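(* Let $d\ge 1$, $0<\alpha<2$, and let $\{X_t\}_{t\in\mathbb{Z}^d}$ be a stationary $S\alpha S$ random field generated by a nonsingular $\mathbb{Z}^d$-action $\{\phi_t\}_{t\in\mathbb{Z}^d}$ on $(S,\mathcal S,\mu)$; that is, $\{X_t\}$ has an integral representation $X_t\stackrel{d}{=}\int_S f_t\,dM$, $t\in\mathbb{Z}^d$, with $$f_t(s)=c_t(s)\Big(\frac{d\mu\circ\phi_t}{d\mu}(s)\Big)^{1/\alpha} f\circ\phi_t(s),\qquad t\in\mathbb{Z}^d,$$ where $f\in L^\alpha(S,\mu)$, $\{c_t\}$ is a measurable $\{-1,+1\}$-valued cocycle for $\{\phi_t\}$, and the full support condition $\mathrm{Support}(f_t,\,t\in\mathbb{Z}^d)=S$ holds. Let $\mathcal C$ and $\mathcal D$ be the conservative and dissipative parts of $\{\phi_t\}$. Then $$\mathcal C=\Big\{s\in S:\sum_{t\in\mathbb{Z}^d}|f_t(s)|^\alpha=\infty\Big\}\ \text{ mod }\mu,\qquad \mathcal D=\Big\{s\in S:\sum_{t\in\mathbb{Z}^d}|f_t(s)|^\alpha<\infty\Big\}\ \text{ mod }\mu .$$ In particular, if a stationary $S\alpha S$ random field $\{X_t\}_{t\in\mathbb{Z}^d}$ is generated by a conservative (respectively dissipative) $\mathbb{Z}^d$-action, then in any other integral representation $X_t\stackrel{d}{=}\int_{S'} f'_t\,dM'$, $t\in\mathbb{Z}^d$, of $\{X_t\}$ (where $M'$ is an $S\alpha S$ random measure on a standard Borel space $(S',\mathcal S')$ with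 $\sigma$-finite control measure $\mu'$) of the form $$f'_t(s)=c'_t(s)\Big(\frac{d\mu'\circ\phi'_t}{d\mu'}(s)\Big)^{1/\alpha} f'\circ\phi'_t(s),\qquad t\in\mathbb{Z}^d,$$ with $f'\in L^\alpha(S',\mu')$, $\{\phi'_t\}_{t\in\mathbb{Z}^d}$ a nonsingular $\mathbb{Z}^d$-action on $(S',\mathcal S',\mu')$ and $\{c'_t\}$ a measurable $\{-1,+1\}$-valued cocycle for $\{\phi'_t\}$, satisfying the full support condition $\mathrm{Support}(f'_t,\,t\in\mathbb{Z}^d)=S'$, the $\mathbb{Z}^d$-action $\{\phi'_t\}$ must be conservative (respectively dissipative). Hence the classes of stationary $S\alpha S$ random fields generated by conservative and by dissipative actions are disjoint.
   Context: A random field $\{X_t\}_{t\in\mathbb{Z}^d}$ is $S\alpha S$ (symmetric $\alpha$-stable) if every finite real linear combination $\sum_j c_jX_{t_j}$ has a symmetric $\alpha$-stable distribution; it is stationary if $\{X_t\}\stackrel{d}{=}\{X_{t+s}\}$ for all $s\in\mathbb{Z}^d$. Random fields are assumed non-Gaussian throughout (in particular not identically zero). Integral representation: $\{X_t\}\stackrel{d}{=}\{\int_S f_t\,dM\}$ (equality of finite-dimensional distributions), where $(S,\mathcal S)$ is a standard Borel space, $\mu$ is a $\sigma$-finite measure on it, $f_t\in L^\alpha(S,\mu)$ are real-valued, and $M$ is an $S\alpha S$ random measure with control measure $\mu$, i.e. an independently scattered random measure with $E\exp(i\theta\int f\,dM)=\exp(-|\theta|^\alpha\int|f|^\alpha d\mu)$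 for $f\in L^\alpha(\mu)$. $\mathrm{Support}(f_t,t\in\mathbb{Z}^d)=S$ means that $\bigcup_t\{f_t\ne0\}=S$ up to a $\mu$-null set. A group action $\{\phi_t\}_{t\in\mathbb{Z}^d}$ on $S$ is a family of measurable maps $\phi_t:S\to S$ with $\phi_0=\mathrm{id}$ and $\phi_{u+v}=\phi_u\circ\phi_v$; it is nonsingular if $\mu\circ\phi_t\sim\mu$ for all $t$. A cocycle with values in $\{-1,+1\}$ is a family of measurable maps $c_t:S\to\{-1,+1\}$ such that for all $u,v$, $c_{u+v}(s)=c_v(s)c_u(\phi_v(s))$ for $\mu$-a.a. $s$. A set $W\in\mathcal S$ is wandering if the sets $\phi_t(W)$, $t\in\mathbb{Z}^d$, are pairwise disjoint. There is a decomposition (unique mod $\mu$) $S=\mathcal C\cup\mathcal D$ into disjoint invariant measurable sets such that $\mathcal D=\bigcup_t\phi_t(W_* )$ for some wandering set $W_*$ and $\mathcal C$ has no wandering subset of positive measure; $\mathcal C$ is the conservative part and $\mathcal D$ the dissipative part. The action is conservative if $S=\mathcal C$ and dissipative if $S=\mathcal D$. Statements about sets hold up to $\mu$-null sets. *)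

theory Defs
  imports "HOL-Probability.Probability"
begin

section \<open>Random fields\<close>

text \<open>Random variables on a probability space \<open>P\<close> are real-valued measurable functions.
  The index set \<open>\<int>\<^sup>d\<close> is the type \<open>int ^ 'd\<close> with \<open>'d\<close> an arbitrary (nonempty) finite type.\<close>

definition random_field :: "'w measure \<Rightarrow> ('t \<Rightarrow> 'w \<Rightarrow> real) \<Rightarrow> bool" where
  "random_field P X \<longleftrightarrow> prob_space P \<and> (\<forall>t. X t \<in> borel_measurable P)"

definition fdd_equal ::
    "'w measure \<Rightarrow> ('t \<Rightarrow> 'w \<Rightarrow> real) \<Rightarrow> 'v measure \<Rightarrow> ('t \<Rightarrow> 'v \<Rightarrow> real) \<Rightarrow> bool" where
  "fdd_equal P X Q Y \<longleftrightarrow>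
     (\<forall>J. finite J \<longrightarrow>
        distr P (\<Pi>\<^sub>M t\<in>J. borel) (\<lambda>\<omega>. \<lambda>t\<in>J. X t \<omega>) =
        distr Q (\<Pi>\<^sub>M t\<in>J. borel) (\<lambda>\<omega>. \<lambda>t\<in>J. Y t \<omega>))"

definition stationary_field :: "'w measure \<Rightarrow> ((int ^ 'd) \<Rightarrow> 'w \<Rightarrow> real) \<Rightarrow> bool" where
  "stationary_field P X \<longleftrightarrow> (\<forall>s. fdd_equal P X P (\<lambda>t. X (t + s)))"

text \<open>Symmetric \<open>\<alpha>\<close>-stable laws are given by their characteristic function
  \<open>exp (- \<sigma>\<^sup>\<alpha> \<bar>\<theta>\<bar>\<^sup>\<alpha>)\<close>; the degenerate law at \<open>0\<close> (scale \<open>\<sigma> = 0\<close>) is included.\<close>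

definition sas_law :: "real \<Rightarrow> real measure \<Rightarrow> bool" where
  "sas_law \<alpha> L \<longleftrightarrow>
     (\<exists>\<sigma>\<ge>0. \<forall>\<theta>. char L \<theta> = of_real (exp (- (\<sigma> powr \<alpha>) * \<bar>\<theta>\<bar> powr \<alpha>)))"

definition sas_field :: "real \<Rightarrow> 'w measure \<Rightarrow> ('t \<Rightarrow> 'w \<Rightarrow> real) \<Rightarrow> bool" where
  "sas_field \<alpha> P X \<longleftrightarrow> random_field P X \<and>
     (\<forall>J c. finite J \<longrightarrow> sas_law \<alpha> (distr P borel (\<lambda>\<omega>. \<Sum>t\<in>J. c t * X t \<omega>)))"

text \<open>Gaussian laws may be degenerate, so the identically zero field is Gaussian.\<close>

definition gaussian_law :: "real measure \<Rightarrow> bool" where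
  "gaussian_law L \<longleftrightarrow>
     (\<exists>m. \<exists>v\<ge>0. \<forall>\<theta>. char L \<theta> = iexp (m * \<theta>) * of_real (exp (- v * \<theta>\<^sup>2 / 2)))"

definition gaussian_field :: "'w measure \<Rightarrow> ('t \<Rightarrow> 'w \<Rightarrow> real) \<Rightarrow> bool" where
  "gaussian_field P X \<longleftrightarrow> random_field P X \<and>
     (\<forall>J c. finite J \<longrightarrow> gaussian_law (distr P borel (\<lambda>\<omega>. \<Sum>t\<in>J. c t * X t \<omega>)))"

definition stationary_sas_field ::
    "real \<Rightarrow> 'w measure \<Rightarrow> ((int ^ 'd) \<Rightarrow> 'w \<Rightarrow> real) \<Rightarrow> bool" where
  "stationary_sas_field \<alpha> P X \<longleftrightarrow>
     sas_field \<alpha> P X \<and> stationary_field P X \<and> \<not> gaussian_field P X"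

section \<open>Stable random measures and stochastic integrals\<close>

definition standard_borel :: "'s measure \<Rightarrow> bool" where
  "standard_borel \<mu> \<longleftrightarrow>
     (\<exists>T. topspace T = space \<mu> \<and> completely_metrizable_space T \<and> separable_space T \<and>
          sets \<mu> = sigma_sets (space \<mu>) {U. openin T U})"

definition L_space :: "real \<Rightarrow> 's measure \<Rightarrow> ('s \<Rightarrow> real) set" where
  "L_space \<alpha> \<mu> = {f \<in> borel_measurable \<mu>. integrable \<mu> (\<lambda>s. \<bar>f s\<bar> powr \<alpha>)}"

text \<open>A random measure \<open>M\<close> assigns random variables on \<open>Q\<close> to the sets of finite
  \<open>\<mu>\<close>-measure; its values on other sets are irrelevant.\<close>

definition independently_scattered ::
    "'s measure \<Rightarrow> 'v measure \<Rightarrow> ('s set \<Rightarrow> 'v \<Rightarrow> real) \<Rightarrow> bool" where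
  "independently_scattered \<mu> Q M \<longleftrightarrow> prob_space Q \<and>
     (\<forall>A \<in> sets \<mu>. emeasure \<mu> A < \<infinity> \<longrightarrow> M A \<in> borel_measurable Q) \<and>
     (\<forall>A :: nat \<Rightarrow> 's set.
        range A \<subseteq> {B \<in> sets \<mu>. emeasure \<mu> B < \<infinity>} \<and> disjoint_family A \<longrightarrow>
        prob_space.indep_vars Q (\<lambda>_. borel) (\<lambda>n. M (A n)) UNIV \<and>
        (emeasure \<mu> (\<Union>n. A n) < \<infinity> \<longrightarrow>
           (AE \<omega> in Q. (\<lambda>n. M (A n) \<omega>) sums M (\<Union>n. A n) \<omega>)))"

definition simple_stoch_integral ::
    "'s measure \<Rightarrow> ('s set \<Rightarrow> 'v \<Rightarrow> real) \<Rightarrow> ('s \<Rightarrow> real) \<Rightarrow> 'v \<Rightarrow> real" where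
  "simple_stoch_integral \<mu> M g \<omega> =
     (\<Sum>y \<in> g ` space \<mu> - {0}. y * M (g -` {y} \<inter> space \<mu>) \<omega>)"

text \<open>\<open>stoch_integral \<alpha> \<mu> Q M f Y\<close>: the random variable \<open>Y\<close> is a version of \<open>\<integral> f dM\<close>, that is,
  the limit in probability of the integrals of simple functions approximating \<open>f\<close> in
  \<open>L\<^sup>\<alpha>(\<mu>)\<close>.\<close>

definition stoch_integral ::
    "real \<Rightarrow> 's measure \<Rightarrow> 'v measure \<Rightarrow> ('s set \<Rightarrow> 'v \<Rightarrow> real) \<Rightarrow>
     ('s \<Rightarrow> real) \<Rightarrow> ('v \<Rightarrow> real) \<Rightarrow> bool" where
  "stoch_integral \<alpha> \<mu> Q M f Y \<longleftrightarrow>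
     f \<in> L_space \<alpha> \<mu> \<and> Y \<in> borel_measurable Q \<and>
     (\<exists>g :: nat \<Rightarrow> 's \<Rightarrow> real.
        (\<forall>n. simple_function \<mu> (g n) \<and> emeasure \<mu> {s \<in> space \<mu>. g n s \<noteq> 0} < \<infinity>) \<and>
        (\<lambda>n. \<integral>\<^sup>+ s. ennreal (\<bar>g n s - f s\<bar> powr \<alpha>) \<partial>\<mu>) \<longlonglongrightarrow> 0 \<and>
        (\<forall>\<epsilon>>0. (\<lambda>n. measure Q
            {\<omega> \<in> space Q. \<bar>simple_stoch_integral \<mu> M (g n) \<omega> - Y \<omega>\<bar> > \<epsilon>}) \<longlonglongrightarrow> 0))"

text \<open>In the following definition \<open>f\<close> may be the indicator of a set \<open>A\<close> of finite measure, which
  gives the law of \<open>M A\<close>.\<close>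

definition sas_random_measure ::
    "real \<Rightarrow> 's measure \<Rightarrow> 'v measure \<Rightarrow> ('s set \<Rightarrow> 'v \<Rightarrow> real) \<Rightarrow> bool" where
  "sas_random_measure \<alpha> \<mu> Q M \<longleftrightarrow> independently_scattered \<mu> Q M \<and>
     (\<forall>f \<in> L_space \<alpha> \<mu>. \<forall>Y. stoch_integral \<alpha> \<mu> Q M f Y \<longrightarrow>
        (\<forall>\<theta>. char (distr Q borel Y) \<theta> =
              of_real (exp (- (\<bar>\<theta>\<bar> powr \<alpha>) * (\<integral>s. \<bar>f s\<bar> powr \<alpha> \<partial>\<mu>)))))"

definition integral_representation ::
    "real \<Rightarrow> 'w measure \<Rightarrow> ('t \<Rightarrow> 'w \<Rightarrow> real) \<Rightarrow> 's measure \<Rightarrow> 'v measure \<Rightarrow>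
     ('s set \<Rightarrow> 'v \<Rightarrow> real) \<Rightarrow> ('t \<Rightarrow> 's \<Rightarrow> real) \<Rightarrow> bool" where
  "integral_representation \<alpha> P X \<mu> Q M f \<longleftrightarrow>
     standard_borel \<mu> \<and> sigma_finite_measure \<mu> \<and>
     (\<forall>t. f t \<in> L_space \<alpha> \<mu>) \<and> sas_random_measure \<alpha> \<mu> Q M \<and>
     (\<exists>Y. (\<forall>t. stoch_integral \<alpha> \<mu> Q M (f t) (Y t)) \<and> fdd_equal P X Q Y)"

section \<open>Nonsingular actions\<close>

definition group_action ::
    "'s measure \<Rightarrow> ((int ^ 'd) \<Rightarrow> 's \<Rightarrow> 's) \<Rightarrow> bool" where
  "group_action \<mu> \<phi> \<longleftrightarrow>
     (\<forall>t. \<phi> t \<in> measurable \<mu> \<mu>) \<and>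
     (\<forall>s \<in> space \<mu>. \<phi> 0 s = s) \<and>
     (\<forall>u v. \<forall>s \<in> space \<mu>. \<phi> (u + v) s = \<phi> u (\<phi> v s))"

text \<open>For an invertible bimeasurable map \<open>\<psi>\<close>, this is the measure \<open>\<mu> \<circ> \<psi>\<close> with
  \<open>(\<mu> \<circ> \<psi>) A = \<mu> (\<psi> A)\<close>.\<close>

definition measure_comp :: "'s measure \<Rightarrow> ('s \<Rightarrow> 's) \<Rightarrow> 's measure" where
  "measure_comp \<mu> \<psi> = measure_of (space \<mu>) (sets \<mu>) (\<lambda>A. emeasure \<mu> (\<psi> ` A))"

lemma group_action_measure_comp:
  assumes "group_action \<mu> \<phi>"
  shows "measure_comp \<mu> (\<phi> t) = distr \<mu> \<mu> (\<phi> (- t))"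
proof -
  have m: "\<phi> u \<in> measurable \<mu> \<mu>" for u
    using assms by (simp add: group_action_def)
  have inv: "\<phi> (- u) (\<phi> u s) = s" "\<phi> u (\<phi> (- u) s) = s" if "s \<in> space \<mu>" for u s
    using assms that unfolding group_action_def
    by (metis add.left_inverse, metis add.right_inverse)
  have "\<phi> t ` A = \<phi> (- t) -` A \<inter> space \<mu>" if "A \<in> sets \<mu>" for A
  proof -
    have A: "A \<subseteq> space \<mu>" using that by (rule sets.sets_into_space)
    show ?thesis
    proof (intro equalityI subsetI)
      fix x assume "x \<in> \<phi> t ` A"
      then obtain a where "a \<in> A" "x = \<phi> t a" by blast
      then show "x \<in> \<phi> (- t) -` A \<inter> space \<mu>"
        using A inv(1)[of a t] measurable_space[OF m[of t], of a] by auto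
    next
      fix x assume "x \<in> \<phi> (- t) -` A \<inter> space \<mu>"
      then show "x \<in> \<phi> t ` A"
        using inv(2)[of x t] by (metis IntE imageI vimageE)
    qed
  qed
  then show ?thesis
    unfolding measure_comp_def distr_def
    by (intro measure_of_eq) (auto simp: sets.space_closed sets.sigma_sets_eq)
qed

definition nonsingular_action ::
    "'s measure \<Rightarrow> ((int ^ 'd) \<Rightarrow> 's \<Rightarrow> 's) \<Rightarrow> bool" where
  "nonsingular_action \<mu> \<phi> \<longleftrightarrow> group_action \<mu> \<phi> \<and>
     (\<forall>t. absolutely_continuous \<mu> (measure_comp \<mu> (\<phi> t)) \<and>
          absolutely_continuous (measure_comp \<mu> (\<phi> t)) \<mu>)"

definition cocycle ::
    "'s measure \<Rightarrow> ((int ^ 'd) \<Rightarrow> 's \<Rightarrow> 's) \<Rightarrow> ((int ^ 'd) \<Rightarrow> 's \<Rightarrow> real) \<Rightarrow> bool" where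
  "cocycle \<mu> \<phi> c \<longleftrightarrow>
     (\<forall>t. c t \<in> borel_measurable \<mu> \<and> (\<forall>s \<in> space \<mu>. c t s \<in> {- 1, 1})) \<and>
     (\<forall>u v. AE s in \<mu>. c (u + v) s = c v s * c u (\<phi> v s))"

definition eq_mod :: "'s measure \<Rightarrow> 's set \<Rightarrow> 's set \<Rightarrow> bool" where
  "eq_mod \<mu> A B \<longleftrightarrow> (AE s in \<mu>. s \<in> A \<longleftrightarrow> s \<in> B)"

definition wandering ::
    "'s measure \<Rightarrow> ((int ^ 'd) \<Rightarrow> 's \<Rightarrow> 's) \<Rightarrow> 's set \<Rightarrow> bool" where
  "wandering \<mu> \<phi> W \<longleftrightarrow> W \<in> sets \<mu> \<and> disjoint_family (\<lambda>t. \<phi> t ` W)"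

text \<open>\<open>C\<close> and \<open>D\<close> are a choice of the conservative and dissipative parts, which are only
  determined up to null sets.\<close>

definition hopf_decomposition ::
    "'s measure \<Rightarrow> ((int ^ 'd) \<Rightarrow> 's \<Rightarrow> 's) \<Rightarrow> 's set \<Rightarrow> 's set \<Rightarrow> bool" where
  "hopf_decomposition \<mu> \<phi> C D \<longleftrightarrow>
     C \<in> sets \<mu> \<and> D \<in> sets \<mu> \<and> C \<inter> D = {} \<and> C \<union> D = space \<mu> \<and>
     (\<forall>t. \<phi> t ` C = C) \<and> (\<forall>t. \<phi> t ` D = D) \<and>
     (\<exists>W. wandering \<mu> \<phi> W \<and> D = (\<Union>t. \<phi> t ` W)) \<and>
     (\<forall>W. wandering \<mu> \<phi> W \<and> W \<subseteq> C \<longrightarrow> emeasure \<mu> W = 0)"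

definition conservative_action ::
    "'s measure \<Rightarrow> ((int ^ 'd) \<Rightarrow> 's \<Rightarrow> 's) \<Rightarrow> bool" where
  "conservative_action \<mu> \<phi> \<longleftrightarrow>
     (\<exists>C D. hopf_decomposition \<mu> \<phi> C D \<and> eq_mod \<mu> (space \<mu>) C)"

definition dissipative_action ::
    "'s measure \<Rightarrow> ((int ^ 'd) \<Rightarrow> 's \<Rightarrow> 's) \<Rightarrow> bool" where
  "dissipative_action \<mu> \<phi> \<longleftrightarrow>
     (\<exists>C D. hopf_decomposition \<mu> \<phi> C D \<and> eq_mod \<mu> (space \<mu>) D)"

section \<open>Fields generated by actions\<close>

text \<open>The field \<open>X\<close> has the integral representation \<open>f\<close> generated by the action \<open>\<phi>\<close>, the cocycle
  \<open>c\<close> and the function \<open>h \<in> L\<^sup>\<alpha>(\<mu>)\<close>. The kernels \<open>f t\<close> and the Radon--Nikodym derivatives are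
  only determined almost everywhere.\<close>

definition generated_representation ::
    "real \<Rightarrow> 'w measure \<Rightarrow> ((int ^ 'd) \<Rightarrow> 'w \<Rightarrow> real) \<Rightarrow> 's measure \<Rightarrow> 'v measure \<Rightarrow>
     ('s set \<Rightarrow> 'v \<Rightarrow> real) \<Rightarrow> ((int ^ 'd) \<Rightarrow> 's \<Rightarrow> 's) \<Rightarrow> ((int ^ 'd) \<Rightarrow> 's \<Rightarrow> real) \<Rightarrow>
     ('s \<Rightarrow> real) \<Rightarrow> ((int ^ 'd) \<Rightarrow> 's \<Rightarrow> real) \<Rightarrow> bool" where
  "generated_representation \<alpha> P X \<mu> Q M \<phi> c h f \<longleftrightarrow>
     integral_representation \<alpha> P X \<mu> Q M f \<and>
     nonsingular_action \<mu> \<phi> \<and> cocycle \<mu> \<phi> c \<and> h \<in> L_space \<alpha> \<mu> \<and>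
     (\<forall>t. AE s in \<mu>. f t s =
        c t s * enn2real (RN_deriv \<mu> (measure_comp \<mu> (\<phi> t)) s) powr (1 / \<alpha>) * h (\<phi> t s)) \<and>
     eq_mod \<mu> (\<Union>t. {s \<in> space \<mu>. f t s \<noteq> 0}) (space \<mu>)"

text \<open>The classes of stationary \<open>S\<alpha>S\<close> random fields generated by conservative and by dissipative
  actions. The type argument names the type of the points of \<open>S\<close> and the type of the sample
  points of the random measure, over which one cannot quantify inside a formula.\<close>

definition conservative_fields ::
    "('s \<times> 'v) itself \<Rightarrow> real \<Rightarrow> ('w measure \<times> ((int ^ 'd) \<Rightarrow> 'w \<Rightarrow> real)) set" where
  "conservative_fields _ \<alpha> =
     {(P, X). stationary_sas_field \<alpha> P X \<and>
        (\<exists>(\<mu> :: 's measure) (Q :: 'v measure) M \<phi> c h f.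
           generated_representation \<alpha> P X \<mu> Q M \<phi> c h f \<and> conservative_action \<mu> \<phi>)}"

definition dissipative_fields ::
    "('s \<times> 'v) itself \<Rightarrow> real \<Rightarrow> ('w measure \<times> ((int ^ 'd) \<Rightarrow> 'w \<Rightarrow> real)) set" where
  "dissipative_fields _ \<alpha> =
     {(P, X). stationary_sas_field \<alpha> P X \<and>
        (\<exists>(\<mu> :: 's measure) (Q :: 'v measure) M \<phi> c h f.
           generated_representation \<alpha> P X \<mu> Q M \<phi> c h f \<and> dissipative_action \<mu> \<phi>)}"

end

theory Submission
  imports Defs
begin

text \<open>Put \<open>G\<^sub>t = \<bar>f\<^sub>t\<bar>\<^sup>\<alpha>\<close> and let \<open>w\<^sub>t\<close> be the Radon--Nikodym derivative of \<open>\<mu> \<circ> \<phi>\<^sub>t\<close>, so that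
  \<open>G\<^bsub>u+t\<^esub>(s) = w\<^sub>t(s) G\<^sub>u(\<phi>\<^sub>t s)\<close>. A wandering set has \<open>\<integral>\<Sum>\<^sub>t G\<^sub>t \<le> \<integral>G\<^sub>0 < \<infinity>\<close>, hence lies in
  \<open>L = {\<Sum>\<^sub>t G\<^sub>t < \<infinity>}\<close>. Conversely, where a nonzero family \<open>(G\<^sub>t)\<close> tends to \<open>0\<close>, the points at which
  \<open>G\<^sub>0\<close> is maximal along the orbit are visited finitely often, and choosing the last visit yields a
  wandering set. So \<open>L\<close> is the dissipative part.

  For the rigidity, let \<open>\<beta> = 2/\<alpha> > 1\<close>. Averaging \<open>\<integral>\<bar>\<Sum>\<^sub>t c\<^sub>t f\<^sub>t\<bar>\<^sup>\<alpha> d\<mu>\<close>, which is determined by the law of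
  the field, over independent Gaussian \<open>c\<^sub>t\<close> shows that the law determines
  \<open>\<integral>(\<Sum>\<^bsub>t\<in>T\<^esub> G\<^sub>t\<^sup>\<beta>)\<^bsup>1/\<beta>\<^esup> d\<mu>\<close> for all finite \<open>T\<close>. By equivariance this is the sum over \<open>t \<in> T\<close> of
  \<open>\<integral>G\<^sub>0 (G\<^sub>0\<^sup>\<beta> / \<Sum>\<^bsub>u\<in>T-t\<^esub> G\<^sub>u\<^sup>\<beta>)\<^bsup>1-1/\<beta>\<^esup> d\<mu>\<close>. For \<open>T\<close> a large box in the sublattice \<open>k\<int>\<^sup>d\<close>, dividing by the
  number of points gives in the limit the same integral with the sum over all of \<open>k\<int>\<^sup>d\<close>. Off \<open>L\<close> that
  sum is infinite wherever \<open>G\<^sub>0 \<noteq> 0\<close>, while on \<open>L\<close> its terms with \<open>u \<noteq> 0\<close> vanish as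
  \<open>k \<rightarrow> \<infinity>\<close>. Hence the law determines \<open>\<integral>\<^sub>L G\<^sub>0 d\<mu>\<close>, which is \<open>0\<close> iff the action is conservative and
  \<open>\<integral>G\<^sub>0 d\<mu>\<close> iff it is dissipative.\<close>

section \<open>The lattice \<open>\<int>\<^sup>d\<close>\<close>

definition lattice_box :: "nat \<Rightarrow> (int ^ 'd) set" where
  "lattice_box m = {t. \<forall>i. \<bar>t $ i\<bar> \<le> int m}"

lemma bij_betw_vec_nth_PiE:
  "bij_betw vec_nth {t :: 'a ^ 'd. \<forall>i. t $ i \<in> A} (UNIV \<rightarrow>\<^sub>E A)"
  by (rule bij_betwI[where g = vec_lambda]) (auto simp: vec_eq_iff)

lemma finite_vec_set: "finite A \<Longrightarrow> finite {t :: 'a ^ 'd. \<forall>i. t $ i \<in> A}"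
  using bij_betw_finite[OF bij_betw_vec_nth_PiE, of A] by (simp add: finite_PiE)

lemma card_vec_set: "card {t :: 'a ^ 'd. \<forall>i. t $ i \<in> A} = card A ^ CARD('d)"
  using bij_betw_same_card[OF bij_betw_vec_nth_PiE, of A] by (simp add: card_PiE)

lemma lattice_box_altdef: "lattice_box m = {t. \<forall>i. t $ i \<in> {- int m..int m}}"
  unfolding lattice_box_def by (auto simp: abs_le_iff minus_le_iff)

lemma finite_lattice_box [simp]: "finite (lattice_box m)"
  unfolding lattice_box_altdef by (rule finite_vec_set) simp

lemma card_lattice_box: "card (lattice_box m :: (int ^ 'd) set) = (2 * m + 1) ^ CARD('d)"
  unfolding lattice_box_altdef card_vec_set by (simp add: nat_add_distrib nat_mult_distrib)

lemma zero_in_lattice_box [simp]: "0 \<in> lattice_box m"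
  by (simp add: lattice_box_def)

lemma lattice_box_mono: "m \<le> n \<Longrightarrow> lattice_box m \<subseteq> lattice_box n"
  unfolding lattice_box_def by (auto intro: order_trans)

lemma finite_subset_lattice_box:
  assumes "finite (T :: (int ^ 'd) set)"
  obtains m where "T \<subseteq> lattice_box m"
proof -
  define m where "m = Max ((\<lambda>(t, i). nat \<bar>t $ i\<bar>) ` (T \<times> UNIV))"
  have "\<bar>t $ i\<bar> \<le> int m" if "t \<in> T" for t i
  proof -
    have "nat \<bar>t $ i\<bar> \<le> m"
      unfolding m_def using assms that
      by (intro Max_ge) (auto intro!: image_eqI[of _ _ "(t, i)"])
    then show ?thesis by linarith
  qed
  then have "T \<subseteq> lattice_box m"
    unfolding lattice_box_def by blast
  then show thesis by (rule that)
qed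

text \<open>Boxes exhaust the finite subsets of the lattice. Both quantifiers on the right range
  over countable types, so sets defined by summability along an orbit become measurable.\<close>

lemma summable_on_iff_lattice_box:
  fixes f :: "int ^ 'd \<Rightarrow> real"
  assumes "\<And>t. 0 \<le> f t"
  shows "f summable_on UNIV \<longleftrightarrow> (\<exists>N :: nat. \<forall>m. sum f (lattice_box m) \<le> real N)"
proof
  assume f: "f summable_on UNIV"
  obtain N where "infsum f UNIV \<le> real N"
    using real_arch_simple by blast
  moreover have "sum f (lattice_box m) \<le> infsum f UNIV" for m
    using f assms by (intro finite_sum_le_infsum) auto
  ultimately show "\<exists>N :: nat. \<forall>m. sum f (lattice_box m) \<le> real N"
    by (meson order_trans)
next
  assume "\<exists>N :: nat. \<forall>m. sum f (lattice_box m) \<le> real N"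
  then obtain N :: nat where N: "\<And>m. sum f (lattice_box m) \<le> real N"
    by blast
  have bound: "sum f T \<le> real N" if "finite T" for T
  proof -
    obtain m where "T \<subseteq> lattice_box m"
      using finite_subset_lattice_box \<open>finite T\<close> by blast
    then have "sum f T \<le> sum f (lattice_box m)"
      using assms by (intro sum_mono2) auto
    then show ?thesis using N[of m] by linarith
  qed
  show "f summable_on UNIV"
    using assms by (intro nonneg_bdd_above_summable_on bdd_aboveI[of _ "real N"]) (auto intro: bound)
qed

text \<open>Each index in the superlevel set contributes at least \<open>c\<close> to a finite
  total, which caps their number.\<close>

lemma summable_on_finite_superlevel:
  fixes f :: "'a \<Rightarrow> real"
  assumes "f summable_on UNIV" "\<And>t. 0 \<le> f t" "0 < c"
  shows "finite {t. c \<le> f t}"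
proof (rule ccontr)
  assume inf: "infinite {t. c \<le> f t}"
  obtain n :: nat where n: "infsum f UNIV / c < real n"
    using reals_Archimedean2 by blast
  obtain T where T: "T \<subseteq> {t. c \<le> f t}" "finite T" "card T = n"
    using infinite_arbitrarily_large[OF inf] by blast
  have "real n * c \<le> sum f T"
    using sum_bounded_below[of T c f] T by auto
  also have "\<dots> \<le> infsum f UNIV"
    using assms T by (intro finite_sum_le_infsum) auto
  finally show False
    using n \<open>0 < c\<close> by (simp add: field_simps)
qed

text \<open>Positive cone of the lexicographic order. The index type is only known to be finite, so
  coordinates are ranked by \<open>to_nat\<close>.\<close>

definition lex_pos :: "int ^ 'd \<Rightarrow> bool" where
  "lex_pos t \<longleftrightarrow> (\<exists>i. 0 < t $ i \<and> (\<forall>j. to_nat j < to_nat i \<longrightarrow> t $ j = 0))"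

lemma lex_pos_total:
  assumes "t \<noteq> 0"
  shows "lex_pos t \<or> lex_pos (- t)"
proof -
  obtain i0 where "t $ i0 \<noteq> 0"
    using assms by (metis vec_eq_iff zero_index)
  define i where "i = arg_min to_nat (\<lambda>i. t $ i \<noteq> 0)"
  have i: "t $ i \<noteq> 0"
    unfolding i_def by (rule arg_min_natI) fact
  have less: "t $ j = 0" if "to_nat j < to_nat i" for j
    using arg_min_nat_le[of "\<lambda>i. t $ i \<noteq> 0" j to_nat] that
    unfolding i_def by (meson not_le)
  show ?thesis
  proof (cases "0 < t $ i")
    case True
    then show ?thesis using less unfolding lex_pos_def by blast
  next
    case False
    then have "0 < (- t) $ i" using i by simp
    moreover have "(- t) $ j = 0" if "to_nat j < to_nat i" for j
      using less[OF that] by simp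
    ultimately show ?thesis unfolding lex_pos_def by blast
  qed
qed

lemma lex_pos_add:
  assumes "lex_pos s" "lex_pos t"
  shows "lex_pos (s + t)"
proof -
  obtain i j where i: "0 < s $ i" "\<And>k. to_nat k < to_nat i \<Longrightarrow> s $ k = 0"
    and j: "0 < t $ j" "\<And>k. to_nat k < to_nat j \<Longrightarrow> t $ k = 0"
    using assms unfolding lex_pos_def by blast
  consider "to_nat i < to_nat j" | "i = j" | "to_nat j < to_nat i"
    using less_linear[of "to_nat i" "to_nat j"] by fastforce
  then show ?thesis
    unfolding lex_pos_def
  proof cases
    case 1
    then show "\<exists>i. 0 < (s + t) $ i \<and> (\<forall>j. to_nat j < to_nat i \<longrightarrow> (s + t) $ j = 0)"
      using i j by (intro exI[of _ i]) auto
  next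
    case 2
    then show "\<exists>i. 0 < (s + t) $ i \<and> (\<forall>j. to_nat j < to_nat i \<longrightarrow> (s + t) $ j = 0)"
      using i j by (intro exI[of _ i]) auto
  next
    case 3
    then show "\<exists>i. 0 < (s + t) $ i \<and> (\<forall>j. to_nat j < to_nat i \<longrightarrow> (s + t) $ j = 0)"
      using i j by (intro exI[of _ j]) auto
  qed
qed

lemma not_lex_pos_0 [simp]: "\<not> lex_pos 0"
  by (simp add: lex_pos_def)

text \<open>The order puts \<open>s\<close> before \<open>t\<close> if
  \<open>lex_pos (t - s)\<close>. Additivity of the cone gives transitivity and, as \<open>0\<close>
  is not in the cone, asymmetry.\<close>

lemma lex_max_exists:
  assumes "finite A" "A \<noteq> {}"
  shows "\<exists>m\<in>A. \<forall>t. lex_pos t \<longrightarrow> m + t \<notin> A"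
proof -
  have asym: "asymp_on A (\<lambda>s t. lex_pos (t - s))"
  proof (rule asymp_onI)
    fix s t :: "int ^ 'd"
    assume "lex_pos (t - s)"
    then show "\<not> lex_pos (s - t)"
      using lex_pos_add[of "t - s" "s - t"] by auto
  qed
  have trans: "transp_on A (\<lambda>s t. lex_pos (t - s))"
  proof (rule transp_onI)
    fix s t u :: "int ^ 'd"
    assume "lex_pos (t - s)" "lex_pos (u - t)"
    then show "lex_pos (u - s)"
      using lex_pos_add[of "t - s" "u - t"] by simp
  qed
  obtain m where m: "m \<in> A" "\<And>t. t \<in> A \<Longrightarrow> t \<noteq> m \<Longrightarrow> \<not> lex_pos (t - m)"
    using Finite_Set.bex_max_element[OF assms(1) asym trans assms(2)] by blast
  have "m + t \<notin> A" if "lex_pos t" for t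
    using m(2)[of "m + t"] that by (cases "t = 0") auto
  then show ?thesis using m(1) by blast
qed

section \<open>Wandering sets from finite return times\<close>

lemma group_action_facts:
  assumes "group_action \<mu> \<phi>"
  shows "\<phi> t \<in> measurable \<mu> \<mu>"
    and "s \<in> space \<mu> \<Longrightarrow> \<phi> t s \<in> space \<mu>"
    and "s \<in> space \<mu> \<Longrightarrow> \<phi> 0 s = s"
    and "s \<in> space \<mu> \<Longrightarrow> \<phi> u (\<phi> v s) = \<phi> (u + v) s"
    and "s \<in> space \<mu> \<Longrightarrow> \<phi> (- t) (\<phi> t s) = s"
    and "s \<in> space \<mu> \<Longrightarrow> \<phi> t (\<phi> (- t) s) = s"
proof -
  show m: "\<phi> t \<in> measurable \<mu> \<mu>" for t
    using assms by (simp add: group_action_def)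
  show "s \<in> space \<mu> \<Longrightarrow> \<phi> t s \<in> space \<mu>"
    using measurable_space[OF m] .
  show 0: "s \<in> space \<mu> \<Longrightarrow> \<phi> 0 s = s"
    using assms by (simp add: group_action_def)
  show add: "s \<in> space \<mu> \<Longrightarrow> \<phi> u (\<phi> v s) = \<phi> (u + v) s" for u v
    using assms by (simp add: group_action_def)
  show "s \<in> space \<mu> \<Longrightarrow> \<phi> (- t) (\<phi> t s) = s" "s \<in> space \<mu> \<Longrightarrow> \<phi> t (\<phi> (- t) s) = s"
    using 0 add[of "- t" t] add[of t "- t"] by simp_all
qed

lemma group_action_image:
  assumes "group_action \<mu> \<phi>" "A \<subseteq> space \<mu>"
  shows "\<phi> t ` A = {s \<in> space \<mu>. \<phi> (- t) s \<in> A}"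
proof (intro equalityI subsetI)
  fix x assume "x \<in> \<phi> t ` A"
  then show "x \<in> {s \<in> space \<mu>. \<phi> (- t) s \<in> A}"
    using assms(2) group_action_facts[OF assms(1)] by auto
next
  fix x assume "x \<in> {s \<in> space \<mu>. \<phi> (- t) s \<in> A}"
  then show "x \<in> \<phi> t ` A"
    using group_action_facts(6)[OF assms(1), of x t] by (auto intro!: image_eqI[of _ _ "\<phi> (- t) x"])
qed

lemma group_action_image_sets:
  assumes "group_action \<mu> \<phi>" "A \<in> sets \<mu>"
  shows "\<phi> t ` A \<in> sets \<mu>"
proof -
  note group_action_facts(1)[OF assms(1), measurable] assms(2)[measurable]
  show ?thesis
    unfolding group_action_image[OF assms(1) sets.sets_into_space[OF assms(2)]]
    by measurable
qed

text \<open>The representative of an orbit is its last visit to \<open>V\<close> in a translation-invariant total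
  order of \<open>\<int>\<^sup>d\<close>.\<close>

lemma wandering_of_finite_returns:
  fixes \<phi> :: "int ^ 'd \<Rightarrow> 's \<Rightarrow> 's"
  assumes act: "group_action \<mu> \<phi>" and V [measurable]: "V \<in> sets \<mu>"
    and fin: "\<And>s. s \<in> space \<mu> \<Longrightarrow> finite {t. \<phi> t s \<in> V}"
  obtains W where "wandering \<mu> \<phi> W" "(\<Union>t. \<phi> t ` W) = (\<Union>t. \<phi> t ` V)"
proof -
  note facts = group_action_facts[OF act]
  note facts(1)[measurable]
  have VS: "V \<subseteq> space \<mu>" by (rule sets.sets_into_space) fact
  define W where "W = {s \<in> space \<mu>. s \<in> V \<and> (\<forall>t\<in>{t. lex_pos t}. \<phi> t s \<notin> V)}"
  have WV: "W \<subseteq> V" by (auto simp: W_def)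
  have Wm: "W \<in> sets \<mu>"
    unfolding W_def by measurable
  have last: "\<phi> t s \<notin> V" if "s \<in> W" "lex_pos t" for s t
    using that by (auto simp: W_def)
  \<comment> \<open>If two translates shared a point, then \<open>b\<close> would be a visit to
    \<open>V\<close> at position \<open>t - u\<close> on the orbit of \<open>a\<close>, after its
    last one.\<close>
  have no_eq: False if a: "a \<in> W" and b: "b \<in> W" and eq: "\<phi> t a = \<phi> u b" and pos: "lex_pos (t - u)"
    for a b t u
  proof -
    have S: "a \<in> space \<mu>" "b \<in> space \<mu>"
      using a b WV VS by auto
    have "b = \<phi> (- u) (\<phi> t a)"
      using facts(5)[OF S(2), of u] eq by simp
    also have "\<dots> = \<phi> (t - u) a"
      using facts(4)[OF S(1), of "- u" t] by simp
    finally have "b \<notin> V"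
      using last[OF a pos] by simp
    then show False
      using b WV by auto
  qed
  have "disjoint_family (\<lambda>t. \<phi> t ` W)"
    unfolding disjoint_family_on_def
  proof (intro ballI impI)
    fix t u :: "int ^ 'd" assume "t \<noteq> u"
    then have "lex_pos (t - u) \<or> lex_pos (u - t)"
      using lex_pos_total[of "t - u"] by simp
    then show "\<phi> t ` W \<inter> \<phi> u ` W = {}"
    proof
      assume pos: "lex_pos (t - u)"
      show ?thesis
        using no_eq[of _ _ t u, OF _ _ _ pos] by fastforce
    next
      assume pos: "lex_pos (u - t)"
      show ?thesis
        using no_eq[of _ _ u t, OF _ _ _ pos] by fastforce
    qed
  qed
  moreover have "(\<Union>t. \<phi> t ` W) = (\<Union>t. \<phi> t ` V)"
  proof (intro equalityI subsetI)
    fix x assume "x \<in> (\<Union>t. \<phi> t ` V)"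
    then obtain t s where s: "s \<in> V" "x = \<phi> t s" by auto
    have S: "s \<in> space \<mu>" using s VS by auto
    have "0 \<in> {t. \<phi> t s \<in> V}" using facts(3)[OF S] s by simp
    then obtain m where m: "\<phi> m s \<in> V" "\<And>t. lex_pos t \<Longrightarrow> \<phi> (m + t) s \<notin> V"
      using lex_max_exists[OF fin[OF S]] by auto
    have "\<phi> m s \<in> W"
      using m S facts(2)[OF S] facts(4)[OF S, of _ m] by (auto simp: W_def add.commute)
    moreover have "x = \<phi> (t - m) (\<phi> m s)"
      using facts(4)[OF S] s(2) by simp
    ultimately show "x \<in> (\<Union>t. \<phi> t ` W)" by blast
  qed (use WV in blast)
  ultimately show thesis
    using Wm by (intro that[of W]) (auto simp: wandering_def)
qed

section \<open>Equivariant functions on a nonsingular action\<close>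

text \<open>\<open>w t\<close> is an everywhere positive version of the Radon--Nikodym derivative,
  and \<open>G t\<close> stands for \<open>\<bar>f t\<bar> powr \<alpha>\<close>. The transformation
  law holds at every point, so arguments along an orbit meet no exceptional sets; only the support
  condition is almost everywhere.\<close>

locale scaled_action =
  fixes \<mu> :: "'s measure" and \<phi> :: "int ^ 'd \<Rightarrow> 's \<Rightarrow> 's"
    and w :: "int ^ 'd \<Rightarrow> 's \<Rightarrow> real" and G :: "int ^ 'd \<Rightarrow> 's \<Rightarrow> real"
  assumes act: "group_action \<mu> \<phi>"
    and w_measurable [measurable]: "\<And>t. w t \<in> borel_measurable \<mu>"
    and w_pos: "\<And>t s. s \<in> space \<mu> \<Longrightarrow> 0 < w t s"
    and density_w: "\<And>t. density \<mu> (\<lambda>s. ennreal (w t s)) = distr \<mu> \<mu> (\<phi> (- t))"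
    and G_measurable [measurable]: "\<And>t. G t \<in> borel_measurable \<mu>"
    and G_nonneg [simp]: "\<And>t s. 0 \<le> G t s"
    and G_translate: "\<And>t u s. s \<in> space \<mu> \<Longrightarrow> G (u + t) s = w t s * G u (\<phi> t s)"
    and G_integrable_0: "integrable \<mu> (G 0)"
    and G_support: "AE s in \<mu>. \<exists>t. G t s \<noteq> 0"
begin

lemmas \<phi>_measurable [measurable] = group_action_facts(1)[OF act]
lemmas \<phi>_space = group_action_facts(2)[OF act]
lemmas \<phi>_add = group_action_facts(4)[OF act]
lemmas \<phi>_inv = group_action_facts(5,6)[OF act]

text \<open>Change of variables: by \<open>density_w\<close> the weight turns \<open>\<mu>\<close>
  into its image under \<open>\<phi> (- t)\<close>, which the composition with
  \<open>\<phi> t\<close> undoes.\<close>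

lemma nn_integral_translate:
  assumes [measurable]: "g \<in> borel_measurable \<mu>"
  shows "(\<integral>\<^sup>+s. ennreal (w t s) * g (\<phi> t s) \<partial>\<mu>) = (\<integral>\<^sup>+s. g s \<partial>\<mu>)"
proof -
  have "(\<integral>\<^sup>+s. ennreal (w t s) * g (\<phi> t s) \<partial>\<mu>)
      = (\<integral>\<^sup>+s. g (\<phi> t s) \<partial>density \<mu> (\<lambda>s. ennreal (w t s)))"
    by (subst nn_integral_density) auto
  also have "\<dots> = (\<integral>\<^sup>+s. g (\<phi> t (\<phi> (- t) s)) \<partial>\<mu>)"
    unfolding density_w by (subst nn_integral_distr) auto
  also have "\<dots> = (\<integral>\<^sup>+s. g s \<partial>\<mu>)"
    by (intro nn_integral_cong) (simp add: \<phi>_inv)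
  finally show ?thesis .
qed

lemma
  fixes g :: "'s \<Rightarrow> real"
  assumes [measurable]: "g \<in> borel_measurable \<mu>"
  shows integral_translate: "(\<integral>s. w t s * g (\<phi> t s) \<partial>\<mu>) = (\<integral>s. g s \<partial>\<mu>)"
    and integrable_translate: "integrable \<mu> (\<lambda>s. w t s * g (\<phi> t s)) \<longleftrightarrow> integrable \<mu> g"
proof -
  have nn: "AE s in \<mu>. 0 \<le> w t s"
    by (auto intro: less_imp_le w_pos)
  have "(\<integral>s. w t s * g (\<phi> t s) \<partial>\<mu>) = (\<integral>s. g (\<phi> t s) \<partial>density \<mu> (\<lambda>s. ennreal (w t s)))"
    by (subst integral_density) (auto intro: nn)
  also have "\<dots> = (\<integral>s. g (\<phi> t (\<phi> (- t) s)) \<partial>\<mu>)"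
    unfolding density_w by (subst integral_distr) auto
  also have "\<dots> = (\<integral>s. g s \<partial>\<mu>)"
    by (intro Bochner_Integration.integral_cong) (auto simp: \<phi>_inv)
  finally show "(\<integral>s. w t s * g (\<phi> t s) \<partial>\<mu>) = (\<integral>s. g s \<partial>\<mu>)" .
  have "integrable \<mu> (\<lambda>s. w t s * g (\<phi> t s))
      \<longleftrightarrow> integrable (density \<mu> (\<lambda>s. ennreal (w t s))) (\<lambda>s. g (\<phi> t s))"
    by (subst integrable_density) (auto intro: nn)
  also have "\<dots> \<longleftrightarrow> integrable \<mu> (\<lambda>s. g (\<phi> t (\<phi> (- t) s)))"
    unfolding density_w by (subst integrable_distr_eq) auto
  also have "\<dots> \<longleftrightarrow> integrable \<mu> g"
    by (intro Bochner_Integration.integrable_cong) (auto simp: \<phi>_inv)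
  finally show "integrable \<mu> (\<lambda>s. w t s * g (\<phi> t s)) \<longleftrightarrow> integrable \<mu> g" .
qed

lemma G_eq: "s \<in> space \<mu> \<Longrightarrow> G t s = w t s * G 0 (\<phi> t s)"
  using G_translate[of s 0 t] by simp

text \<open>For a null set \<open>N\<close>, the weighted indicator of \<open>N\<close> along
  \<open>\<phi> t\<close> has integral zero by the change of variables; positivity of
  \<open>w t\<close> removes the weight.\<close>

lemma AE_translate:
  assumes "AE s in \<mu>. P s"
  shows "AE s in \<mu>. P (\<phi> t s)"
proof -
  obtain N where N: "N \<in> null_sets \<mu>" "{s \<in> space \<mu>. \<not> P s} \<subseteq> N"
    using assms by (auto simp: eventually_ae_filter)
  have [measurable]: "N \<in> sets \<mu>" using N by auto
  have "(\<integral>\<^sup>+s. ennreal (w t s) * indicator N (\<phi> t s) \<partial>\<mu>) = 0"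
    using N nn_integral_translate[of "indicator N" t] by (simp add: null_setsD1)
  then have "AE s in \<mu>. ennreal (w t s) * indicator N (\<phi> t s) = 0"
    by (subst (asm) nn_integral_0_iff_AE) auto
  then show ?thesis
    using AE_space
  proof eventually_elim
    case (elim s)
    then have "\<phi> t s \<notin> N"
      using w_pos[of s t] by (auto simp: indicator_def split: if_splits)
    then show ?case
      using N(2) elim \<phi>_space by auto
  qed
qed

text \<open>This is the set written \<open>L\<close> in the opening outline, which turns out to be
  the dissipative part modulo null sets.\<close>

definition orbit_summable :: "'s set" where
  "orbit_summable = {s \<in> space \<mu>. (\<lambda>t. G t s) summable_on UNIV}"

lemma orbit_summable_sets [measurable]: "orbit_summable \<in> sets \<mu>"
  unfolding orbit_summable_def summable_on_iff_lattice_box[OF G_nonneg] by measurable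

text \<open>Moving to \<open>\<phi> t s\<close> rescales the family by a positive weight and shifts
  its index, neither of which affects summability. The converse follows by using
  \<open>- t\<close>.\<close>

lemma orbit_summable_invariant:
  assumes s: "s \<in> space \<mu>" and "\<phi> t s \<in> orbit_summable"
  shows "s \<in> orbit_summable"
proof -
  have "(\<lambda>u. w t s * G u (\<phi> t s)) summable_on UNIV"
    using assms by (auto simp: orbit_summable_def intro: summable_on_cmult_right)
  then have "(\<lambda>u. G (u + t) s) summable_on UNIV"
    by (simp add: G_translate[OF s])
  moreover have "bij (\<lambda>u. u + t)"
    by (rule bij_betwI[of _ _ _ "\<lambda>u. u - t"]) auto
  ultimately show ?thesis
    using summable_on_reindex_bij_betw[of "\<lambda>u. u + t" UNIV UNIV "\<lambda>u. G u s"] s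
    by (simp add: orbit_summable_def)
qed

lemma null_translate:
  assumes "A \<in> sets \<mu>" "emeasure \<mu> A = 0"
  shows "emeasure \<mu> (\<phi> t ` A) = 0"
proof -
  have "AE s in \<mu>. s \<notin> A"
    using assms by (intro AE_not_in) (auto simp: null_sets_def)
  then have "AE s in \<mu>. \<phi> (- t) s \<notin> A"
    by (rule AE_translate)
  then have "AE s in \<mu>. s \<notin> \<phi> t ` A"
    unfolding group_action_image[OF act sets.sets_into_space[OF assms(1)]] by auto
  then show ?thesis
    using AE_iff_null_sets[OF group_action_image_sets[OF act assms(1)]] by (auto simp: null_sets_def)
qed

lemma wandering_translate:
  assumes "wandering \<mu> \<phi> W"
  shows "wandering \<mu> \<phi> (\<phi> t ` W)"
proof -
  have W: "W \<in> sets \<mu>" "disjoint_family (\<lambda>t. \<phi> t ` W)"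
    using assms by (auto simp: wandering_def)
  have "\<phi> u ` \<phi> t ` W = \<phi> (u + t) ` W" for u
    using sets.sets_into_space[OF W(1)] by (auto simp: image_image \<phi>_add subset_iff)
  then have "disjoint_family (\<lambda>u. \<phi> u ` \<phi> t ` W)"
    using W(2) by (auto simp: disjoint_family_on_def)
  then show ?thesis
    using W(1) group_action_image_sets[OF act] by (auto simp: wandering_def)
qed

text \<open>By equivariance, the integral of \<open>\<Sum>\<^sub>t G t\<close> over a wandering set is the integral of \<open>G 0\<close>
  over the union of its translates.\<close>

lemma wandering_orbit_summable:
  assumes "wandering \<mu> \<phi> W"
  shows "AE s in \<mu>. s \<in> W \<longrightarrow> s \<in> orbit_summable"
proof -
  have W [measurable]: "W \<in> sets \<mu>" and disj: "disjoint_family (\<lambda>t. \<phi> t ` W)"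
    using assms by (auto simp: wandering_def)
  have WS: "W \<subseteq> space \<mu>" by (rule sets.sets_into_space) fact
  have disj': "disjoint_family_on (\<lambda>t. \<phi> t ` W) T" for T
    using disj by (rule disjoint_family_on_mono[rotated]) simp
  define F where "F m s = ennreal (\<Sum>t\<in>lattice_box m. indicator W s * G t s)" for m s
  have [measurable]: "F m \<in> borel_measurable \<mu>" for m
    unfolding F_def by measurable
  have "incseq F"
    unfolding F_def incseq_def le_fun_def
    by (auto intro!: ennreal_leI sum_mono2 dest: lattice_box_mono[THEN subsetD])
  have bound: "(\<integral>\<^sup>+s. F m s \<partial>\<mu>) \<le> (\<integral>\<^sup>+s. G 0 s \<partial>\<mu>)" for m
  proof -
    have "(\<integral>\<^sup>+s. F m s \<partial>\<mu>) = (\<Sum>t\<in>lattice_box m. \<integral>\<^sup>+s. ennreal (indicator W s * G t s) \<partial>\<mu>)"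
      unfolding F_def by (subst nn_integral_sum[symmetric]) (auto simp: sum_ennreal)
    also have "\<dots> = (\<Sum>t\<in>lattice_box m. \<integral>\<^sup>+s. indicator (\<phi> t ` W) s * ennreal (G 0 s) \<partial>\<mu>)"
    proof (rule sum.cong[OF refl])
      fix t :: "int ^ 'd"
      have [measurable]: "\<phi> t ` W \<in> sets \<mu>"
        by (rule group_action_image_sets[OF act W])
      have "(\<integral>\<^sup>+s. indicator (\<phi> t ` W) s * ennreal (G 0 s) \<partial>\<mu>)
          = (\<integral>\<^sup>+s. ennreal (w t s) * (indicator (\<phi> t ` W) (\<phi> t s) * ennreal (G 0 (\<phi> t s))) \<partial>\<mu>)"
        by (rule nn_integral_translate[symmetric]) measurable
      also have "\<dots> = (\<integral>\<^sup>+s. ennreal (indicator W s * G t s) \<partial>\<mu>)"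
      proof (rule nn_integral_cong)
        fix s assume s: "s \<in> space \<mu>"
        have "\<phi> t s \<in> \<phi> t ` W \<longleftrightarrow> s \<in> W"
          unfolding group_action_image[OF act WS] using s by (simp add: \<phi>_space \<phi>_inv)
        then show "ennreal (w t s) * (indicator (\<phi> t ` W) (\<phi> t s) * ennreal (G 0 (\<phi> t s)))
            = ennreal (indicator W s * G t s)"
          using G_eq[OF s, of t] w_pos[OF s, of t] by (auto simp: indicator_def ennreal_mult)
      qed
      finally show "(\<integral>\<^sup>+s. ennreal (indicator W s * G t s) \<partial>\<mu>)
          = (\<integral>\<^sup>+s. indicator (\<phi> t ` W) s * ennreal (G 0 s) \<partial>\<mu>)" by simp
    qed
    also have "\<dots> = (\<integral>\<^sup>+s. (\<Sum>t\<in>lattice_box m. indicator (\<phi> t ` W) s * ennreal (G 0 s)) \<partial>\<mu>)"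
      using group_action_image_sets[OF act W] by (subst nn_integral_sum) auto
    \<comment> \<open>The translates of \<open>W\<close> are disjoint, so at each point at most one
      indicator is nonzero.\<close>
    also have "\<dots> \<le> (\<integral>\<^sup>+s. G 0 s \<partial>\<mu>)"
    proof (rule nn_integral_mono)
      fix s
      have "(\<Sum>t\<in>lattice_box m. indicator (\<phi> t ` W) s * ennreal (G 0 s))
          = indicator (\<Union>t\<in>lattice_box m. \<phi> t ` W) s * ennreal (G 0 s)"
        unfolding sum_distrib_right[symmetric]
        by (subst indicator_UN_disjoint) (auto simp: disj')
      also have "\<dots> \<le> G 0 s"
        by (auto simp: indicator_def)
      finally show "(\<Sum>t\<in>lattice_box m. indicator (\<phi> t ` W) s * ennreal (G 0 s)) \<le> ennreal (G 0 s)" .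
    qed
    finally show ?thesis .
  qed
  have fin: "(\<integral>\<^sup>+s. G 0 s \<partial>\<mu>) < \<infinity>"
    using G_integrable_0 by (simp add: integrable_iff_bounded)
  have "(\<integral>\<^sup>+s. (SUP m. F m s) \<partial>\<mu>) = (SUP m. \<integral>\<^sup>+s. F m s \<partial>\<mu>)"
    using \<open>incseq F\<close> by (intro nn_integral_monotone_convergence_SUP) auto
  also have "\<dots> \<le> (\<integral>\<^sup>+s. G 0 s \<partial>\<mu>)"
    by (intro SUP_least bound)
  also note fin
  finally have "AE s in \<mu>. (SUP m. F m s) \<noteq> \<infinity>"
    by (intro nn_integral_noteq_infinite) auto
  then show ?thesis
    using AE_space
  proof eventually_elim
    case (elim s)
    show ?case
    proof
      assume sW: "s \<in> W"
      obtain N :: nat where N: "(SUP m. F m s) < of_nat N"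
        using elim(1) ennreal_Ex_less_of_nat[of "SUP m. F m s"] unfolding infinity_ennreal_def less_top
        by blast
      have "(\<Sum>t\<in>lattice_box m. G t s) \<le> real N" for m
      proof -
        have "F m s \<le> of_nat N"
          using N SUP_upper[of m UNIV "\<lambda>m. F m s"] by (meson UNIV_I le_less_trans less_imp_le)
        then show ?thesis
          using sW by (simp add: F_def ennreal_of_nat_eq_real_of_nat sum_nonneg)
      qed
      then show "s \<in> orbit_summable"
        using elim(2) by (auto simp: orbit_summable_def summable_on_iff_lattice_box)
    qed
  qed
qed

text \<open>Every translate of \<open>W\<close> is wandering as well, and there are countably many
  of them.\<close>

lemma wandering_orbit_summable':
  assumes "wandering \<mu> \<phi> W"
  shows "AE s in \<mu>. s \<in> (\<Union>t. \<phi> t ` W) \<longrightarrow> s \<in> orbit_summable"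
proof -
  have "AE s in \<mu>. \<forall>t. s \<in> \<phi> t ` W \<longrightarrow> s \<in> orbit_summable"
    unfolding AE_all_countable using wandering_orbit_summable wandering_translate[OF assms] by blast
  then show ?thesis by eventually_elim blast
qed

end

section \<open>Sublattices: summability and peak sets\<close>

lemma inj_lattice_scale: "0 < k \<Longrightarrow> inj (\<lambda>u :: int ^ 'd. int k *s u)"
  by (rule injI) (auto simp: vec_eq_iff)

text \<open>The sublattice has finitely many cosets, represented in the cube \<open>R\<close>. The
  hypothesis speaks only of base points in \<open>A\<close>, so a nonempty trace \<open>C r\<close>
  is first recentred at one of its points.\<close>

lemma finite_of_finite_coset_traces:
  fixes A :: "(int ^ 'd) set"
  assumes k: "0 < k" and coset: "\<And>r. r \<in> A \<Longrightarrow> finite {u. r + int k *s u \<in> A}"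
  shows "finite A"
proof -
  define R where "R = {t :: int ^ 'd. \<forall>i. t $ i \<in> {0..<int k}}"
  define C where "C r = (\<lambda>u. r + int k *s u) ` {u. r + int k *s u \<in> A}" for r
  have "finite R"
    unfolding R_def by (rule finite_vec_set) simp
  have finC: "finite (C r)" for r
  proof (cases "C r = {}")
    case False
    then obtain u0 where u0: "r + int k *s u0 \<in> A"
      by (auto simp: C_def)
    have "C r \<subseteq> (\<lambda>u. (r + int k *s u0) + int k *s u) ` {u. (r + int k *s u0) + int k *s u \<in> A}"
    proof
      fix t assume "t \<in> C r"
      then obtain u where "t = r + int k *s u" "t \<in> A"
        by (auto simp: C_def)
      then have "t = (r + int k *s u0) + int k *s (u - u0)"
        by (simp add: vec_eq_iff algebra_simps)
      then show "t \<in> (\<lambda>u. (r + int k *s u0) + int k *s u) ` {u. (r + int k *s u0) + int k *s u \<in> A}"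
        using \<open>t \<in> A\<close> by blast
    qed
    then show ?thesis
      using coset[OF u0] finite_subset by blast
  qed simp
  have "A \<subseteq> (\<Union>r\<in>R. C r)"
  proof
    fix t assume "t \<in> A"
    define r :: "int ^ 'd" where "r = (\<chi> i. t $ i mod int k)"
    define u :: "int ^ 'd" where "u = (\<chi> i. t $ i div int k)"
    have "t = r + int k *s u"
      by (simp add: vec_eq_iff r_def u_def)
    moreover have "r \<in> R"
      using k by (simp add: R_def r_def)
    ultimately show "t \<in> (\<Union>r\<in>R. C r)"
      using \<open>t \<in> A\<close> by (auto simp: C_def)
  qed
  then show ?thesis
    using \<open>finite R\<close> finC finite_subset by blast
qed

text \<open>Each term is at most the total, so its \<open>\<beta>\<close>-th power is at most a
  constant multiple of the term itself.\<close>

lemma summable_powr_of_summable: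
  fixes g :: "'a \<Rightarrow> real"
  assumes g: "g summable_on UNIV" and nonneg: "\<And>x. 0 \<le> g x" and "1 \<le> \<beta>"
  shows "(\<lambda>x. g x powr \<beta>) summable_on UNIV"
proof (rule summable_on_comparison_test)
  show "(\<lambda>x. infsum g UNIV powr (\<beta> - 1) * g x) summable_on UNIV"
    using g by (rule summable_on_cmult_right)
  fix x
  have "g x \<le> infsum g UNIV"
    using finite_sum_le_infsum[OF g, of "{x}"] nonneg by simp
  then have "g x powr (\<beta> - 1) * g x \<le> infsum g UNIV powr (\<beta> - 1) * g x"
    using nonneg \<open>1 \<le> \<beta>\<close> by (intro mult_right_mono powr_mono2) auto
  then show "g x powr \<beta> \<le> infsum g UNIV powr (\<beta> - 1) * g x"
    using powr_mult_base[OF nonneg[of x], of "\<beta> - 1"] by (simp add: mult.commute)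
qed auto

context scaled_action
begin

text \<open>The exponent is the one in the denominators of the box averages below. With
  \<open>\<beta> = 1\<close> and \<open>k = 1\<close> this is \<open>orbit_summable\<close>.\<close>

definition sublattice_summable :: "real \<Rightarrow> nat \<Rightarrow> 's set" where
  "sublattice_summable \<beta> k = {s \<in> space \<mu>. (\<lambda>u. G (int k *s u) s powr \<beta>) summable_on UNIV}"

lemma sublattice_summable_sets [measurable]: "sublattice_summable \<beta> k \<in> sets \<mu>"
proof -
  have *: "0 \<le> G t s powr \<beta>" for t s by simp
  show ?thesis
    unfolding sublattice_summable_def summable_on_iff_lattice_box[OF *] by measurable
qed

definition sublattice_peak :: "real \<Rightarrow> nat \<Rightarrow> 's set" where
  "sublattice_peak \<beta> k =
     {s \<in> sublattice_summable \<beta> k. 0 < G 0 s \<and> (\<forall>u. G (int k *s u) s \<le> G 0 s)}"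

lemma sublattice_peak_sets [measurable]: "sublattice_peak \<beta> k \<in> sets \<mu>"
proof -
  have "sublattice_peak \<beta> k =
      {s \<in> space \<mu>. s \<in> sublattice_summable \<beta> k \<and> 0 < G 0 s \<and> (\<forall>u. G (int k *s u) s \<le> G 0 s)}"
    by (auto simp: sublattice_peak_def sublattice_summable_def)
  then show ?thesis by simp
qed

text \<open>All three conditions survive a positive rescaling of \<open>G\<close>, so the weight
  \<open>w t s\<close> drops out when the family is seen from \<open>\<phi> t s\<close>.\<close>

lemma translate_sublattice_peak_iff:
  assumes s: "s \<in> space \<mu>"
  shows "\<phi> t s \<in> sublattice_peak \<beta> k \<longleftrightarrow>
    (\<lambda>u. G (t + int k *s u) s powr \<beta>) summable_on UNIV \<and> 0 < G t s \<and>
    (\<forall>u. G (t + int k *s u) s \<le> G t s)"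
proof -
  have w: "0 < w t s" by (rule w_pos[OF s])
  have G: "G (t + v) s = w t s * G v (\<phi> t s)" for v
    using G_translate[OF s, of v t] by (simp add: add.commute)
  have "(\<lambda>u. G (t + int k *s u) s powr \<beta>) = (\<lambda>u. (w t s powr \<beta>) * G (int k *s u) (\<phi> t s) powr \<beta>)"
    using w by (simp add: G powr_mult)
  moreover have "(\<lambda>u. (w t s powr \<beta>) * G (int k *s u) (\<phi> t s) powr \<beta>) summable_on UNIV
      \<longleftrightarrow> (\<lambda>u. G (int k *s u) (\<phi> t s) powr \<beta>) summable_on UNIV"
    using w by (intro summable_on_cmult_right') auto
  moreover have "0 < G t s \<longleftrightarrow> 0 < G 0 (\<phi> t s)"
    using w by (simp add: G_eq[OF s] zero_less_mult_iff)
  moreover have "(\<forall>u. G (t + int k *s u) s \<le> G t s) \<longleftrightarrow> (\<forall>u. G (int k *s u) (\<phi> t s) \<le> G 0 (\<phi> t s))"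
    using w by (simp add: G G_eq[OF s, of t])
  ultimately show ?thesis
    using \<phi>_space[OF s] by (simp add: sublattice_peak_def sublattice_summable_def)
qed

text \<open>Within one coset of \<open>k\<int>\<^sup>d\<close> all returns attain the same positive maximum of a summable
  family.\<close>

lemma finite_returns_sublattice_peak:
  assumes "0 < k" "0 < \<beta>" and s: "s \<in> space \<mu>"
  shows "finite {t. \<phi> t s \<in> sublattice_peak \<beta> k}"
proof (rule finite_of_finite_coset_traces[OF \<open>0 < k\<close>])
  fix r assume "r \<in> {t. \<phi> t s \<in> sublattice_peak \<beta> k}"
  then have r: "(\<lambda>u. G (r + int k *s u) s powr \<beta>) summable_on UNIV" "0 < G r s"
    by (auto simp: translate_sublattice_peak_iff[OF s])
  have "G r s \<le> G (r + int k *s u) s" if "\<phi> (r + int k *s u) s \<in> sublattice_peak \<beta> k" for u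
  proof -
    \<comment> \<open>The index \<open>- u\<close> leads from the return back to \<open>r\<close>;
      as the return is a peak, it dominates the value there.\<close>
    have "G (r + int k *s u + int k *s (- u)) s \<le> G (r + int k *s u) s"
      using that unfolding translate_sublattice_peak_iff[OF s] by blast
    moreover have "r + int k *s u + int k *s (- u) = r"
      by (simp add: vec_eq_iff)
    ultimately show ?thesis by simp
  qed
  then have "{u. r + int k *s u \<in> {t. \<phi> t s \<in> sublattice_peak \<beta> k}}
      \<subseteq> {u. G r s powr \<beta> \<le> G (r + int k *s u) s powr \<beta>}"
    using \<open>0 < \<beta>\<close> by (auto intro!: powr_mono2)
  moreover have "finite {u. G r s powr \<beta> \<le> G (r + int k *s u) s powr \<beta>}"
    using r by (intro summable_on_finite_superlevel) auto
  ultimately show "finite {u. r + int k *s u \<in> {t. \<phi> t s \<in> sublattice_peak \<beta> k}}"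
    using finite_subset by blast
qed

text \<open>By summability only finitely many values reach \<open>G (int k *s u) s\<close>, so the
  maximum over the sublattice is attained; the orbit point where this happens is a peak.\<close>

lemma sublattice_peak_visited:
  assumes "0 < \<beta>" and s: "s \<in> sublattice_summable \<beta> k" and "0 < G (int k *s u) s"
  shows "\<exists>t. \<phi> t s \<in> sublattice_peak \<beta> k"
proof -
  define A where "A = {v. G (int k *s u) s powr \<beta> \<le> G (int k *s v) s powr \<beta>}"
  have S: "s \<in> space \<mu>" and sm: "(\<lambda>v. G (int k *s v) s powr \<beta>) summable_on UNIV"
    using s by (auto simp: sublattice_summable_def)
  have "finite A"
    unfolding A_def using sm \<open>0 < G (int k *s u) s\<close> by (intro summable_on_finite_superlevel) auto
  have "u \<in> A" by (simp add: A_def)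
  have "Max ((\<lambda>v. G (int k *s v) s) ` A) \<in> (\<lambda>v. G (int k *s v) s) ` A"
    using \<open>finite A\<close> \<open>u \<in> A\<close> by (intro Max_in) auto
  then obtain m where "m \<in> A" and Max: "Max ((\<lambda>v. G (int k *s v) s) ` A) = G (int k *s m) s"
    by auto
  have m: "G (int k *s v) s \<le> G (int k *s m) s" if "v \<in> A" for v
    unfolding Max[symmetric] using \<open>finite A\<close> that by (intro Max_ge) auto
  have max: "G (int k *s v) s \<le> G (int k *s m) s" for v
  proof (cases "v \<in> A")
    case False
    then have "G (int k *s v) s powr \<beta> < G (int k *s u) s powr \<beta>"
      by (simp add: A_def)
    then have "G (int k *s v) s < G (int k *s u) s"
      using powr_mono2[of \<beta> "G (int k *s u) s" "G (int k *s v) s"] \<open>0 < \<beta>\<close>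
      by (meson G_nonneg less_imp_le not_le)
    then show ?thesis
      using m[OF \<open>u \<in> A\<close>] by linarith
  qed (rule m)
  have shift: "int k *s m + int k *s v = int k *s (m + v)" for v
    by (simp add: vec_eq_iff algebra_simps)
  have "(\<lambda>v. G (int k *s (m + v)) s powr \<beta>) summable_on UNIV"
    using summable_on_reindex_bij_betw[of "\<lambda>v. m + v" UNIV UNIV "\<lambda>v. G (int k *s v) s powr \<beta>"]
      sm by (simp add: bij_betw_def)
  moreover have "0 < G (int k *s m) s"
    using max[of u] \<open>0 < G (int k *s u) s\<close> by linarith
  ultimately have "\<phi> (int k *s m) s \<in> sublattice_peak \<beta> k"
    unfolding translate_sublattice_peak_iff[OF S] shift using max by blast
  then show ?thesis ..
qed

lemma sublattice_wandering:
  assumes "0 < k" "0 < \<beta>"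
  obtains W where "wandering \<mu> \<phi> W"
    "\<And>s u. s \<in> sublattice_summable \<beta> k \<Longrightarrow> 0 < G (int k *s u) s \<Longrightarrow> s \<in> (\<Union>t. \<phi> t ` W)"
proof -
  obtain W where W: "wandering \<mu> \<phi> W" "(\<Union>t. \<phi> t ` W) = (\<Union>t. \<phi> t ` sublattice_peak \<beta> k)"
    using wandering_of_finite_returns[OF act sublattice_peak_sets finite_returns_sublattice_peak[OF assms]]
    by blast
  have "s \<in> (\<Union>t. \<phi> t ` sublattice_peak \<beta> k)"
    if s: "s \<in> sublattice_summable \<beta> k" and G: "0 < G (int k *s u) s" for s u
  proof -
    obtain t where t: "\<phi> t s \<in> sublattice_peak \<beta> k"
      using sublattice_peak_visited[OF \<open>0 < \<beta>\<close> s G] by blast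
    have "s = \<phi> (- t) (\<phi> t s)"
      using s by (simp add: sublattice_summable_def \<phi>_inv)
    then show ?thesis using t by blast
  qed
  then show thesis
    using W by (intro that[of W]) auto
qed

text \<open>Such a point visits the peak set and hence lies in a translate of a wandering set, where
  the sum over the whole lattice is finite almost everywhere. Thus powers along a single sublattice
  decide summability over all of the lattice.\<close>

lemma sublattice_orbit_summable:
  assumes "0 < k" "0 < \<beta>"
  shows "AE s in \<mu>. s \<in> sublattice_summable \<beta> k \<and> (\<exists>u. 0 < G (int k *s u) s) \<longrightarrow> s \<in> orbit_summable"
proof -
  obtain W where W: "wandering \<mu> \<phi> W"
    "\<And>s u. s \<in> sublattice_summable \<beta> k \<Longrightarrow> 0 < G (int k *s u) s \<Longrightarrow> s \<in> (\<Union>t. \<phi> t ` W)"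
    using sublattice_wandering[OF assms] by blast
  show ?thesis
    using wandering_orbit_summable'[OF W(1)] by eventually_elim (use W(2) in blast)
qed

lemma orbit_summable_sublattice:
  assumes "0 < k" "1 \<le> \<beta>"
  shows "orbit_summable \<subseteq> sublattice_summable \<beta> k"
proof
  fix s assume s: "s \<in> orbit_summable"
  then have "(\<lambda>t. G t s) summable_on (\<lambda>u. int k *s u) ` UNIV"
    by (auto simp: orbit_summable_def intro: summable_on_subset_banach)
  then have "(\<lambda>u. G (int k *s u) s) summable_on UNIV"
    using summable_on_reindex[OF inj_lattice_scale[OF \<open>0 < k\<close>], of "\<lambda>t. G t s"] by (simp add: o_def)
  then show "s \<in> sublattice_summable \<beta> k"
    using s assms by (auto simp: sublattice_summable_def orbit_summable_def intro: summable_powr_of_summable)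
qed

section \<open>The Hopf decomposition and its two extreme cases\<close>

lemma translates_subset_space:
  assumes "W \<in> sets \<mu>"
  shows "(\<Union>t. \<phi> t ` W) \<subseteq> space \<mu>"
  using sets.sets_into_space[OF assms] \<phi>_space by blast

lemma orbit_summable_wandering:
  obtains W where "wandering \<mu> \<phi> W"
    "AE s in \<mu>. s \<in> orbit_summable \<longleftrightarrow> s \<in> (\<Union>t. \<phi> t ` W)"
proof -
  \<comment> \<open>For \<open>\<beta> = 1\<close> and \<open>k = 1\<close> the sublattice is the
    whole lattice; the support condition then supplies the positive value that is required.\<close>
  obtain W where W: "wandering \<mu> \<phi> W"
    "\<And>s u. s \<in> sublattice_summable 1 1 \<Longrightarrow> 0 < G (int 1 *s u) s \<Longrightarrow> s \<in> (\<Union>t. \<phi> t ` W)"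
    using sublattice_wandering[of 1 1] by auto
  have "AE s in \<mu>. s \<in> orbit_summable \<longleftrightarrow> s \<in> (\<Union>t. \<phi> t ` W)"
    using wandering_orbit_summable'[OF W(1)] G_support
  proof eventually_elim
    case (elim s)
    obtain t where "G t s \<noteq> 0" using elim(2) by blast
    then have "0 < G (int 1 *s t) s"
      using G_nonneg[of t s] by (simp add: order_less_le)
    then show ?case
      using elim(1) W(2) orbit_summable_sublattice[of 1 1] by auto
  qed
  then show thesis using W(1) that by blast
qed

text \<open>One inclusion holds because \<open>D\<close> consists of translates of a wandering set.
  For the other, the wandering set generating the summable part meets \<open>C\<close> in a null
  set; almost every summable point therefore comes from a point outside \<open>C\<close>, and
  \<open>C\<close> is invariant.\<close>

lemma hopf_orbit_summable:
  assumes "hopf_decomposition \<mu> \<phi> C D"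
  shows "AE s in \<mu>. s \<in> D \<longleftrightarrow> s \<in> orbit_summable"
proof -
  have C: "C \<in> sets \<mu>" "C \<union> D = space \<mu>" "\<And>t. \<phi> t ` C = C"
    and null: "\<And>W. wandering \<mu> \<phi> W \<Longrightarrow> W \<subseteq> C \<Longrightarrow> emeasure \<mu> W = 0"
    and ex: "\<exists>V. wandering \<mu> \<phi> V \<and> D = (\<Union>t. \<phi> t ` V)"
    using assms by (simp_all add: hopf_decomposition_def)
  from ex obtain V where V: "wandering \<mu> \<phi> V" "D = (\<Union>t. \<phi> t ` V)"
    by blast
  obtain W where W: "wandering \<mu> \<phi> W"
    "AE s in \<mu>. s \<in> orbit_summable \<longleftrightarrow> s \<in> (\<Union>t. \<phi> t ` W)"
    using orbit_summable_wandering .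
  have WC: "wandering \<mu> \<phi> (W \<inter> C)"
    using W(1) C(1) disjoint_family_subset[of "\<lambda>t. \<phi> t ` W" "\<lambda>t. \<phi> t ` (W \<inter> C)"]
    by (simp add: wandering_def image_mono sets.Int)
  then have WCs: "W \<inter> C \<in> sets \<mu>" by (simp add: wandering_def)
  have "emeasure \<mu> (\<phi> t ` (W \<inter> C)) = 0" for t
    using null_translate[OF WCs null[OF WC]] by simp
  then have "AE s in \<mu>. \<forall>t. s \<notin> \<phi> t ` (W \<inter> C)"
    unfolding AE_all_countable
    using group_action_image_sets[OF act WCs] by (intro allI AE_not_in) (auto simp: null_sets_def)
  then show ?thesis
    using W(2) wandering_orbit_summable'[OF V(1)] AE_space
  proof eventually_elim
    case (elim s)
    show ?case
    proof
      assume s: "s \<in> orbit_summable"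
      then obtain t x where x: "x \<in> W" "s = \<phi> t x"
        using elim(2) by auto
      have xS: "x \<in> space \<mu>"
        using x W(1) sets.sets_into_space unfolding wandering_def by blast
      have "x \<notin> C" using elim(1) x by blast
      then have "s \<notin> C"
        using C(3)[of "- t"] \<phi>_inv(1)[OF xS, of t] x(2) by (metis imageI)
      then show "s \<in> D" using C(2) elim(4) by blast
    qed (use elim(3) V(2) in blast)
  qed
qed

text \<open>The definitions of conservative and dissipative actions ask for an actual decomposition.
  Take for \<open>D\<close> the translates of the wandering set that generates the summable part; a
  wandering set outside \<open>D\<close> is almost everywhere summable, hence null.\<close>

lemma hopf_decomposition_exists: "\<exists>C D. hopf_decomposition \<mu> \<phi> C D"
proof -
  obtain W where W: "wandering \<mu> \<phi> W"
    and AE_W: "AE s in \<mu>. s \<in> orbit_summable \<longleftrightarrow> s \<in> (\<Union>t. \<phi> t ` W)"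
    using orbit_summable_wandering .
  have Ws: "W \<in> sets \<mu>" using W by (simp add: wandering_def)
  define D where "D = (\<Union>t. \<phi> t ` W)"
  have DS: "D \<subseteq> space \<mu>"
    unfolding D_def by (rule translates_subset_space[OF Ws])
  have Ds [measurable]: "D \<in> sets \<mu>"
    unfolding D_def using group_action_image_sets[OF act Ws] by auto
  have sub: "\<phi> t ` D \<subseteq> D" for t
  proof
    fix s assume "s \<in> \<phi> t ` D"
    then obtain u x where x: "x \<in> W" "s = \<phi> t (\<phi> u x)"
      by (auto simp: D_def)
    then have "s = \<phi> (t + u) x"
      using sets.sets_into_space[OF Ws] by (simp add: \<phi>_add subset_iff)
    then show "s \<in> D"
      using x(1) by (auto simp: D_def)
  qed
  have D: "\<phi> t ` D = D" for t
  proof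
    show "D \<subseteq> \<phi> t ` D"
    proof
      fix s assume "s \<in> D"
      then have "\<phi> (- t) s \<in> D" "s = \<phi> t (\<phi> (- t) s)"
        using sub[of "- t"] DS by (auto simp: \<phi>_inv)
      then show "s \<in> \<phi> t ` D" by blast
    qed
  qed (rule sub)
  have D_iff: "\<phi> t s \<in> D \<longleftrightarrow> s \<in> D" if "s \<in> space \<mu>" for t s
    using sub[of t] sub[of "- t"] \<phi>_inv(1)[OF that, of t] by force
  have C: "\<phi> t ` (space \<mu> - D) = space \<mu> - D" for t
    by (subst group_action_image[OF act]) (auto simp: \<phi>_space D_iff)
  have "emeasure \<mu> V = 0" if V: "wandering \<mu> \<phi> V" "V \<subseteq> space \<mu> - D" for V
  proof -
    have "AE s in \<mu>. s \<notin> V"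
      using wandering_orbit_summable[OF V(1)] AE_W
      by eventually_elim (use V(2) in \<open>auto simp: D_def\<close>)
    then show ?thesis
      using V(1) AE_iff_null_sets[of V \<mu>] by (auto simp: wandering_def null_sets_def)
  qed
  moreover have "\<exists>W. wandering \<mu> \<phi> W \<and> D = (\<Union>t. \<phi> t ` W)"
    using W D_def by blast
  ultimately have "hopf_decomposition \<mu> \<phi> (space \<mu> - D) D"
    unfolding hopf_decomposition_def using DS C D by auto
  then show ?thesis by blast
qed

lemma conservative_action_iff: "conservative_action \<mu> \<phi> \<longleftrightarrow> (AE s in \<mu>. s \<notin> orbit_summable)"
proof
  assume "conservative_action \<mu> \<phi>"
  then obtain C D where CD: "hopf_decomposition \<mu> \<phi> C D" "eq_mod \<mu> (space \<mu>) C"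
    by (auto simp: conservative_action_def)
  have "AE s in \<mu>. s \<in> C"
    using CD(2) AE_space unfolding eq_mod_def by eventually_elim auto
  then show "AE s in \<mu>. s \<notin> orbit_summable"
    using hopf_orbit_summable[OF CD(1)]
    by eventually_elim (use CD(1) in \<open>auto simp: hopf_decomposition_def\<close>)
next
  assume *: "AE s in \<mu>. s \<notin> orbit_summable"
  obtain C D where CD: "hopf_decomposition \<mu> \<phi> C D"
    using hopf_decomposition_exists by blast
  then have "C \<union> D = space \<mu>" by (simp add: hopf_decomposition_def)
  have "eq_mod \<mu> (space \<mu>) C"
    unfolding eq_mod_def using * hopf_orbit_summable[OF CD]
    by eventually_elim (use \<open>C \<union> D = space \<mu>\<close> in auto)
  then show "conservative_action \<mu> \<phi>"
    using CD by (auto simp: conservative_action_def)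
qed

lemma dissipative_action_iff: "dissipative_action \<mu> \<phi> \<longleftrightarrow> (AE s in \<mu>. s \<in> orbit_summable)"
proof
  assume "dissipative_action \<mu> \<phi>"
  then obtain C D where CD: "hopf_decomposition \<mu> \<phi> C D" "eq_mod \<mu> (space \<mu>) D"
    by (auto simp: dissipative_action_def)
  show "AE s in \<mu>. s \<in> orbit_summable"
    using CD(2) hopf_orbit_summable[OF CD(1)] AE_space unfolding eq_mod_def
    by eventually_elim auto
next
  assume *: "AE s in \<mu>. s \<in> orbit_summable"
  obtain C D where CD: "hopf_decomposition \<mu> \<phi> C D"
    using hopf_decomposition_exists by blast
  have "eq_mod \<mu> (space \<mu>) D"
    unfolding eq_mod_def using * hopf_orbit_summable[OF CD] AE_space
    by eventually_elim auto
  then show "dissipative_action \<mu> \<phi>"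
    using CD by (auto simp: dissipative_action_def)
qed

text \<open>Along the whole orbit the hypothesis makes every \<open>G t\<close> vanish, which the
  support condition forbids almost everywhere.\<close>

lemma AE_orbit_of_AE:
  assumes "AE s in \<mu>. P s \<longrightarrow> G 0 s = 0" "\<And>s t. s \<in> space \<mu> \<Longrightarrow> P s \<Longrightarrow> P (\<phi> t s)"
  shows "AE s in \<mu>. \<not> P s"
proof -
  have "AE s in \<mu>. \<forall>t. P (\<phi> t s) \<longrightarrow> G 0 (\<phi> t s) = 0"
    unfolding AE_all_countable using AE_translate[OF assms(1)] by blast
  then show ?thesis
    using G_support AE_space by eventually_elim (use assms(2) in \<open>auto simp: G_eq\<close>)
qed

text \<open>The criterion uses the number that the law of the field will determine. Vanishing of the
  integral only says that \<open>G 0\<close> is zero on the summable set; invariance and full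
  support upgrade this to nullity of the set.\<close>

lemma conservative_action_iff_integral:
  "conservative_action \<mu> \<phi> \<longleftrightarrow> (\<integral>s. indicator orbit_summable s * G 0 s \<partial>\<mu>) = 0"
proof -
  have int: "integrable \<mu> (\<lambda>s. indicator orbit_summable s * G 0 s)"
    using integrable_mult_indicator[OF orbit_summable_sets G_integrable_0] by simp
  have "(\<integral>s. indicator orbit_summable s * G 0 s \<partial>\<mu>) = 0
      \<longleftrightarrow> (AE s in \<mu>. indicator orbit_summable s * G 0 s = 0)"
    using int by (intro integral_nonneg_eq_0_iff_AE) auto
  also have "\<dots> \<longleftrightarrow> (AE s in \<mu>. s \<in> orbit_summable \<longrightarrow> G 0 s = 0)"
    by (intro AE_cong) (auto simp: indicator_def)
  also have "\<dots> \<longleftrightarrow> (AE s in \<mu>. s \<notin> orbit_summable)"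
  proof
    assume "AE s in \<mu>. s \<in> orbit_summable \<longrightarrow> G 0 s = 0"
    then show "AE s in \<mu>. s \<notin> orbit_summable"
    proof (rule AE_orbit_of_AE)
      fix s t assume "s \<in> space \<mu>" "s \<in> orbit_summable"
      then show "\<phi> t s \<in> orbit_summable"
        using orbit_summable_invariant[of "\<phi> t s" "- t"] by (simp add: \<phi>_inv \<phi>_space)
    qed
  next
    assume "AE s in \<mu>. s \<notin> orbit_summable"
    then show "AE s in \<mu>. s \<in> orbit_summable \<longrightarrow> G 0 s = 0" by eventually_elim simp
  qed
  finally show ?thesis by (simp add: conservative_action_iff)
qed

lemma dissipative_action_iff_integral:
  "dissipative_action \<mu> \<phi> \<longleftrightarrow>
    (\<integral>s. indicator orbit_summable s * G 0 s \<partial>\<mu>) = (\<integral>s. G 0 s \<partial>\<mu>)"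
proof -
  have int: "integrable \<mu> (\<lambda>s. indicator orbit_summable s * G 0 s)"
    using integrable_mult_indicator[OF orbit_summable_sets G_integrable_0] by simp
  have "(\<integral>s. indicator orbit_summable s * G 0 s \<partial>\<mu>) = (\<integral>s. G 0 s \<partial>\<mu>)
      \<longleftrightarrow> (\<integral>s. G 0 s - indicator orbit_summable s * G 0 s \<partial>\<mu>) = 0"
    using int G_integrable_0 by (subst Bochner_Integration.integral_diff) auto
  also have "\<dots> \<longleftrightarrow> (AE s in \<mu>. G 0 s - indicator orbit_summable s * G 0 s = 0)"
    using int G_integrable_0
    by (intro integral_nonneg_eq_0_iff_AE) (auto simp: indicator_def)
  also have "\<dots> \<longleftrightarrow> (AE s in \<mu>. s \<notin> orbit_summable \<longrightarrow> G 0 s = 0)"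
    by (intro AE_cong) (auto simp: indicator_def)
  also have "\<dots> \<longleftrightarrow> (AE s in \<mu>. \<not> s \<notin> orbit_summable)"
  proof
    assume "AE s in \<mu>. s \<notin> orbit_summable \<longrightarrow> G 0 s = 0"
    then show "AE s in \<mu>. \<not> s \<notin> orbit_summable"
      by (rule AE_orbit_of_AE) (use orbit_summable_invariant in blast)
  next
    assume "AE s in \<mu>. \<not> s \<notin> orbit_summable"
    then show "AE s in \<mu>. s \<notin> orbit_summable \<longrightarrow> G 0 s = 0" by eventually_elim simp
  qed
  finally show ?thesis by (simp add: dissipative_action_iff)
qed

end

section \<open>Averages over boxes\<close>

text \<open>With \<open>S\<close> the sum of the powers, each summand equals
  \<open>x t powr \<beta> * S powr (1 / \<beta> - 1)\<close>. The form chosen pairs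
  \<open>x t\<close> with a ratio insensitive to rescaling, which suits the equivariance of
  \<open>G\<close>. If \<open>S = 0\<close>, both sides vanish by the conventions for division and
  \<open>powr\<close>.\<close>

lemma lp_norm_decompose:
  fixes x :: "'a \<Rightarrow> real"
  assumes x: "\<And>t. t \<in> T \<Longrightarrow> 0 \<le> x t" and "1 < \<beta>" and "finite T"
  shows "(\<Sum>t\<in>T. x t powr \<beta>) powr (1 / \<beta>) =
    (\<Sum>t\<in>T. x t * (x t powr \<beta> / (\<Sum>u\<in>T. x u powr \<beta>)) powr (1 - 1 / \<beta>))"
proof (cases "(\<Sum>u\<in>T. x u powr \<beta>) = 0")
  case False
  define S where "S = (\<Sum>u\<in>T. x u powr \<beta>)"
  have "0 < S"
    using False sum_nonneg[of T "\<lambda>u. x u powr \<beta>"] by (simp add: S_def)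
  have summand: "x t * (x t powr \<beta> / S) powr (1 - 1 / \<beta>) = x t powr \<beta> * S powr (1 / \<beta> - 1)"
    if "t \<in> T" for t
  proof (cases "x t = 0")
    case False
    then have xt: "0 < x t" using x[OF that] by linarith
    have "x t * (x t powr \<beta> / S) powr (1 - 1 / \<beta>)
        = (x t powr 1 * x t powr (\<beta> * (1 - 1 / \<beta>))) / S powr (1 - 1 / \<beta>)"
      using xt \<open>0 < S\<close> by (simp add: powr_divide powr_powr)
    also have "x t powr 1 * x t powr (\<beta> * (1 - 1 / \<beta>)) = x t powr \<beta>"
      unfolding powr_add[symmetric] using \<open>1 < \<beta>\<close> by (simp add: field_simps)
    also have "x t powr \<beta> / S powr (1 - 1 / \<beta>) = x t powr \<beta> * S powr (1 / \<beta> - 1)"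
      using powr_minus_divide[of S "1 - 1 / \<beta>"] by simp
    finally show ?thesis .
  qed simp
  have "(\<Sum>t\<in>T. x t * (x t powr \<beta> / S) powr (1 - 1 / \<beta>))
      = (\<Sum>t\<in>T. x t powr \<beta> * S powr (1 / \<beta> - 1))"
    by (intro sum.cong refl summand)
  also have "\<dots> = S * S powr (1 / \<beta> - 1)"
    by (subst (2) S_def) (rule sum_distrib_right[symmetric])
  also have "\<dots> = S powr (1 / \<beta>)"
    using powr_mult_base[of S "1 / \<beta> - 1"] \<open>0 < S\<close> by simp
  finally show ?thesis by (simp add: S_def)
qed simp

context scaled_action
begin

text \<open>For \<open>0 \<in> T\<close> this is the summand of index \<open>0\<close> when
  \<open>lp_norm_decompose\<close> is applied to the family \<open>G\<close>.\<close>

definition share :: "real \<Rightarrow> (int ^ 'd) set \<Rightarrow> 's \<Rightarrow> real" where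
  "share \<beta> T s = G 0 s * (G 0 s powr \<beta> / (\<Sum>u\<in>T. G u s powr \<beta>)) powr (1 - 1 / \<beta>)"

lemma share_measurable [measurable]: "share \<beta> T \<in> borel_measurable \<mu>"
  unfolding share_def by measurable

lemma share_nonneg: "0 \<le> share \<beta> T s"
  by (simp add: share_def)

text \<open>A larger index set enlarges the denominator. The condition \<open>0 \<in> T\<close>
  keeps it positive wherever \<open>G 0\<close> is, so the convention \<open>x / 0 = 0\<close>
  cannot reverse the inequality.\<close>

lemma share_antimono:
  assumes "1 < \<beta>" "T \<subseteq> T'" "finite T'" "0 \<in> T"
  shows "share \<beta> T' s \<le> share \<beta> T s"
proof (cases "G 0 s = 0")
  case False
  then have "0 < G 0 s" using G_nonneg[of 0 s] by linarith
  then have "0 < (\<Sum>u\<in>T. G u s powr \<beta>)"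
    using assms finite_subset by (intro sum_pos2[of T 0]) auto
  moreover have "(\<Sum>u\<in>T. G u s powr \<beta>) \<le> (\<Sum>u\<in>T'. G u s powr \<beta>)"
    using assms by (intro sum_mono2) auto
  ultimately show ?thesis
    unfolding share_def using assms
    by (intro mult_left_mono powr_mono2 divide_left_mono) auto
qed (simp add: share_def)

lemma share_le:
  assumes "1 < \<beta>" "finite T" "0 \<in> T"
  shows "share \<beta> T s \<le> G 0 s"
proof -
  have "share \<beta> T s \<le> share \<beta> {0} s"
    using assms by (intro share_antimono) auto
  also have "\<dots> \<le> G 0 s"
    by (cases "G 0 s = 0") (simp_all add: share_def)
  finally show ?thesis .
qed

lemma share_integrable:
  assumes "1 < \<beta>" "finite T" "0 \<in> T"
  shows "integrable \<mu> (share \<beta> T)"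
  by (rule Bochner_Integration.integrable_bound[OF G_integrable_0])
    (use share_le[OF assms] share_nonneg in auto)

text \<open>For \<open>\<beta> = 2 / \<alpha>\<close> this integrates the \<open>\<alpha>\<close>-th
  power of the Euclidean norm of the kernels in \<open>T\<close>, which Gaussian averaging extracts
  from the law.\<close>

definition lp_mass :: "real \<Rightarrow> (int ^ 'd) set \<Rightarrow> real" where
  "lp_mass \<beta> T = (\<integral>s. (\<Sum>t\<in>T. G t s powr \<beta>) powr (1 / \<beta>) \<partial>\<mu>)"

text \<open>Seen from \<open>\<phi> t s\<close> the family is rescaled by \<open>w t s\<close> and
  shifted by \<open>t\<close>. The ratio does not notice the rescaling, and the remaining factor
  \<open>w t s\<close> is absorbed by the change of variables.\<close>

lemma lp_mass_eq_sum_share: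
  assumes "1 < \<beta>" "finite T"
  shows "lp_mass \<beta> T = (\<Sum>t\<in>T. \<integral>s. share \<beta> ((\<lambda>u. u - t) ` T) s \<partial>\<mu>)"
proof -
  have summand: "G t s * (G t s powr \<beta> / (\<Sum>u\<in>T. G u s powr \<beta>)) powr (1 - 1 / \<beta>)
      = w t s * share \<beta> ((\<lambda>u. u - t) ` T) (\<phi> t s)" if s: "s \<in> space \<mu>" for t s
  proof -
    have w: "0 < w t s" by (rule w_pos[OF s])
    have G: "G u s = w t s * G (u - t) (\<phi> t s)" for u
      using G_translate[OF s, of "u - t" t] by simp
    have "(\<Sum>u\<in>T. G u s powr \<beta>) = w t s powr \<beta> * (\<Sum>u\<in>T. G (u - t) (\<phi> t s) powr \<beta>)"
      unfolding sum_distrib_left using w by (intro sum.cong refl) (simp add: G powr_mult)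
    moreover have "(\<Sum>u\<in>T. G (u - t) (\<phi> t s) powr \<beta>) = (\<Sum>u\<in>(\<lambda>u. u - t) ` T. G u (\<phi> t s) powr \<beta>)"
      by (subst sum.reindex) (auto simp: inj_on_def)
    moreover have "G t s = w t s * G 0 (\<phi> t s)" by (rule G_eq[OF s])
    ultimately show ?thesis
      using w by (simp add: share_def powr_mult)
  qed
  have zero: "0 \<in> (\<lambda>u. u - t) ` T" if "t \<in> T" for t
    using that by (auto intro: image_eqI[of _ _ t])
  have int: "integrable \<mu> (\<lambda>s. w t s * share \<beta> ((\<lambda>u. u - t) ` T) (\<phi> t s))" if "t \<in> T" for t
    using integrable_translate[OF share_measurable] share_integrable[OF assms(1) _ zero[OF that]] assms(2)
    by simp
  have "lp_mass \<beta> T = (\<integral>s. (\<Sum>t\<in>T. w t s * share \<beta> ((\<lambda>u. u - t) ` T) (\<phi> t s)) \<partial>\<mu>)"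
    unfolding lp_mass_def
    by (intro Bochner_Integration.integral_cong refl)
      (simp add: lp_norm_decompose[OF _ assms] summand)
  also have "\<dots> = (\<Sum>t\<in>T. \<integral>s. w t s * share \<beta> ((\<lambda>u. u - t) ` T) (\<phi> t s) \<partial>\<mu>)"
    by (intro Bochner_Integration.integral_sum int)
  also have "\<dots> = (\<Sum>t\<in>T. \<integral>s. share \<beta> ((\<lambda>u. u - t) ` T) s \<partial>\<mu>)"
    by (intro sum.cong refl integral_translate share_measurable)
  finally show ?thesis .
qed

section \<open>Boxes of a sublattice and their boundary layer\<close>

abbreviation subbox :: "nat \<Rightarrow> nat \<Rightarrow> (int ^ 'd) set" where
  "subbox k m \<equiv> (\<lambda>u. int k *s u) ` lattice_box m"

lemma zero_in_subbox: "0 \<in> subbox k m"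
  by (rule image_eqI[of _ _ 0]) auto

lemma subbox_shift_subset:
  assumes "v \<in> lattice_box n"
  shows "(\<lambda>u. u - int k *s v) ` subbox k n \<subseteq> subbox k (2 * n)"
proof
  fix t assume "t \<in> (\<lambda>u. u - int k *s v) ` subbox k n"
  then obtain u where u: "u \<in> lattice_box n" "t = int k *s u - int k *s v" by auto
  have "t = int k *s (u - v)"
    using u by (simp add: vec_eq_iff algebra_simps)
  moreover have "u - v \<in> lattice_box (2 * n)"
    unfolding lattice_box_def
  proof (intro CollectI allI)
    fix i
    have "\<bar>u $ i\<bar> \<le> int n" "\<bar>v $ i\<bar> \<le> int n"
      using u assms by (auto simp: lattice_box_def)
    then show "\<bar>(u - v) $ i\<bar> \<le> int (2 * n)" by simp
  qed
  ultimately show "t \<in> subbox k (2 * n)" by blast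
qed

lemma subbox_subset_shift:
  assumes "v \<in> lattice_box (n - m)" "m \<le> n"
  shows "subbox k m \<subseteq> (\<lambda>u. u - int k *s v) ` subbox k n"
proof
  fix t assume "t \<in> subbox k m"
  then obtain u where u: "u \<in> lattice_box m" "t = int k *s u" by auto
  have "t = int k *s (u + v) - int k *s v"
    using u by (simp add: vec_eq_iff algebra_simps)
  moreover have "u + v \<in> lattice_box n"
    unfolding lattice_box_def
  proof (intro CollectI allI)
    fix i
    have "\<bar>u $ i\<bar> \<le> int m" "\<bar>v $ i\<bar> \<le> int n - int m"
      using u assms by (auto simp: lattice_box_def of_nat_diff)
    then show "\<bar>(u + v) $ i\<bar> \<le> int n" by simp
  qed
  ultimately show "t \<in> (\<lambda>u. u - int k *s v) ` subbox k n" by blast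
qed

definition box_share :: "real \<Rightarrow> nat \<Rightarrow> nat \<Rightarrow> real" where
  "box_share \<beta> k m = (\<integral>s. share \<beta> (subbox k m) s \<partial>\<mu>)"

text \<open>The summand of index \<open>int k *s v\<close> sees the box recentred at that point. The
  recentred box lies in the box of twice the radius, whence the lower bound. For \<open>v\<close> at
  depth \<open>m\<close> it contains the box of radius \<open>m\<close>; summands in the boundary
  layer are bounded by the integral of \<open>G 0\<close>.\<close>

lemma lp_mass_subbox_bounds:
  assumes "1 < \<beta>" "0 < k" "m \<le> n"
  defines "N \<equiv> real (card (lattice_box n :: (int ^ 'd) set))"
    and "N' \<equiv> real (card (lattice_box (n - m) :: (int ^ 'd) set))"
  shows "box_share \<beta> k (2 * n) \<le> lp_mass \<beta> (subbox k n) / N"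
    and "lp_mass \<beta> (subbox k n) / N \<le> box_share \<beta> k m + (1 - N' / N) * (\<integral>s. G 0 s \<partial>\<mu>)"
proof -
  define B :: "(int ^ 'd) set" where "B = lattice_box n"
  define B' :: "(int ^ 'd) set" where "B' = lattice_box (n - m)"
  define h where "h v = (\<integral>s. share \<beta> ((\<lambda>u. u - int k *s v) ` subbox k n) s \<partial>\<mu>)" for v
  have N: "N = real (card B)" "N' = real (card B')" by (simp_all add: N_def N'_def B_def B'_def)
  have "B' \<subseteq> B"
    unfolding B_def B'_def by (rule lattice_box_mono) simp
  have fin: "finite B" "finite B'" by (simp_all add: B_def B'_def)
  have "0 < N"
    unfolding N_def card_lattice_box by simp
  have "N' \<le> N"
    unfolding N using card_mono[OF fin(1) \<open>B' \<subseteq> B\<close>] by simp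
  have "lp_mass \<beta> (subbox k n) = (\<Sum>v\<in>B. h v)"
    unfolding h_def B_def lp_mass_eq_sum_share[OF \<open>1 < \<beta>\<close> finite_imageI[OF finite_lattice_box]]
    by (subst sum.reindex) (auto intro: inj_on_subset[OF inj_lattice_scale[OF \<open>0 < k\<close>]])
  note mass = this
  have zero: "0 \<in> (\<lambda>u. u - int k *s v) ` subbox k n" if "v \<in> B" for v
    using that by (auto simp: B_def intro!: image_eqI[of _ _ "int k *s v"])
  have low: "box_share \<beta> k (2 * n) \<le> h v" if "v \<in> B" for v
    unfolding box_share_def h_def using that zero[OF that] \<open>1 < \<beta>\<close>
    by (intro integral_mono share_integrable share_antimono subbox_shift_subset)
      (auto simp: B_def zero_in_subbox)
  have up: "h v \<le> box_share \<beta> k m" if "v \<in> B'" for v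
    unfolding box_share_def h_def using that zero[of v] \<open>B' \<subseteq> B\<close> \<open>1 < \<beta>\<close> \<open>m \<le> n\<close>
    by (intro integral_mono share_integrable share_antimono subbox_subset_shift)
      (auto simp: B'_def zero_in_subbox)
  have up': "h v \<le> (\<integral>s. G 0 s \<partial>\<mu>)" if "v \<in> B" for v
    unfolding h_def using that zero[OF that] \<open>1 < \<beta>\<close>
    by (intro integral_mono share_integrable G_integrable_0 share_le) auto
  have "N * box_share \<beta> k (2 * n) \<le> (\<Sum>v\<in>B. h v)"
    unfolding N using sum_bounded_below[of B "box_share \<beta> k (2 * n)" h] low by simp
  then show "box_share \<beta> k (2 * n) \<le> lp_mass \<beta> (subbox k n) / N"
    unfolding mass using \<open>0 < N\<close> by (simp add: field_simps)
  have "(\<Sum>v\<in>B. h v) = (\<Sum>v\<in>B'. h v) + (\<Sum>v\<in>B - B'. h v)"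
    using fin \<open>B' \<subseteq> B\<close> by (subst sum.subset_diff[of B' B]) auto
  also have "\<dots> \<le> N' * box_share \<beta> k m + (N - N') * (\<integral>s. G 0 s \<partial>\<mu>)"
  proof (rule add_mono)
    show "(\<Sum>v\<in>B'. h v) \<le> N' * box_share \<beta> k m"
      unfolding N using sum_bounded_above[of B' h] up by simp
    have "(\<Sum>v\<in>B - B'. h v) \<le> real (card (B - B')) * (\<integral>s. G 0 s \<partial>\<mu>)"
      using up' by (intro sum_bounded_above) auto
    also have "real (card (B - B')) = N - N'"
      unfolding N using fin \<open>B' \<subseteq> B\<close> by (simp add: card_Diff_subset of_nat_diff card_mono)
    finally show "(\<Sum>v\<in>B - B'. h v) \<le> (N - N') * (\<integral>s. G 0 s \<partial>\<mu>)" .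
  qed
  also have "\<dots> \<le> N * box_share \<beta> k m + (N - N') * (\<integral>s. G 0 s \<partial>\<mu>)"
    using \<open>N' \<le> N\<close> by (intro add_mono mult_right_mono)
      (auto simp: box_share_def share_nonneg)
  finally show "lp_mass \<beta> (subbox k n) / N \<le> box_share \<beta> k m + (1 - N' / N) * (\<integral>s. G 0 s \<partial>\<mu>)"
    unfolding mass using \<open>0 < N\<close> by (simp add: field_simps)
qed

text \<open>The share of the origin in the whole sublattice. As the limit of a decreasing sequence
  it also covers points where the denominators diverge.\<close>

definition lim_share :: "real \<Rightarrow> nat \<Rightarrow> 's \<Rightarrow> real" where
  "lim_share \<beta> k s = lim (\<lambda>m. share \<beta> (subbox k m) s)"

lemma share_subbox_LIMSEQ:
  assumes "1 < \<beta>"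
  shows "(\<lambda>m. share \<beta> (subbox k m) s) \<longlonglongrightarrow> lim_share \<beta> k s"
proof -
  have "decseq (\<lambda>m. share \<beta> (subbox k m) s)"
    using assms unfolding decseq_def
    by (auto intro!: share_antimono image_mono lattice_box_mono simp: zero_in_subbox)
  then obtain L where "(\<lambda>m. share \<beta> (subbox k m) s) \<longlonglongrightarrow> L"
    by (rule decseq_convergent[where B = 0]) (simp_all add: share_nonneg)
  then have "convergent (\<lambda>m. share \<beta> (subbox k m) s)"
    by (rule convergentI)
  then show ?thesis
    unfolding lim_share_def by (rule convergent_LIMSEQ_iff[THEN iffD1])
qed

lemma lim_share_measurable:
  assumes "1 < \<beta>"
  shows "lim_share \<beta> k \<in> borel_measurable \<mu>"
  by (rule borel_measurable_LIMSEQ_real[of _ "\<lambda>m. share \<beta> (subbox k m)"])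
    (use share_subbox_LIMSEQ[OF assms] in auto)

lemma lim_share_bounds:
  assumes "1 < \<beta>"
  shows "0 \<le> lim_share \<beta> k s" "lim_share \<beta> k s \<le> G 0 s"
  by (rule LIMSEQ_le_const[OF share_subbox_LIMSEQ[OF assms]], simp add: share_nonneg)
    (rule LIMSEQ_le_const2[OF share_subbox_LIMSEQ[OF assms]],
      simp add: share_le[OF assms _ zero_in_subbox])

lemma box_share_LIMSEQ:
  assumes "1 < \<beta>"
  shows "box_share \<beta> k \<longlonglongrightarrow> (\<integral>s. lim_share \<beta> k s \<partial>\<mu>)"
  unfolding box_share_def
proof (rule integral_dominated_convergence[OF lim_share_measurable[OF assms] _ G_integrable_0])
  show "AE s in \<mu>. (\<lambda>m. share \<beta> (subbox k m) s) \<longlonglongrightarrow> lim_share \<beta> k s"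
    using share_subbox_LIMSEQ[OF assms] by auto
  show "AE s in \<mu>. norm (share \<beta> (subbox k m) s) \<le> G 0 s" for m
    using share_nonneg share_le[OF assms _ zero_in_subbox] by auto
qed auto

text \<open>Radius \<open>m\<^sup>2\<close> with margin \<open>m\<close>: the margin grows without
  bound, yet the boundary layer becomes negligible.\<close>

lemma card_lattice_box_ratio:
  "(\<lambda>m. real (card (lattice_box (m\<^sup>2 - m) :: (int ^ 'd) set)) /
        real (card (lattice_box (m\<^sup>2) :: (int ^ 'd) set))) \<longlonglongrightarrow> 1"
proof -
  have "(\<lambda>m. (2 * (real m ^ 2 - real m) + 1) / (2 * real m ^ 2 + 1)) \<longlonglongrightarrow> 1"
    by real_asymp
  then have "(\<lambda>m. ((2 * (real m ^ 2 - real m) + 1) / (2 * real m ^ 2 + 1)) ^ CARD('d)) \<longlonglongrightarrow> 1 ^ CARD('d)"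
    by (rule tendsto_power)
  moreover have "real (card (lattice_box (m\<^sup>2 - m) :: (int ^ 'd) set)) /
        real (card (lattice_box (m\<^sup>2) :: (int ^ 'd) set))
      = ((2 * (real m ^ 2 - real m) + 1) / (2 * real m ^ 2 + 1)) ^ CARD('d)" for m
  proof -
    have "m \<le> m\<^sup>2" by (simp add: power2_eq_square)
    then show ?thesis
      unfolding card_lattice_box power_divide by (simp add: of_nat_diff algebra_simps)
  qed
  ultimately show ?thesis by simp
qed

lemma lp_mass_average_LIMSEQ:
  assumes "1 < \<beta>" "0 < k"
  shows "(\<lambda>m. lp_mass \<beta> (subbox k (m\<^sup>2)) / real (card (lattice_box (m\<^sup>2) :: (int ^ 'd) set)))
    \<longlonglongrightarrow> (\<integral>s. lim_share \<beta> k s \<partial>\<mu>)"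
proof (rule tendsto_sandwich)
  let ?r = "\<lambda>m. real (card (lattice_box (m\<^sup>2 - m) :: (int ^ 'd) set)) /
        real (card (lattice_box (m\<^sup>2) :: (int ^ 'd) set))"
  have le: "m \<le> m\<^sup>2" for m :: nat
    by (simp add: power2_eq_square)
  show "\<forall>\<^sub>F m in sequentially. box_share \<beta> k (2 * m\<^sup>2)
      \<le> lp_mass \<beta> (subbox k (m\<^sup>2)) / real (card (lattice_box (m\<^sup>2) :: (int ^ 'd) set))"
    using lp_mass_subbox_bounds(1)[OF assms le] by simp
  show "\<forall>\<^sub>F m in sequentially.
      lp_mass \<beta> (subbox k (m\<^sup>2)) / real (card (lattice_box (m\<^sup>2) :: (int ^ 'd) set))
      \<le> box_share \<beta> k m + (1 - ?r m) * (\<integral>s. G 0 s \<partial>\<mu>)"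
    using lp_mass_subbox_bounds(2)[OF assms le] by simp
  have "filterlim (\<lambda>m::nat. 2 * m\<^sup>2) sequentially sequentially"
    by (rule filterlim_subseq) (auto simp: strict_mono_def power_strict_mono)
  then show "(\<lambda>m. box_share \<beta> k (2 * m\<^sup>2)) \<longlonglongrightarrow> (\<integral>s. lim_share \<beta> k s \<partial>\<mu>)"
    by (rule filterlim_compose[OF box_share_LIMSEQ[OF assms(1)]])
  have "(\<lambda>m. box_share \<beta> k m + (1 - ?r m) * (\<integral>s. G 0 s \<partial>\<mu>))
      \<longlonglongrightarrow> (\<integral>s. lim_share \<beta> k s \<partial>\<mu>) + (1 - 1) * (\<integral>s. G 0 s \<partial>\<mu>)"
    by (intro tendsto_intros box_share_LIMSEQ assms card_lattice_box_ratio)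
  then show "(\<lambda>m. box_share \<beta> k m + (1 - ?r m) * (\<integral>s. G 0 s \<partial>\<mu>))
      \<longlonglongrightarrow> (\<integral>s. lim_share \<beta> k s \<partial>\<mu>)"
    by simp
qed

section \<open>Limits of the shares on and off the summable set\<close>

lemma sum_subbox:
  assumes "0 < k"
  shows "(\<Sum>t\<in>subbox k m. f t) = (\<Sum>u\<in>lattice_box m. f (int k *s u))"
  by (subst sum.reindex) (auto intro: inj_on_subset[OF inj_lattice_scale[OF assms]])

text \<open>The denominators increase to infinity and the exponent \<open>1 - 1 / \<beta>\<close> is
  positive, so the weight on \<open>G 0\<close> tends to zero.\<close>

lemma lim_share_not_summable:
  assumes "1 < \<beta>" "0 < k" and s: "s \<in> space \<mu>" "s \<notin> sublattice_summable \<beta> k"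
  shows "lim_share \<beta> k s = 0"
proof -
  define S where "S m = (\<Sum>t\<in>subbox k m. G t s powr \<beta>)" for m
  have "incseq S"
    unfolding S_def incseq_def
    by (auto intro!: sum_mono2 image_mono lattice_box_mono)
  have summable_iff: "s \<in> sublattice_summable \<beta> k \<longleftrightarrow> (\<exists>N :: nat. \<forall>m. S m \<le> real N)"
    unfolding sublattice_summable_def S_def sum_subbox[OF \<open>0 < k\<close>] using s(1)
    by (simp add: summable_on_iff_lattice_box)
  have "filterlim S at_top sequentially"
    unfolding filterlim_at_top eventually_sequentially
  proof
    fix Z :: real
    obtain N :: nat where "Z \<le> real N" using real_arch_simple by blast
    have "\<not> (\<forall>m. S m \<le> real N)"
      using s(2) unfolding summable_iff by blast
    then obtain m where "real N < S m" by (auto simp: not_le)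
    then have "Z \<le> S n" if "m \<le> n" for n
      using \<open>Z \<le> real N\<close> incseqD[OF \<open>incseq S\<close> that] by linarith
    then show "\<exists>M. \<forall>n\<ge>M. Z \<le> S n" by blast
  qed
  then have "(\<lambda>m. G 0 s powr \<beta> / S m) \<longlonglongrightarrow> 0"
    by (rule real_tendsto_divide_at_top[OF tendsto_const])
  then have "(\<lambda>m. (G 0 s powr \<beta> / S m) powr (1 - 1 / \<beta>)) \<longlonglongrightarrow> 0"
    by (rule tendsto_zero_powrI[OF _ tendsto_const])
      (use \<open>1 < \<beta>\<close> in \<open>auto simp: S_def sum_nonneg\<close>)
  then have "(\<lambda>m. share \<beta> (subbox k m) s) \<longlonglongrightarrow> G 0 s * 0"
    unfolding share_def S_def by (rule tendsto_mult_left)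
  then show ?thesis
    using LIMSEQ_unique[OF share_subbox_LIMSEQ[OF \<open>1 < \<beta>\<close>]] by simp
qed

text \<open>Where \<open>G 0\<close> vanishes, the bound by \<open>G 0\<close> suffices. Elsewhere
  summability on the sublattice would imply summability on the orbit almost everywhere, so the
  denominators diverge.\<close>

lemma lim_share_not_orbit_summable:
  assumes "1 < \<beta>" "0 < k"
  shows "AE s in \<mu>. s \<notin> orbit_summable \<longrightarrow> lim_share \<beta> k s = 0"
proof -
  have "0 < \<beta>" using assms by simp
  show ?thesis
    using sublattice_orbit_summable[OF \<open>0 < k\<close> \<open>0 < \<beta>\<close>] AE_space
  proof eventually_elim
    case (elim s)
    show ?case
    proof
      assume s: "s \<notin> orbit_summable"
      show "lim_share \<beta> k s = 0"
      proof (cases "G 0 s = 0")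
        case True
        then show ?thesis
          using lim_share_bounds[OF \<open>1 < \<beta>\<close>, of k s] by simp
      next
        case False
        then have "0 < G (int k *s 0) s"
          using G_nonneg[of 0 s] by (simp add: order_less_le)
        then show ?thesis
          using elim s lim_share_not_summable[OF assms] by blast
      qed
    qed
  qed
qed

text \<open>A finite set \<open>F\<close> carries all but \<open>e\<close> of the sum of the powers.
  Once the spacing exceeds the radius of a box around \<open>F\<close>, the nonzero sublattice
  points miss \<open>F\<close> and add at most \<open>e\<close> to the denominator.\<close>

lemma lim_share_LIMSEQ:
  assumes "1 < \<beta>" and s: "s \<in> orbit_summable"
  shows "(\<lambda>k. lim_share \<beta> (Suc k) s) \<longlonglongrightarrow> G 0 s"
proof (cases "G 0 s = 0")
  case True
  then have "lim_share \<beta> k s = 0" for k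
    using lim_share_bounds[OF \<open>1 < \<beta>\<close>, of k s] by simp
  then show ?thesis using True by simp
next
  case False
  then have G0: "0 < G 0 s" using G_nonneg[of 0 s] by linarith
  \<comment> \<open>A lower bound for the share when the indices other than \<open>0\<close>
    contribute at most \<open>e\<close>; it tends to \<open>G 0 s\<close> as \<open>e\<close>
    decreases to zero.\<close>
  define \<rho> where "\<rho> e = G 0 s * (G 0 s powr \<beta> / (G 0 s powr \<beta> + e)) powr (1 - 1 / \<beta>)" for e
  have "(\<rho> \<longlongrightarrow> G 0 s * (G 0 s powr \<beta> / (G 0 s powr \<beta> + 0)) powr (1 - 1 / \<beta>)) (at_right 0)"
    unfolding \<rho>_def using G0 by (intro tendsto_intros) auto
  then have \<rho>: "(\<rho> \<longlongrightarrow> G 0 s) (at_right 0)"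
    using G0 by simp
  have sm: "(\<lambda>t. G t s powr \<beta>) summable_on UNIV"
    using s \<open>1 < \<beta>\<close> by (intro summable_powr_of_summable) (auto simp: orbit_summable_def)
  define L where "L = infsum (\<lambda>t. G t s powr \<beta>) UNIV"
  show ?thesis
  proof (rule order_tendstoI)
    fix a assume "a < G 0 s"
    then have "\<forall>\<^sub>F e in at_right 0. a < \<rho> e \<and> 0 < e"
      by (intro eventually_conj order_tendstoD(1)[OF \<rho>] eventually_at_right_less)
    then obtain e where e: "a < \<rho> e" "0 < e"
      using eventually_happens trivial_limit_at_right_real by blast
    have "(sum (\<lambda>t. G t s powr \<beta>) \<longlongrightarrow> L) (finite_subsets_at_top UNIV)"
      using has_sum_infsum[OF sm] by (simp add: has_sum_def L_def)
    then have "\<forall>\<^sub>F F in finite_subsets_at_top UNIV. L - e < (\<Sum>t\<in>F. G t s powr \<beta>)"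
      using e by (intro order_tendstoD(1)) auto
    then obtain F where F: "finite F" "L - e < (\<Sum>t\<in>F. G t s powr \<beta>)"
      unfolding eventually_finite_subsets_at_top by blast
    obtain n where n: "F \<subseteq> lattice_box n"
      using finite_subset_lattice_box[OF F(1)] .
    have "\<rho> e \<le> lim_share \<beta> k s" if k: "n < k" for k
    proof -
      have "0 < k" using k by simp
      have "\<rho> e \<le> share \<beta> (subbox k m) s" for m
      proof -
        define T where "T = subbox k m - {0}"
        have "finite T" by (simp add: T_def)
        have "T \<inter> F = {}"
        proof -
          \<comment> \<open>A nonzero multiple of \<open>k\<close> has absolute value at least
            \<open>k\<close>, which exceeds \<open>n\<close>.\<close>
          have False if u: "int k *s u \<in> lattice_box n" "u \<noteq> 0" for u :: "int ^ 'd"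
          proof -
            obtain i where i: "u $ i \<noteq> 0" using u(2) by (auto simp: vec_eq_iff)
            have "int k * 1 \<le> int k * \<bar>u $ i\<bar>"
              using i by (intro mult_left_mono) auto
            also have "\<dots> = \<bar>(int k *s u) $ i\<bar>"
              by (simp add: abs_mult)
            also have "\<dots> \<le> int n"
              using u(1) by (simp add: lattice_box_def)
            finally show False using k by simp
          qed
          then show ?thesis
            using n unfolding T_def by fastforce
        qed
        then have "(\<Sum>t\<in>T. G t s powr \<beta>) + (\<Sum>t\<in>F. G t s powr \<beta>) = (\<Sum>t\<in>T \<union> F. G t s powr \<beta>)"
          using \<open>finite T\<close> F(1) by (simp add: sum.union_disjoint)
        also have "\<dots> \<le> L"
          unfolding L_def using \<open>finite T\<close> F(1) by (intro finite_sum_le_infsum sm) auto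
        finally have T: "(\<Sum>t\<in>T. G t s powr \<beta>) \<le> e" using F(2) by linarith
        have "(\<Sum>t\<in>subbox k m. G t s powr \<beta>) = G 0 s powr \<beta> + (\<Sum>t\<in>T. G t s powr \<beta>)"
          unfolding T_def using zero_in_subbox by (intro sum.remove) auto
        moreover have "0 \<le> (\<Sum>t\<in>T. G t s powr \<beta>)" by (intro sum_nonneg) simp
        ultimately have "G 0 s powr \<beta> / (G 0 s powr \<beta> + e)
            \<le> G 0 s powr \<beta> / (\<Sum>t\<in>subbox k m. G t s powr \<beta>)"
          using T G0 e by (intro divide_left_mono mult_pos_pos) (auto intro: add_pos_pos add_pos_nonneg)
        then show ?thesis
          unfolding \<rho>_def share_def using G0 e \<open>1 < \<beta>\<close>
          by (intro mult_left_mono powr_mono2) auto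
      qed
      then show ?thesis
        by (intro LIMSEQ_le_const[OF share_subbox_LIMSEQ[OF \<open>1 < \<beta>\<close>]]) auto
    qed
    then show "\<forall>\<^sub>F k in sequentially. a < lim_share \<beta> (Suc k) s"
      unfolding eventually_sequentially using e(1)
      by (intro exI[of _ n] allI impI) (meson le_imp_less_Suc less_le_trans)
  next
    fix a assume "G 0 s < a"
    then have "lim_share \<beta> (Suc k) s < a" for k
      using lim_share_bounds(2)[OF \<open>1 < \<beta>\<close>, of "Suc k" s] by linarith
    then show "\<forall>\<^sub>F k in sequentially. lim_share \<beta> (Suc k) s < a"
      by simp
  qed
qed

text \<open>Dominated convergence with majorant \<open>G 0\<close>. Writing \<open>Suc k\<close>
  excludes the degenerate spacing zero.\<close>

lemma integral_lim_share_LIMSEQ: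
  assumes "1 < \<beta>"
  shows "(\<lambda>k. \<integral>s. lim_share \<beta> (Suc k) s \<partial>\<mu>) \<longlonglongrightarrow> (\<integral>s. indicator orbit_summable s * G 0 s \<partial>\<mu>)"
proof (rule integral_dominated_convergence[where w = "G 0"])
  have "AE s in \<mu>. \<forall>k. s \<notin> orbit_summable \<longrightarrow> lim_share \<beta> (Suc k) s = 0"
    unfolding AE_all_countable using lim_share_not_orbit_summable[OF assms] by blast
  then show "AE s in \<mu>. (\<lambda>k. lim_share \<beta> (Suc k) s) \<longlonglongrightarrow> indicator orbit_summable s * G 0 s"
  proof eventually_elim
    case (elim s)
    then show ?case
      using lim_share_LIMSEQ[OF assms, of s] by (cases "s \<in> orbit_summable") auto
  qed
  show "AE s in \<mu>. norm (lim_share \<beta> (Suc k) s) \<le> G 0 s" for k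
    using lim_share_bounds[OF assms] by auto
qed (use lim_share_measurable[OF assms] G_integrable_0 in measurable)

end

text \<open>Two limits, first in the box radius and then in the spacing, express each side through
  \<open>lp_mass\<close> alone.\<close>

lemma integral_orbit_summable_cong:
  fixes \<phi>1 :: "int ^ 'd \<Rightarrow> 's1 \<Rightarrow> 's1" and \<phi>2 :: "int ^ 'd \<Rightarrow> 's2 \<Rightarrow> 's2"
  assumes "scaled_action \<mu>1 \<phi>1 w1 G1" "scaled_action \<mu>2 \<phi>2 w2 G2" "1 < \<beta>"
    and eq: "\<And>T. finite T \<Longrightarrow> scaled_action.lp_mass \<mu>1 G1 \<beta> T = scaled_action.lp_mass \<mu>2 G2 \<beta> T"
  shows "(\<integral>s. indicator (scaled_action.orbit_summable \<mu>1 G1) s * G1 0 s \<partial>\<mu>1)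
       = (\<integral>s. indicator (scaled_action.orbit_summable \<mu>2 G2) s * G2 0 s \<partial>\<mu>2)"
proof -
  interpret A: scaled_action \<mu>1 \<phi>1 w1 G1 by fact
  interpret B: scaled_action \<mu>2 \<phi>2 w2 G2 by fact
  have "(\<integral>s. A.lim_share \<beta> (Suc k) s \<partial>\<mu>1) = (\<integral>s. B.lim_share \<beta> (Suc k) s \<partial>\<mu>2)" for k
    using LIMSEQ_unique[OF A.lp_mass_average_LIMSEQ[OF \<open>1 < \<beta>\<close>, of "Suc k"]]
      B.lp_mass_average_LIMSEQ[OF \<open>1 < \<beta>\<close>, of "Suc k"] by (simp add: eq)
  then show ?thesis
    using LIMSEQ_unique[OF A.integral_lim_share_LIMSEQ[OF \<open>1 < \<beta>\<close>]]
      B.integral_lim_share_LIMSEQ[OF \<open>1 < \<beta>\<close>] by simp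
qed

section \<open>Gaussian averages\<close>

definition gauss :: "real measure" where
  "gauss = density lborel (\<lambda>x. ennreal (std_normal_density x))"

lemma prob_space_gauss: "prob_space gauss"
  unfolding gauss_def by (rule prob_space_normal_density) simp

lemma sets_gauss [simp, measurable_cong]: "sets gauss = sets borel"
  by (simp add: gauss_def)

lemma space_gauss [simp]: "space gauss = UNIV"
  by (simp add: gauss_def)

lemma indep_vars_PiM_coordinates:
  assumes "\<And>i. i \<in> I \<Longrightarrow> prob_space (M i)" "I \<noteq> {}"
  shows "prob_space.indep_vars (PiM I M) M (\<lambda>i \<omega>. \<omega> i) I"
proof -
  interpret prob_space "PiM I M"
    by (rule prob_space_PiM) (rule assms)
  have "distr (PiM I M) (PiM I M) (\<lambda>x. \<lambda>i\<in>I. x i) = distr (PiM I M) (PiM I M) (\<lambda>x. x)"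
    by (rule distr_cong) (auto simp: space_PiM)
  also have "\<dots> = PiM I M" by (rule distr_id)
  also have "\<dots> = PiM I (\<lambda>i. distr (PiM I M) (M i) (\<lambda>\<omega>. \<omega> i))"
    by (rule PiM_cong) (simp_all add: distr_PiM_component assms)
  finally show ?thesis
    using assms(2) by (subst indep_vars_iff_distr_eq_PiM') auto
qed

definition gauss_moment :: "real \<Rightarrow> ennreal" where
  "gauss_moment \<alpha> = (\<integral>\<^sup>+z. ennreal (\<bar>z\<bar> powr \<alpha>) \<partial>gauss)"

text \<open>A vanishing moment would concentrate Lebesgue measure at \<open>0\<close>. Together with
  finiteness below, this lets the moment be cancelled when two averages are compared.\<close>

lemma gauss_moment_pos: "gauss_moment \<alpha> \<noteq> 0"
proof
  assume "gauss_moment \<alpha> = 0"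
  then have "AE z in gauss. ennreal (\<bar>z\<bar> powr \<alpha>) = 0"
    unfolding gauss_moment_def by (subst (asm) nn_integral_0_iff_AE) auto
  then have "AE z in lborel. 0 < std_normal_density z \<longrightarrow> z = 0"
    unfolding gauss_def by (subst (asm) AE_density) (auto simp: ennreal_eq_0_iff)
  then have "AE z in (lborel :: real measure). z = 0"
    by eventually_elim (simp add: normal_density_pos)
  then have "emeasure lborel (UNIV - {0 :: real}) = 0"
    by (subst (asm) AE_iff_measurable[OF _ refl]) (auto simp: Compl_eq_Diff_UNIV[symmetric] Collect_neg_eq)
  moreover have "emeasure lborel {1..2 :: real} \<le> emeasure lborel (UNIV - {0 :: real})"
    by (rule emeasure_mono) auto
  ultimately show False by simp
qed

lemma gauss_moment_finite:
  assumes "0 < \<alpha>" "\<alpha> < 2"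
  shows "gauss_moment \<alpha> < \<infinity>"
proof -
  have "gauss_moment \<alpha> = (\<integral>\<^sup>+z. ennreal (std_normal_density z * \<bar>z\<bar> powr \<alpha>) \<partial>lborel)"
    unfolding gauss_moment_def gauss_def
    by (subst nn_integral_density) (auto simp: ennreal_mult)
  \<comment> \<open>The power \<open>\<bar>z\<bar> ^ 0\<close> writes the bound
    \<open>1 + z\<^sup>2\<close> as a sum of absolute moments known to be integrable.\<close>
  also have "\<dots> \<le> (\<integral>\<^sup>+z. ennreal (std_normal_density z * \<bar>z\<bar> ^ 0 + std_normal_density z * \<bar>z\<bar> ^ 2) \<partial>lborel)"
  proof (intro nn_integral_mono ennreal_leI)
    fix z :: real
    have "\<bar>z\<bar> powr \<alpha> \<le> 1 + \<bar>z\<bar> ^ 2"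
    proof (cases "\<bar>z\<bar> \<le> 1")
      case True
      then have "\<bar>z\<bar> powr \<alpha> \<le> 1 powr \<alpha>" using assms by (intro powr_mono2) auto
      then show ?thesis by (simp add: add_increasing2)
    next
      case False
      then have "\<bar>z\<bar> powr \<alpha> \<le> \<bar>z\<bar> powr 2" using assms by (intro powr_mono) auto
      also have "\<dots> = \<bar>z\<bar> ^ 2" using False by (subst powr_numeral) auto
      finally show ?thesis by simp
    qed
    then have "std_normal_density z * \<bar>z\<bar> powr \<alpha> \<le> std_normal_density z * (1 + \<bar>z\<bar> ^ 2)"
      by (rule mult_left_mono) simp
    then show "std_normal_density z * \<bar>z\<bar> powr \<alpha>
        \<le> std_normal_density z * \<bar>z\<bar> ^ 0 + std_normal_density z * \<bar>z\<bar> ^ 2"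
      by (simp add: algebra_simps)
  qed
  also have "\<dots> < \<infinity>"
  proof -
    have "integrable lborel (\<lambda>z. std_normal_density z * \<bar>z\<bar> ^ 0 + std_normal_density z * \<bar>z\<bar> ^ 2)"
      by (intro Bochner_Integration.integrable_add integrable_std_normal_moment_abs)
    then show ?thesis
      by (simp add: integrable_iff_bounded add_nonneg_nonneg)
  qed
  finally show ?thesis .
qed

text \<open>The combination is centred normal with variance the sum of the squares, so dividing by
  its standard deviation leaves a standard normal moment.\<close>

lemma gauss_linear_combination_moment:
  assumes "finite T" "0 < \<alpha>"
  shows "(\<integral>\<^sup>+c. ennreal (\<bar>\<Sum>t\<in>T. c t * x t\<bar> powr \<alpha>) \<partial>PiM T (\<lambda>_. gauss))
    = ennreal ((\<Sum>t\<in>T. (x t)\<^sup>2) powr (\<alpha> / 2)) * gauss_moment \<alpha>"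
proof (cases "\<exists>t\<in>T. x t \<noteq> 0")
  case False
  then have "(\<Sum>t\<in>T. c t * x t) = 0" "(\<Sum>t\<in>T. (x t)\<^sup>2) = 0" for c :: "'a \<Rightarrow> real"
    by (auto intro: sum.neutral)
  then show ?thesis by simp
next
  case True
  \<comment> \<open>Zero coefficients are removed first, since the normal densities need positive
    standard deviations.\<close>
  define T' where "T' = {t \<in> T. x t \<noteq> 0}"
  have T': "finite T'" "T' \<noteq> {}" "T' \<subseteq> T" "\<And>t. t \<in> T' \<Longrightarrow> x t \<noteq> 0"
    using True assms by (auto simp: T'_def)
  interpret prob_space "PiM T (\<lambda>_. gauss)"
    by (intro prob_space_PiM prob_space_gauss)
  have "indep_vars (\<lambda>_. gauss) (\<lambda>t c. c t) T"
    using True by (intro indep_vars_PiM_coordinates prob_space_gauss) auto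
  then have "indep_vars (\<lambda>_. borel) (\<lambda>t c. x t * c t) T"
    by (rule indep_vars_compose2) simp
  then have indep: "indep_vars (\<lambda>_. borel) (\<lambda>t c. x t * c t) T'"
    using T'(3) by (rule indep_vars_subset)
  have normal: "distributed (PiM T (\<lambda>_. gauss)) lborel (\<lambda>c. x t * c t) (normal_density 0 \<bar>x t\<bar>)"
    if t: "t \<in> T'" for t
  proof -
    have tT: "t \<in> T" using t T'(3) by blast
    have "distr (PiM T (\<lambda>_. gauss)) lborel (\<lambda>c. c t) = distr (PiM T (\<lambda>_. gauss)) gauss (\<lambda>c. c t)"
      by (rule distr_cong) auto
    also have "\<dots> = gauss"
      using tT prob_space_gauss by (intro distr_PiM_component) auto
    finally have "distributed (PiM T (\<lambda>_. gauss)) lborel (\<lambda>c. c t) std_normal_density"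
      using tT unfolding distributed_def gauss_def[symmetric] by (simp add: measurable_component_singleton)
    from normal_density_affine[OF this, of "x t" 0] show ?thesis
      using T'(4)[OF t] by simp
  qed
  define \<sigma> where "\<sigma> = sqrt (\<Sum>t\<in>T'. (x t)\<^sup>2)"
  have sumT': "(\<Sum>t\<in>T'. (x t)\<^sup>2) = (\<Sum>t\<in>T. (x t)\<^sup>2)" "(\<Sum>t\<in>T'. x t * c t) = (\<Sum>t\<in>T. c t * x t)" for c
    using assms unfolding T'_def by (auto intro!: sum.mono_neutral_cong_left)
  have "0 < (\<Sum>t\<in>T'. (x t)\<^sup>2)"
    using T' by (intro sum_pos) auto
  then have "0 < \<sigma>" by (simp add: \<sigma>_def)
  have "distributed (PiM T (\<lambda>_. gauss)) lborel (\<lambda>c. \<Sum>t\<in>T'. x t * c t)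
      (normal_density (\<Sum>t\<in>T'. 0) (sqrt (\<Sum>t\<in>T'. \<bar>x t\<bar>\<^sup>2)))"
    using T' indep normal by (intro sum_indep_normal) auto
  then have "distributed (PiM T (\<lambda>_. gauss)) lborel (\<lambda>c. \<Sum>t\<in>T'. x t * c t) (normal_density 0 \<sigma>)"
    by (simp add: \<sigma>_def)
  then have D: "distributed (PiM T (\<lambda>_. gauss)) lborel (\<lambda>c. (\<Sum>t\<in>T'. x t * c t) / \<sigma>) std_normal_density"
    using normal_standard_normal_convert[OF \<open>0 < \<sigma>\<close>] by simp
  have "(\<integral>\<^sup>+c. ennreal (\<bar>\<Sum>t\<in>T. c t * x t\<bar> powr \<alpha>) \<partial>PiM T (\<lambda>_. gauss))
      = (\<integral>\<^sup>+c. ennreal (\<sigma> powr \<alpha> * \<bar>(\<Sum>t\<in>T'. x t * c t) / \<sigma>\<bar> powr \<alpha>) \<partial>PiM T (\<lambda>_. gauss))"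
    using \<open>0 < \<sigma>\<close> by (simp add: sumT' abs_divide powr_divide)
  also have "\<dots> = (\<integral>\<^sup>+z. ennreal (std_normal_density z) * ennreal (\<sigma> powr \<alpha> * \<bar>z\<bar> powr \<alpha>) \<partial>lborel)"
    by (rule distributed_nn_integral[OF D, symmetric]) simp
  also have "\<dots> = (\<integral>\<^sup>+z. ennreal (\<sigma> powr \<alpha> * \<bar>z\<bar> powr \<alpha>) \<partial>gauss)"
    unfolding gauss_def by (subst nn_integral_density) auto
  also have "\<dots> = ennreal (\<sigma> powr \<alpha>) * gauss_moment \<alpha>"
    unfolding gauss_moment_def by (subst nn_integral_cmult[symmetric]) (auto simp: ennreal_mult)
  also have "\<sigma> powr \<alpha> = (\<Sum>t\<in>T. (x t)\<^sup>2) powr (\<alpha> / 2)"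
    using \<open>0 < (\<Sum>t\<in>T'. (x t)\<^sup>2)\<close> unfolding \<sigma>_def sumT'(1)
    by (simp add: powr_half_sqrt[symmetric] powr_powr)
  finally show ?thesis .
qed

text \<open>Tonelli moves the Gaussian average inside, where it is explicit for fixed
  \<open>s\<close>. The squares it produces are the origin of the exponent
  \<open>2 / \<alpha>\<close>.\<close>

lemma gauss_average_nn_integral:
  assumes "sigma_finite_measure \<mu>" and f [measurable]: "\<And>t. f t \<in> borel_measurable \<mu>"
    and T: "finite T" and "0 < \<alpha>"
  shows "(\<integral>\<^sup>+c. (\<integral>\<^sup>+s. ennreal (\<bar>\<Sum>t\<in>T. c t * f t s\<bar> powr \<alpha>) \<partial>\<mu>) \<partial>PiM T (\<lambda>_. gauss))
    = (\<integral>\<^sup>+s. ennreal ((\<Sum>t\<in>T. (f t s)\<^sup>2) powr (\<alpha> / 2)) \<partial>\<mu>) * gauss_moment \<alpha>"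
proof -
  interpret S: sigma_finite_measure \<mu> by fact
  interpret P: prob_space "PiM T (\<lambda>_. gauss)"
    by (intro prob_space_PiM prob_space_gauss)
  interpret pair_sigma_finite "PiM T (\<lambda>_. gauss)" \<mu> ..
  have [measurable]: "(\<lambda>p. fst p t) \<in> borel_measurable (PiM T (\<lambda>_. gauss) \<Otimes>\<^sub>M \<mu>)" if "t \<in> T" for t
    using measurable_compose[OF measurable_fst measurable_component_singleton[OF that, of "\<lambda>_. gauss"], of \<mu>]
    by (simp cong: measurable_cong_sets)
  have "(\<integral>\<^sup>+c. (\<integral>\<^sup>+s. ennreal (\<bar>\<Sum>t\<in>T. c t * f t s\<bar> powr \<alpha>) \<partial>\<mu>) \<partial>PiM T (\<lambda>_. gauss))
      = (\<integral>\<^sup>+s. (\<integral>\<^sup>+c. ennreal (\<bar>\<Sum>t\<in>T. c t * f t s\<bar> powr \<alpha>) \<partial>PiM T (\<lambda>_. gauss)) \<partial>\<mu>)"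
    by (intro Fubini'[symmetric]) (simp add: split_beta')
  also have "\<dots> = (\<integral>\<^sup>+s. ennreal ((\<Sum>t\<in>T. (f t s)\<^sup>2) powr (\<alpha> / 2)) * gauss_moment \<alpha> \<partial>\<mu>)"
    by (simp add: gauss_linear_combination_moment[OF T \<open>0 < \<alpha>\<close>])
  also have "\<dots> = (\<integral>\<^sup>+s. ennreal ((\<Sum>t\<in>T. (f t s)\<^sup>2) powr (\<alpha> / 2)) \<partial>\<mu>) * gauss_moment \<alpha>"
    by (rule nn_integral_multc) simp
  finally show ?thesis .
qed

section \<open>Linearity of the stable integral\<close>

text \<open>Comparison with the largest term works for every positive \<open>\<alpha>\<close>, also
  below \<open>1\<close>, where the power is not convex.\<close>

lemma abs_sum_powr_le:
  fixes a :: "'a \<Rightarrow> real"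
  assumes "finite T" "0 < \<alpha>"
  shows "\<bar>\<Sum>t\<in>T. a t\<bar> powr \<alpha> \<le> real (card T) powr \<alpha> * (\<Sum>t\<in>T. \<bar>a t\<bar> powr \<alpha>)"
proof (cases "T = {}")
  case False
  define m where "m = Max ((\<lambda>t. \<bar>a t\<bar>) ` T)"
  have "m \<in> (\<lambda>t. \<bar>a t\<bar>) ` T"
    unfolding m_def using assms False by (intro Max_in) auto
  then obtain t0 where t0: "t0 \<in> T" "m = \<bar>a t0\<bar>" by auto
  have "\<bar>\<Sum>t\<in>T. a t\<bar> \<le> (\<Sum>t\<in>T. \<bar>a t\<bar>)"
    by (rule sum_abs)
  also have "\<dots> \<le> real (card T) * m"
    unfolding m_def using assms by (intro sum_bounded_above Max_ge) auto
  finally have "\<bar>\<Sum>t\<in>T. a t\<bar> \<le> real (card T) * m" .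
  then have "\<bar>\<Sum>t\<in>T. a t\<bar> powr \<alpha> \<le> (real (card T) * m) powr \<alpha>"
    using assms by (intro powr_mono2) auto
  also have "\<dots> = real (card T) powr \<alpha> * \<bar>a t0\<bar> powr \<alpha>"
    using t0 by (simp add: powr_mult)
  also have "\<dots> \<le> real (card T) powr \<alpha> * (\<Sum>t\<in>T. \<bar>a t\<bar> powr \<alpha>)"
    using assms t0 by (intro mult_left_mono member_le_sum) auto
  finally show ?thesis .
qed simp

lemma L_space_linear_combination:
  assumes "0 < \<alpha>" "finite T" "\<And>t. t \<in> T \<Longrightarrow> f t \<in> L_space \<alpha> \<mu>"
  shows "(\<lambda>s. \<Sum>t\<in>T. c t * f t s) \<in> L_space \<alpha> \<mu>"
proof -
  have f [measurable]: "f t \<in> borel_measurable \<mu>" if "t \<in> T" for t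
    using assms(3)[OF that] by (simp add: L_space_def)
  have "integrable \<mu> (\<lambda>s. real (card T) powr \<alpha> * (\<Sum>t\<in>T. \<bar>c t\<bar> powr \<alpha> * \<bar>f t s\<bar> powr \<alpha>))"
    using assms(3) by (intro integrable_mult_right integrable_sum) (auto simp: L_space_def)
  then have "integrable \<mu> (\<lambda>s. \<bar>\<Sum>t\<in>T. c t * f t s\<bar> powr \<alpha>)"
  proof (rule Bochner_Integration.integrable_bound)
    show "AE s in \<mu>. norm (\<bar>\<Sum>t\<in>T. c t * f t s\<bar> powr \<alpha>)
        \<le> norm (real (card T) powr \<alpha> * (\<Sum>t\<in>T. \<bar>c t\<bar> powr \<alpha> * \<bar>f t s\<bar> powr \<alpha>))"
      using abs_sum_powr_le[OF assms(2,1), of "\<lambda>t. c t * f t _"]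
      by (auto simp: abs_mult powr_mult sum_nonneg)
  qed measurable
  then show ?thesis
    by (simp add: L_space_def)
qed

lemma independently_scattered_sums:
  assumes "independently_scattered \<mu> Q M"
    and "\<And>n. A n \<in> sets \<mu>" "\<And>n. emeasure \<mu> (A n) < \<infinity>" "disjoint_family A"
    and "emeasure \<mu> (\<Union>n. A n) < \<infinity>"
  shows "AE \<omega> in Q. (\<lambda>n :: nat. M (A n) \<omega>) sums M (\<Union>n. A n) \<omega>"
  using assms unfolding independently_scattered_def by blast

text \<open>Countable additivity over empty sets makes a constant series converge, which forces its
  term to be zero.\<close>

lemma independently_scattered_empty:
  assumes "independently_scattered \<mu> Q M"
  shows "AE \<omega> in Q. M {} \<omega> = 0"
proof -
  have "AE \<omega> in Q. (\<lambda>n :: nat. M {} \<omega>) sums M {} \<omega>"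
    using independently_scattered_sums[OF assms, of "\<lambda>_. {}"] by (simp add: disjoint_family_on_def)
  then show ?thesis
    by eventually_elim (simp add: sums_iff summable_const_iff)
qed

text \<open>\<open>binaryset\<close> pads the pair with empty sets, whose values vanish almost
  surely.\<close>

lemma independently_scattered_Un:
  assumes sc: "independently_scattered \<mu> Q M"
    and A: "A \<in> sets \<mu>" "emeasure \<mu> A < \<infinity>" and B: "B \<in> sets \<mu>" "emeasure \<mu> B < \<infinity>"
    and disj: "A \<inter> B = {}"
  shows "AE \<omega> in Q. M (A \<union> B) \<omega> = M A \<omega> + M B \<omega>"
proof -
  have "AE \<omega> in Q. (\<lambda>n. M (binaryset A B n) \<omega>) sums M (\<Union>n. binaryset A B n) \<omega>"
  proof (rule independently_scattered_sums[OF sc])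
    show "disjoint_family (binaryset A B)"
      using disj by (auto simp: disjoint_family_on_def binaryset_def)
    show "emeasure \<mu> (\<Union>n. binaryset A B n) < \<infinity>"
      using emeasure_subadditive[OF A(1) B(1)] A(2) B(2)
      by (simp add: UN_binaryset_eq) (meson ennreal_add_less_top le_less_trans)
  qed (use A B in \<open>auto simp: binaryset_def\<close>)
  then show ?thesis
    using independently_scattered_empty[OF sc]
  proof eventually_elim
    case (elim \<omega>)
    have "(\<lambda>n. M (binaryset A B n) \<omega>) sums (\<Sum>n<2. M (binaryset A B n) \<omega>)"
      by (rule sums_finite) (use elim(2) in \<open>auto simp: binaryset_def\<close>)
    then have "(\<lambda>n. M (binaryset A B n) \<omega>) sums (M A \<omega> + M B \<omega>)"
      by (simp add: binaryset_def lessThan_Suc numeral_2_eq_2 add.commute)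
    then show ?case
      using elim(1) sums_unique2 by (fastforce simp: UN_binaryset_eq)
  qed
qed

lemma independently_scattered_UN:
  assumes sc: "independently_scattered \<mu> Q M" and "finite I"
    and "\<And>i. i \<in> I \<Longrightarrow> A i \<in> sets \<mu>" "\<And>i. i \<in> I \<Longrightarrow> emeasure \<mu> (A i) < \<infinity>"
    and "disjoint_family_on A I"
  shows "AE \<omega> in Q. M (\<Union>i\<in>I. A i) \<omega> = (\<Sum>i\<in>I. M (A i) \<omega>)"
  using assms(2-)
proof (induction I rule: finite_induct)
  case empty
  then show ?case using independently_scattered_empty[OF sc] by simp
next
  case (insert i I)
  have "emeasure \<mu> (\<Union>i\<in>I. A i) \<le> (\<Sum>i\<in>I. emeasure \<mu> (A i))"
    using insert by (intro emeasure_subadditive_finite) auto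
  also have "\<dots> < \<infinity>"
    using insert by (auto simp: less_top[symmetric] top_unique)
  finally have fin: "emeasure \<mu> (\<Union>i\<in>I. A i) < \<infinity>" .
  have "AE \<omega> in Q. M (A i \<union> (\<Union>i\<in>I. A i)) \<omega> = M (A i) \<omega> + M (\<Union>i\<in>I. A i) \<omega>"
    using insert fin
    by (intro independently_scattered_Un[OF sc]) (auto simp: disjoint_family_on_def)
  moreover have "AE \<omega> in Q. M (\<Union>i\<in>I. A i) \<omega> = (\<Sum>i\<in>I. M (A i) \<omega>)"
    using insert by (intro insert.IH) (auto simp: disjoint_family_on_def)
  ultimately show ?case
    by eventually_elim (use insert in simp)
qed

text \<open>Finite additivity refines each level set of the composed function into level sets of
  \<open>h\<close>. The value \<open>z\<close> is left out because its level set may have infinite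
  measure, and \<open>F z = 0\<close> makes this harmless.\<close>

lemma simple_stoch_integral_compose:
  fixes h :: "'s \<Rightarrow> 'b" and F :: "'b \<Rightarrow> real"
  assumes sc: "independently_scattered \<mu> Q M"
    and h: "simple_function \<mu> h" "emeasure \<mu> {s \<in> space \<mu>. h s \<noteq> z} < \<infinity>" and F: "F z = 0"
  shows "AE \<omega> in Q. simple_stoch_integral \<mu> M (\<lambda>s. F (h s)) \<omega> =
    (\<Sum>p\<in>h ` space \<mu> - {z}. F p * M (h -` {p} \<inter> space \<mu>) \<omega>)"
proof -
  define R where "R = h ` space \<mu> - {z}"
  define S where "S p = h -` {p} \<inter> space \<mu>" for p
  have "finite R"
    using h(1) by (simp add: R_def simple_function_def)
  have supp: "{s \<in> space \<mu>. h s \<noteq> z} \<in> sets \<mu>"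
    using simple_functionD(2)[OF h(1), of "- {z}"] by (simp add: vimage_def Int_def conj_commute)
  have S: "S p \<in> sets \<mu>" "emeasure \<mu> (S p) < \<infinity>" if "p \<in> R" for p
  proof -
    show "S p \<in> sets \<mu>" unfolding S_def by (rule simple_functionD(2)[OF h(1)])
    have "emeasure \<mu> (S p) \<le> emeasure \<mu> {s \<in> space \<mu>. h s \<noteq> z}"
      using that supp by (intro emeasure_mono) (auto simp: S_def R_def)
    then show "emeasure \<mu> (S p) < \<infinity>" using h(2) by (rule le_less_trans)
  qed
  define Y where "Y = (\<lambda>s. F (h s)) ` space \<mu> - {0}"
  have "finite Y"
    unfolding Y_def using h(1) by (metis finite_Diff finite_imageI image_image simple_function_def)
  have level: "(\<lambda>s. F (h s)) -` {y} \<inter> space \<mu> = (\<Union>p\<in>{p \<in> R. F p = y}. S p)" if "y \<in> Y" for y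
    using that F by (auto simp: R_def S_def Y_def)
  have "AE \<omega> in Q. \<forall>y\<in>Y. M ((\<lambda>s. F (h s)) -` {y} \<inter> space \<mu>) \<omega> = (\<Sum>p\<in>{p \<in> R. F p = y}. M (S p) \<omega>)"
  proof (rule AE_finite_allI[OF \<open>finite Y\<close>])
    fix y assume y: "y \<in> Y"
    show "AE \<omega> in Q. M ((\<lambda>s. F (h s)) -` {y} \<inter> space \<mu>) \<omega> = (\<Sum>p\<in>{p \<in> R. F p = y}. M (S p) \<omega>)"
      unfolding level[OF y] using \<open>finite R\<close> S
      by (intro independently_scattered_UN[OF sc]) (auto simp: disjoint_family_on_def S_def)
  qed
  then show ?thesis
  proof eventually_elim
    case (elim \<omega>)
    \<comment> \<open>Regrouping by the values of \<open>F\<close> requires them to lie in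
      \<open>Y\<close>, so the zeros of \<open>F\<close> are set aside; they contribute
      nothing.\<close>
    define R' where "R' = {p \<in> R. F p \<noteq> 0}"
    have "simple_stoch_integral \<mu> M (\<lambda>s. F (h s)) \<omega> = (\<Sum>y\<in>Y. y * (\<Sum>p\<in>{p \<in> R. F p = y}. M (S p) \<omega>))"
      unfolding simple_stoch_integral_def Y_def[symmetric]
      by (intro sum.cong refl) (use elim in auto)
    also have "\<dots> = (\<Sum>y\<in>Y. \<Sum>p\<in>{p \<in> R'. F p = y}. F p * M (S p) \<omega>)"
      unfolding sum_distrib_left by (intro sum.cong refl) (auto simp: R'_def Y_def)
    also have "\<dots> = (\<Sum>p\<in>R'. F p * M (S p) \<omega>)"
      using \<open>finite R\<close> \<open>finite Y\<close> by (intro sum.group) (auto simp: R'_def R_def Y_def)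
    also have "\<dots> = (\<Sum>p\<in>R. F p * M (S p) \<omega>)"
      using \<open>finite R\<close> by (intro sum.mono_neutral_left) (auto simp: R'_def)
    finally show ?case by (simp add: R_def S_def)
  qed
qed

text \<open>All the functions \<open>g t\<close> are constant on the level sets of the joint function
  \<open>s \<mapsto> (g t s)\<^sub>t\<close>, which serve as a common partition.\<close>

lemma simple_stoch_integral_linear_combination:
  fixes g :: "'t \<Rightarrow> 's \<Rightarrow> real"
  assumes sc: "independently_scattered \<mu> Q M" and T: "finite T"
    and g: "\<And>t. t \<in> T \<Longrightarrow> simple_function \<mu> (g t)"
      "\<And>t. t \<in> T \<Longrightarrow> emeasure \<mu> {s \<in> space \<mu>. g t s \<noteq> 0} < \<infinity>"
  shows "AE \<omega> in Q. simple_stoch_integral \<mu> M (\<lambda>s. \<Sum>t\<in>T. c t * g t s) \<omega> =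
    (\<Sum>t\<in>T. c t * simple_stoch_integral \<mu> M (g t) \<omega>)"
proof -
  define h where "h s = (\<lambda>t\<in>T. g t s)" for s
  \<comment> \<open>The zero tuple, extensional like the values of \<open>h\<close>, so that
    \<open>h s \<noteq> z\<close> means that some \<open>g t s\<close> is nonzero.\<close>
  define z :: "'t \<Rightarrow> real" where "z = (\<lambda>t\<in>T. 0)"
  have gm [measurable]: "g t \<in> borel_measurable \<mu>" if "t \<in> T" for t
    using g(1)[OF that] by (rule borel_measurable_simple_function)
  have h: "simple_function \<mu> h"
    unfolding simple_function_def
  proof
    have "h ` space \<mu> \<subseteq> (\<Pi>\<^sub>E t\<in>T. g t ` space \<mu>)"
      by (auto simp: h_def)
    moreover have "finite (\<Pi>\<^sub>E t\<in>T. g t ` space \<mu>)"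
      using T g(1) by (intro finite_PiE) (auto simp: simple_function_def)
    ultimately show "finite (h ` space \<mu>)"
      by (rule finite_subset)
    show "\<forall>x\<in>h ` space \<mu>. h -` {x} \<inter> space \<mu> \<in> sets \<mu>"
    proof
      fix x assume "x \<in> h ` space \<mu>"
      then obtain s' where x: "x = h s'" by blast
      have "h s = h s' \<longleftrightarrow> (\<forall>t\<in>T. g t s = g t s')" for s
      proof
        assume "h s = h s'"
        then show "\<forall>t\<in>T. g t s = g t s'"
          unfolding h_def by (metis restrict_apply')
      qed (simp add: h_def cong: restrict_cong)
      then have "h -` {x} \<inter> space \<mu> = {s \<in> space \<mu>. \<forall>t\<in>T. g t s = g t s'}"
        unfolding x by auto
      also have "\<dots> \<in> sets \<mu>"
        using T by measurable
      finally show "h -` {x} \<inter> space \<mu> \<in> sets \<mu>" .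
    qed
  qed
  have "emeasure \<mu> {s \<in> space \<mu>. h s \<noteq> z} = emeasure \<mu> (\<Union>t\<in>T. {s \<in> space \<mu>. g t s \<noteq> 0})"
    by (rule arg_cong[of _ _ "emeasure \<mu>"]) (auto simp: h_def z_def fun_eq_iff)
  also have "\<dots> \<le> (\<Sum>t\<in>T. emeasure \<mu> {s \<in> space \<mu>. g t s \<noteq> 0})"
    using T by (intro emeasure_subadditive_finite) auto
  also have "\<dots> < \<infinity>"
    using T g(2) by (auto simp: less_top[symmetric] top_unique)
  finally have fin: "emeasure \<mu> {s \<in> space \<mu>. h s \<noteq> z} < \<infinity>" .
  note compose = simple_stoch_integral_compose[OF sc h fin]
  have "AE \<omega> in Q. \<forall>t\<in>T. simple_stoch_integral \<mu> M (\<lambda>s. h s t) \<omega> =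
      (\<Sum>p\<in>h ` space \<mu> - {z}. p t * M (h -` {p} \<inter> space \<mu>) \<omega>)"
    by (intro AE_finite_allI[OF T] compose) (simp add: z_def)
  moreover have "AE \<omega> in Q. simple_stoch_integral \<mu> M (\<lambda>s. \<Sum>t\<in>T. c t * h s t) \<omega> =
      (\<Sum>p\<in>h ` space \<mu> - {z}. (\<Sum>t\<in>T. c t * p t) * M (h -` {p} \<inter> space \<mu>) \<omega>)"
    by (intro compose) (simp add: z_def)
  ultimately show ?thesis
  proof eventually_elim
    case (elim \<omega>)
    have "simple_stoch_integral \<mu> M (\<lambda>s. \<Sum>t\<in>T. c t * g t s) \<omega>
        = simple_stoch_integral \<mu> M (\<lambda>s. \<Sum>t\<in>T. c t * h s t) \<omega>"
      by (simp add: h_def)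
    also have "\<dots> = (\<Sum>t\<in>T. c t * (\<Sum>p\<in>h ` space \<mu> - {z}. p t * M (h -` {p} \<inter> space \<mu>) \<omega>))"
      unfolding elim(2) sum_distrib_left sum_distrib_right
      by (subst sum.swap) (simp add: mult.assoc)
    also have "\<dots> = (\<Sum>t\<in>T. c t * simple_stoch_integral \<mu> M (g t) \<omega>)"
      using elim(1) by (intro sum.cong refl) (simp add: h_def)
    finally show ?case .
  qed
qed

lemma simple_stoch_integral_measurable:
  assumes sc: "independently_scattered \<mu> Q M"
    and g: "simple_function \<mu> g" "emeasure \<mu> {s \<in> space \<mu>. g s \<noteq> 0} < \<infinity>"
  shows "simple_stoch_integral \<mu> M g \<in> borel_measurable Q"
proof -
  have [measurable]: "M (g -` {y} \<inter> space \<mu>) \<in> borel_measurable Q" if "y \<noteq> 0" for y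
  proof -
    have "{s \<in> space \<mu>. g s \<noteq> 0} \<in> sets \<mu>"
      using simple_functionD(2)[OF g(1), of "- {0}"] by (simp add: vimage_def Int_def conj_commute)
    then have "emeasure \<mu> (g -` {y} \<inter> space \<mu>) \<le> emeasure \<mu> {s \<in> space \<mu>. g s \<noteq> 0}"
      using that by (intro emeasure_mono) auto
    then have "emeasure \<mu> (g -` {y} \<inter> space \<mu>) < \<infinity>"
      using g(2) by (rule le_less_trans)
    then show ?thesis
      using sc simple_functionD(2)[OF g(1)] by (simp add: independently_scattered_def)
  qed
  show ?thesis
    unfolding simple_stoch_integral_def[abs_def] by measurable
qed

text \<open>This covers a deviation event of the combination by finitely many events of its terms.
  The \<open>+ 1\<close> keeps the denominator positive when all coefficients vanish.\<close>

lemma abs_sum_gt_imp_ex: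
  fixes c d :: "'t \<Rightarrow> real"
  assumes "finite T" "0 < \<epsilon>" "\<epsilon> < \<bar>\<Sum>t\<in>T. c t * d t\<bar>"
  shows "\<exists>t\<in>T. \<epsilon> / ((\<Sum>t\<in>T. \<bar>c t\<bar>) + 1) < \<bar>d t\<bar>"
proof (rule ccontr)
  define \<delta> where "\<delta> = \<epsilon> / ((\<Sum>t\<in>T. \<bar>c t\<bar>) + 1)"
  have nonneg: "0 \<le> (\<Sum>t\<in>T. \<bar>c t\<bar>)" by (simp add: sum_nonneg)
  assume "\<not> ?thesis"
  then have d: "\<bar>d t\<bar> \<le> \<delta>" if "t \<in> T" for t
    using that by (auto simp: \<delta>_def not_less)
  have "\<bar>\<Sum>t\<in>T. c t * d t\<bar> \<le> (\<Sum>t\<in>T. \<bar>c t * d t\<bar>)"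
    by (rule sum_abs)
  also have "\<dots> \<le> (\<Sum>t\<in>T. \<bar>c t\<bar> * \<delta>)"
    unfolding abs_mult by (intro sum_mono mult_left_mono d) auto
  also have "\<dots> = (\<Sum>t\<in>T. \<bar>c t\<bar>) * \<delta>"
    by (simp add: sum_distrib_right)
  also have "\<dots> \<le> ((\<Sum>t\<in>T. \<bar>c t\<bar>) + 1) * \<delta>"
    using nonneg assms(2) by (intro mult_right_mono) (auto simp: \<delta>_def)
  also have "\<dots> = \<epsilon>"
    using nonneg unfolding \<delta>_def by (intro nonzero_mult_div_cancel_left[THEN trans[OF times_divide_eq_right]]) linarith
  finally show False using assms(3) by simp
qed

text \<open>The same combination is taken of the approximating simple functions. Convergence of
  kernels follows from \<open>abs_sum_powr_le\<close>, convergence in probability from a union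
  bound.\<close>

lemma stoch_integral_linear_combination:
  fixes f :: "'t \<Rightarrow> 's \<Rightarrow> real"
  assumes "0 < \<alpha>" and sc: "independently_scattered \<mu> Q M" and T: "finite T"
    and int: "\<And>t. t \<in> T \<Longrightarrow> stoch_integral \<alpha> \<mu> Q M (f t) (Y t)"
  shows "stoch_integral \<alpha> \<mu> Q M (\<lambda>s. \<Sum>t\<in>T. c t * f t s) (\<lambda>\<omega>. \<Sum>t\<in>T. c t * Y t \<omega>)"
proof -
  have fL: "f t \<in> L_space \<alpha> \<mu>" and Ym [measurable]: "Y t \<in> borel_measurable Q" if "t \<in> T" for t
    using int[OF that] by (auto simp: stoch_integral_def)
  then have fm [measurable]: "f t \<in> borel_measurable \<mu>" if "t \<in> T" for t
    using that by (auto simp: L_space_def)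
  define approx where "approx t g \<longleftrightarrow>
        (\<forall>n. simple_function \<mu> (g n) \<and> emeasure \<mu> {s \<in> space \<mu>. g n s \<noteq> 0} < \<infinity>) \<and>
        (\<lambda>n. \<integral>\<^sup>+ s. ennreal (\<bar>g n s - f t s\<bar> powr \<alpha>) \<partial>\<mu>) \<longlonglongrightarrow> 0 \<and>
        (\<forall>\<epsilon>>0. (\<lambda>n. measure Q
            {\<omega> \<in> space Q. \<bar>simple_stoch_integral \<mu> M (g n) \<omega> - Y t \<omega>\<bar> > \<epsilon>}) \<longlonglongrightarrow> 0)"
    for t and g :: "nat \<Rightarrow> 's \<Rightarrow> real"
  have "\<exists>g. approx t g" if "t \<in> T" for t
    using int[OF that] unfolding stoch_integral_def approx_def by (elim conjE)
  then obtain g where "\<And>t. t \<in> T \<Longrightarrow> approx t (g t)"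
    by metis
  then have g: "\<And>t n. t \<in> T \<Longrightarrow> simple_function \<mu> (g t n)"
      "\<And>t n. t \<in> T \<Longrightarrow> emeasure \<mu> {s \<in> space \<mu>. g t n s \<noteq> 0} < \<infinity>"
      "\<And>t. t \<in> T \<Longrightarrow> (\<lambda>n. \<integral>\<^sup>+ s. ennreal (\<bar>g t n s - f t s\<bar> powr \<alpha>) \<partial>\<mu>) \<longlonglongrightarrow> 0"
      "\<And>t \<epsilon>. t \<in> T \<Longrightarrow> 0 < \<epsilon> \<Longrightarrow> (\<lambda>n. measure Q
            {\<omega> \<in> space Q. \<bar>simple_stoch_integral \<mu> M (g t n) \<omega> - Y t \<omega>\<bar> > \<epsilon>}) \<longlonglongrightarrow> 0"
    unfolding approx_def by simp_all
  have gm [measurable]: "g t n \<in> borel_measurable \<mu>" if "t \<in> T" for t n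
    using g(1)[OF that] by (rule borel_measurable_simple_function)
  have Im [measurable]: "simple_stoch_integral \<mu> M (g t n) \<in> borel_measurable Q" if "t \<in> T" for t n
    using g(1,2)[OF that] by (rule simple_stoch_integral_measurable[OF sc])
  define G where "G n s = (\<Sum>t\<in>T. c t * g t n s)" for n s
  have G_simple: "simple_function \<mu> (G n)" for n
    unfolding G_def using g(1) by (intro simple_function_sum simple_function_mult simple_function_const) auto
  have G_fin: "emeasure \<mu> {s \<in> space \<mu>. G n s \<noteq> 0} < \<infinity>" for n
  proof -
    have "emeasure \<mu> {s \<in> space \<mu>. G n s \<noteq> 0} \<le> emeasure \<mu> (\<Union>t\<in>T. {s \<in> space \<mu>. g t n s \<noteq> 0})"
      using T by (intro emeasure_mono) (auto simp: G_def intro!: sum.neutral)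
    also have "\<dots> \<le> (\<Sum>t\<in>T. emeasure \<mu> {s \<in> space \<mu>. g t n s \<noteq> 0})"
      using T by (intro emeasure_subadditive_finite) auto
    also have "\<dots> < \<infinity>"
      using T g(2) by (auto simp: less_top[symmetric] top_unique)
    finally show ?thesis .
  qed
  have conv: "(\<lambda>n. \<integral>\<^sup>+ s. ennreal (\<bar>G n s - (\<Sum>t\<in>T. c t * f t s)\<bar> powr \<alpha>) \<partial>\<mu>) \<longlonglongrightarrow> 0"
  proof (rule tendsto_sandwich[OF _ _ tendsto_const])
    let ?C = "\<lambda>t. ennreal (real (card T) powr \<alpha> * \<bar>c t\<bar> powr \<alpha>)"
    let ?U = "\<lambda>n. \<Sum>t\<in>T. ?C t * (\<integral>\<^sup>+ s. ennreal (\<bar>g t n s - f t s\<bar> powr \<alpha>) \<partial>\<mu>)"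
    show "\<forall>\<^sub>F n in sequentially. (\<integral>\<^sup>+ s. ennreal (\<bar>G n s - (\<Sum>t\<in>T. c t * f t s)\<bar> powr \<alpha>) \<partial>\<mu>) \<le> ?U n"
    proof (rule always_eventually, rule allI)
      fix n
      have "(\<integral>\<^sup>+ s. ennreal (\<bar>G n s - (\<Sum>t\<in>T. c t * f t s)\<bar> powr \<alpha>) \<partial>\<mu>)
          \<le> (\<integral>\<^sup>+ s. (\<Sum>t\<in>T. ?C t * ennreal (\<bar>g t n s - f t s\<bar> powr \<alpha>)) \<partial>\<mu>)"
      proof (rule nn_integral_mono)
        fix s
        have "\<bar>G n s - (\<Sum>t\<in>T. c t * f t s)\<bar> powr \<alpha> = \<bar>\<Sum>t\<in>T. c t * (g t n s - f t s)\<bar> powr \<alpha>"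
          by (simp add: G_def right_diff_distrib sum_subtractf)
        also have "\<dots> \<le> real (card T) powr \<alpha> * (\<Sum>t\<in>T. \<bar>c t * (g t n s - f t s)\<bar> powr \<alpha>)"
          by (rule abs_sum_powr_le[OF T \<open>0 < \<alpha>\<close>])
        also have "\<dots> = (\<Sum>t\<in>T. (real (card T) powr \<alpha> * \<bar>c t\<bar> powr \<alpha>) * \<bar>g t n s - f t s\<bar> powr \<alpha>)"
          by (simp add: sum_distrib_left abs_mult powr_mult mult.assoc)
        finally show "ennreal (\<bar>G n s - (\<Sum>t\<in>T. c t * f t s)\<bar> powr \<alpha>)
            \<le> (\<Sum>t\<in>T. ?C t * ennreal (\<bar>g t n s - f t s\<bar> powr \<alpha>))"
          by (simp add: ennreal_mult[symmetric] sum_ennreal ennreal_leI)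
      qed
      also have "\<dots> = ?U n"
        by (subst nn_integral_sum) (auto simp: nn_integral_cmult)
      finally show "(\<integral>\<^sup>+ s. ennreal (\<bar>G n s - (\<Sum>t\<in>T. c t * f t s)\<bar> powr \<alpha>) \<partial>\<mu>) \<le> ?U n" .
    qed
    have "?U \<longlonglongrightarrow> (\<Sum>t\<in>T. ?C t * 0)"
      by (intro tendsto_sum ennreal_tendsto_cmult g(3)) auto
    then show "?U \<longlonglongrightarrow> 0" by simp
  qed simp
  interpret prob_space Q
    using sc by (simp add: independently_scattered_def)
  have prob: "(\<lambda>n. measure Q {\<omega> \<in> space Q.
      \<bar>simple_stoch_integral \<mu> M (G n) \<omega> - (\<Sum>t\<in>T. c t * Y t \<omega>)\<bar> > \<epsilon>}) \<longlonglongrightarrow> 0" if "0 < \<epsilon>" for \<epsilon>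
  proof (rule tendsto_sandwich[OF _ _ tendsto_const])
    define \<delta> where "\<delta> = \<epsilon> / ((\<Sum>t\<in>T. \<bar>c t\<bar>) + 1)"
    have "0 < \<delta>"
      unfolding \<delta>_def using \<open>0 < \<epsilon>\<close> by (intro divide_pos_pos add_nonneg_pos sum_nonneg) auto
    define E where "E n t = {\<omega> \<in> space Q. \<bar>simple_stoch_integral \<mu> M (g t n) \<omega> - Y t \<omega>\<bar> > \<delta>}" for n t
    have Em [measurable]: "E n t \<in> sets Q" if "t \<in> T" for n t
      unfolding E_def using that by measurable
    show "\<forall>\<^sub>F n in sequentially. measure Q {\<omega> \<in> space Q.
      \<bar>simple_stoch_integral \<mu> M (G n) \<omega> - (\<Sum>t\<in>T. c t * Y t \<omega>)\<bar> > \<epsilon>} \<le> (\<Sum>t\<in>T. measure Q (E n t))"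
    proof (rule always_eventually, rule allI)
      fix n
      have "AE \<omega> in Q. simple_stoch_integral \<mu> M (G n) \<omega> = (\<Sum>t\<in>T. c t * simple_stoch_integral \<mu> M (g t n) \<omega>)"
        unfolding G_def by (intro simple_stoch_integral_linear_combination sc T g)
      then have "AE \<omega> in Q. \<omega> \<in> {\<omega> \<in> space Q.
          \<bar>simple_stoch_integral \<mu> M (G n) \<omega> - (\<Sum>t\<in>T. c t * Y t \<omega>)\<bar> > \<epsilon>} \<longrightarrow> \<omega> \<in> (\<Union>t\<in>T. E n t)"
      proof eventually_elim
        case (elim \<omega>)
        show ?case
        proof
          assume \<omega>: "\<omega> \<in> {\<omega> \<in> space Q. \<bar>simple_stoch_integral \<mu> M (G n) \<omega> - (\<Sum>t\<in>T. c t * Y t \<omega>)\<bar> > \<epsilon>}"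
          then have "\<epsilon> < \<bar>\<Sum>t\<in>T. c t * (simple_stoch_integral \<mu> M (g t n) \<omega> - Y t \<omega>)\<bar>"
            by (simp add: elim right_diff_distrib sum_subtractf)
          from abs_sum_gt_imp_ex[OF T \<open>0 < \<epsilon>\<close> this] show "\<omega> \<in> (\<Union>t\<in>T. E n t)"
            using \<omega> by (auto simp: E_def \<delta>_def)
        qed
      qed
      then have "measure Q {\<omega> \<in> space Q.
          \<bar>simple_stoch_integral \<mu> M (G n) \<omega> - (\<Sum>t\<in>T. c t * Y t \<omega>)\<bar> > \<epsilon>} \<le> measure Q (\<Union>t\<in>T. E n t)"
        using T by (intro finite_measure_mono_AE) auto
      also have "\<dots> \<le> (\<Sum>t\<in>T. measure Q (E n t))"
        using T by (intro finite_measure_subadditive_finite) auto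
      finally show "measure Q {\<omega> \<in> space Q.
          \<bar>simple_stoch_integral \<mu> M (G n) \<omega> - (\<Sum>t\<in>T. c t * Y t \<omega>)\<bar> > \<epsilon>} \<le> (\<Sum>t\<in>T. measure Q (E n t))" .
    qed
    have "(\<lambda>n. \<Sum>t\<in>T. measure Q (E n t)) \<longlonglongrightarrow> (\<Sum>t\<in>T. 0)"
      unfolding E_def using \<open>0 < \<delta>\<close> by (intro tendsto_sum g(4)) auto
    then show "(\<lambda>n. \<Sum>t\<in>T. measure Q (E n t)) \<longlonglongrightarrow> 0" by simp
  qed simp
  show ?thesis
    unfolding stoch_integral_def
  proof (intro conjI exI[of _ G] allI impI)
    show "(\<lambda>s. \<Sum>t\<in>T. c t * f t s) \<in> L_space \<alpha> \<mu>"
      by (rule L_space_linear_combination[OF \<open>0 < \<alpha>\<close> T fL])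
    show "(\<lambda>\<omega>. \<Sum>t\<in>T. c t * Y t \<omega>) \<in> borel_measurable Q" by measurable
  qed (use G_simple G_fin conv prob in auto)
qed

text \<open>Factoring through the finite-dimensional law lets \<open>fdd_equal\<close> act on linear
  combinations.\<close>

lemma distr_linear_combination:
  fixes Z :: "'t \<Rightarrow> 'w \<Rightarrow> real"
  assumes "\<And>t. Z t \<in> borel_measurable N"
  shows "distr N borel (\<lambda>\<omega>. \<Sum>t\<in>T. c t * Z t \<omega>) =
    distr (distr N (\<Pi>\<^sub>M t\<in>T. borel) (\<lambda>\<omega>. \<lambda>t\<in>T. Z t \<omega>)) borel (\<lambda>p. \<Sum>t\<in>T. c t * p t)"
proof -
  have "distr (distr N (\<Pi>\<^sub>M t\<in>T. borel) (\<lambda>\<omega>. \<lambda>t\<in>T. Z t \<omega>)) borel (\<lambda>p. \<Sum>t\<in>T. c t * p t)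
      = distr N borel ((\<lambda>p. \<Sum>t\<in>T. c t * p t) \<circ> (\<lambda>\<omega>. \<lambda>t\<in>T. Z t \<omega>))"
    using assms by (intro distr_distr measurable_restrict) measurable
  also have "(\<lambda>p. \<Sum>t\<in>T. c t * p t) \<circ> (\<lambda>\<omega>. \<lambda>t\<in>T. Z t \<omega>) = (\<lambda>\<omega>. \<Sum>t\<in>T. c t * Z t \<omega>)"
    by (auto simp: fun_eq_iff)
  finally show ?thesis by (rule sym)
qed

text \<open>By linearity the combination of the field has the law of the integral of the combined
  kernel. Hence the law of the field fixes the \<open>\<alpha>\<close>-integrals of all linear
  combinations of kernels.\<close>

lemma char_integral_representation:
  assumes "0 < \<alpha>" and rep: "integral_representation \<alpha> P X \<mu> Q M f"
    and X: "random_field P X" and T: "finite T"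
  shows "char (distr P borel (\<lambda>\<omega>. \<Sum>t\<in>T. c t * X t \<omega>)) \<theta> =
    of_real (exp (- (\<bar>\<theta>\<bar> powr \<alpha>) * (\<integral>s. \<bar>\<Sum>t\<in>T. c t * f t s\<bar> powr \<alpha> \<partial>\<mu>)))"
proof -
  obtain Y where Y: "\<And>t. stoch_integral \<alpha> \<mu> Q M (f t) (Y t)" and eq: "fdd_equal P X Q Y"
    using rep by (auto simp: integral_representation_def)
  have sas: "sas_random_measure \<alpha> \<mu> Q M"
    using rep by (simp add: integral_representation_def)
  then have sc: "independently_scattered \<mu> Q M" by (simp add: sas_random_measure_def)
  have Xm: "X t \<in> borel_measurable P" for t
    using X by (simp add: random_field_def)
  have Ym: "Y t \<in> borel_measurable Q" for t
    using Y[of t] by (simp add: stoch_integral_def)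
  have "distr P borel (\<lambda>\<omega>. \<Sum>t\<in>T. c t * X t \<omega>) = distr Q borel (\<lambda>\<omega>. \<Sum>t\<in>T. c t * Y t \<omega>)"
    using eq T unfolding fdd_equal_def by (simp add: distr_linear_combination[of X, OF Xm] distr_linear_combination[of Y, OF Ym])
  moreover have int: "stoch_integral \<alpha> \<mu> Q M (\<lambda>s. \<Sum>t\<in>T. c t * f t s) (\<lambda>\<omega>. \<Sum>t\<in>T. c t * Y t \<omega>)"
    by (rule stoch_integral_linear_combination[OF \<open>0 < \<alpha>\<close> sc T Y])
  moreover have "(\<lambda>s. \<Sum>t\<in>T. c t * f t s) \<in> L_space \<alpha> \<mu>"
    using int by (simp add: stoch_integral_def)
  ultimately show ?thesis
    using sas by (simp add: sas_random_measure_def)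
qed

section \<open>Generated representations\<close>

text \<open>Bridge between the extended sums of the theorem and the real summability used along
  orbits.\<close>

lemma summable_on_iff_infsum_ennreal:
  fixes g :: "'a \<Rightarrow> real"
  assumes g: "\<And>t. 0 \<le> g t"
  shows "(\<Sum>\<^sub>\<infinity>t. ennreal (g t)) < \<infinity> \<longleftrightarrow> g summable_on UNIV"
proof -
  have sum: "(\<Sum>t\<in>F. ennreal (g t)) = ennreal (sum g F)" for F
    using g by (simp add: sum_ennreal)
  have SUP: "(\<Sum>\<^sub>\<infinity>t. ennreal (g t)) = (SUP F\<in>{F. finite F \<and> F \<subseteq> UNIV}. ennreal (sum g F))"
    by (subst nonneg_infsum_complete) (auto simp: sum)
  show ?thesis
  proof
    assume fin: "(\<Sum>\<^sub>\<infinity>t. ennreal (g t)) < \<infinity>"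
    then obtain r where r: "0 \<le> r" "(\<Sum>\<^sub>\<infinity>t. ennreal (g t)) = ennreal r"
      by (cases "\<Sum>\<^sub>\<infinity>t. ennreal (g t)") auto
    have "sum g F \<le> r" if "finite F" for F
    proof -
      have "ennreal (sum g F) \<le> ennreal r"
        unfolding r(2)[symmetric] SUP using that by (intro SUP_upper) auto
      then show ?thesis using r(1) by simp
    qed
    then show "g summable_on UNIV"
      using g by (intro nonneg_bdd_above_summable_on bdd_aboveI[of _ r]) auto
  next
    assume sm: "g summable_on UNIV"
    have "(\<Sum>\<^sub>\<infinity>t. ennreal (g t)) \<le> ennreal (infsum g UNIV)"
      unfolding SUP using g by (intro SUP_least ennreal_leI finite_sum_le_infsum[OF sm]) auto
    also have "\<dots> < \<infinity>" by simp
    finally show "(\<Sum>\<^sub>\<infinity>t. ennreal (g t)) < \<infinity>" .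
  qed
qed

section \<open>Radon--Nikodym derivatives of the action\<close>

lemma nonsingular_action_AE:
  assumes "nonsingular_action \<mu> \<phi>" "AE s in \<mu>. P s"
  shows "AE s in \<mu>. P (\<phi> t s)"
proof -
  have act: "group_action \<mu> \<phi>" and ac: "absolutely_continuous \<mu> (measure_comp \<mu> (\<phi> (- t)))"
    using assms(1) by (auto simp: nonsingular_action_def)
  have comp: "measure_comp \<mu> (\<phi> (- t)) = distr \<mu> \<mu> (\<phi> t)"
    using group_action_measure_comp[OF act, of "- t"] by simp
  have "AE s in distr \<mu> \<mu> (\<phi> t). P s"
    by (rule absolutely_continuous_AE[OF _ ac[unfolded comp] assms(2)]) simp
  then show ?thesis
    by (rule AE_distrD[OF group_action_facts(1)[OF act]])
qed

definition jacobian :: "'s measure \<Rightarrow> (int ^ 'd \<Rightarrow> 's \<Rightarrow> 's) \<Rightarrow> int ^ 'd \<Rightarrow> 's \<Rightarrow> real" where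
  "jacobian \<mu> \<phi> t s = enn2real (RN_deriv \<mu> (measure_comp \<mu> (\<phi> t)) s)"

lemma jacobian_measurable [measurable]: "jacobian \<mu> \<phi> t \<in> borel_measurable \<mu>"
  unfolding jacobian_def by measurable

text \<open>A further image under \<open>\<phi> t\<close> restores \<open>\<mu>\<close>, so the
  image measure is sigma-finite and its derivative is finite almost everywhere. Passing to reals by
  \<open>enn2real\<close> therefore loses nothing.\<close>

lemma density_jacobian:
  assumes sf: "sigma_finite_measure \<mu>" and ns: "nonsingular_action \<mu> \<phi>"
  shows "density \<mu> (\<lambda>s. ennreal (jacobian \<mu> \<phi> t s)) = distr \<mu> \<mu> (\<phi> (- t))"
    and "AE s in \<mu>. RN_deriv \<mu> (measure_comp \<mu> (\<phi> t)) s = ennreal (jacobian \<mu> \<phi> t s)"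
proof -
  interpret sigma_finite_measure \<mu> by fact
  have act: "group_action \<mu> \<phi>" and ac: "absolutely_continuous \<mu> (measure_comp \<mu> (\<phi> t))"
    using ns by (auto simp: nonsingular_action_def)
  note facts = group_action_facts[OF act]
  have comp: "measure_comp \<mu> (\<phi> t) = distr \<mu> \<mu> (\<phi> (- t))"
    by (rule group_action_measure_comp[OF act])
  have sf': "sigma_finite_measure (distr \<mu> \<mu> (\<phi> (- t)))"
  proof (rule sigma_finite_measure_distr)
    have "distr (distr \<mu> \<mu> (\<phi> (- t))) \<mu> (\<phi> t) = distr \<mu> \<mu> (\<phi> t \<circ> \<phi> (- t))"
      by (rule distr_distr) (rule facts(1))+
    also have "\<dots> = distr \<mu> \<mu> (\<lambda>s. s)"
      by (rule distr_cong) (simp_all add: facts(6))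
    also have "\<dots> = \<mu>" by (rule distr_id)
    finally show "sigma_finite_measure (distr (distr \<mu> \<mu> (\<phi> (- t))) \<mu> (\<phi> t))"
      using sf by simp
    show "\<phi> t \<in> distr \<mu> \<mu> (\<phi> (- t)) \<rightarrow>\<^sub>M \<mu>"
      using facts(1)[of t] by simp
  qed
  have "AE s in \<mu>. RN_deriv \<mu> (measure_comp \<mu> (\<phi> t)) s \<noteq> \<infinity>"
    using sf' ac by (intro RN_deriv_finite) (auto simp: comp)
  then show AE: "AE s in \<mu>. RN_deriv \<mu> (measure_comp \<mu> (\<phi> t)) s = ennreal (jacobian \<mu> \<phi> t s)"
    by eventually_elim (simp add: jacobian_def less_top[symmetric])
  have "density \<mu> (\<lambda>s. ennreal (jacobian \<mu> \<phi> t s)) = density \<mu> (RN_deriv \<mu> (measure_comp \<mu> (\<phi> t)))"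
    by (rule density_cong) (use AE in auto)
  also have "\<dots> = measure_comp \<mu> (\<phi> t)"
    using ac by (intro density_RN_deriv) (auto simp: comp)
  finally show "density \<mu> (\<lambda>s. ennreal (jacobian \<mu> \<phi> t s)) = distr \<mu> \<mu> (\<phi> (- t))"
    by (simp add: comp)
qed

text \<open>The zero set of a density is null for the measure it defines; the second half of
  nonsingularity transfers this to \<open>\<mu>\<close>.\<close>

lemma jacobian_pos:
  assumes sf: "sigma_finite_measure \<mu>" and ns: "nonsingular_action \<mu> \<phi>"
  shows "AE s in \<mu>. 0 < jacobian \<mu> \<phi> t s"
proof -
  have act: "group_action \<mu> \<phi>" and ac: "absolutely_continuous (measure_comp \<mu> (\<phi> t)) \<mu>"
    using ns by (auto simp: nonsingular_action_def)
  have comp: "measure_comp \<mu> (\<phi> t) = density \<mu> (\<lambda>s. ennreal (jacobian \<mu> \<phi> t s))"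
    by (simp add: group_action_measure_comp[OF act] density_jacobian[OF sf ns])
  have "AE s in density \<mu> (\<lambda>s. ennreal (jacobian \<mu> \<phi> t s)). 0 < jacobian \<mu> \<phi> t s"
    by (subst AE_density) auto
  then show ?thesis
    by (rule absolutely_continuous_AE[OF _ ac[unfolded comp], rotated]) simp
qed

text \<open>Two changes of variables show that the product is a density of
  \<open>measure_comp \<mu> (\<phi> (u + t))\<close>, and densities are unique almost
  everywhere.\<close>

lemma jacobian_add:
  assumes sf: "sigma_finite_measure \<mu>" and ns: "nonsingular_action \<mu> \<phi>"
  shows "AE s in \<mu>. jacobian \<mu> \<phi> (u + t) s = jacobian \<mu> \<phi> t s * jacobian \<mu> \<phi> u (\<phi> t s)"
proof -
  interpret sigma_finite_measure \<mu> by fact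
  have act: "group_action \<mu> \<phi>"
    using ns by (auto simp: nonsingular_action_def)
  note facts = group_action_facts[OF act]
  note facts(1)[measurable]
  let ?j = "jacobian \<mu> \<phi>"
  have change: "(\<integral>\<^sup>+s. ennreal (?j t s) * g s \<partial>\<mu>) = (\<integral>\<^sup>+s. g (\<phi> (- t) s) \<partial>\<mu>)"
    if [measurable]: "g \<in> borel_measurable \<mu>" for g t
  proof -
    have "(\<integral>\<^sup>+s. ennreal (?j t s) * g s \<partial>\<mu>) = (\<integral>\<^sup>+s. g s \<partial>density \<mu> (\<lambda>s. ennreal (?j t s)))"
      by (subst nn_integral_density) auto
    also have "\<dots> = (\<integral>\<^sup>+s. g (\<phi> (- t) s) \<partial>\<mu>)"
      unfolding density_jacobian(1)[OF sf ns] by (subst nn_integral_distr) auto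
    finally show ?thesis .
  qed
  have "density \<mu> (\<lambda>s. ennreal (?j t s * ?j u (\<phi> t s))) = measure_comp \<mu> (\<phi> (u + t))"
  proof (rule measure_eqI)
    show "sets (density \<mu> (\<lambda>s. ennreal (?j t s * ?j u (\<phi> t s)))) = sets (measure_comp \<mu> (\<phi> (u + t)))"
      by (simp add: group_action_measure_comp[OF act])
    fix A assume "A \<in> sets (density \<mu> (\<lambda>s. ennreal (?j t s * ?j u (\<phi> t s))))"
    then have [measurable]: "A \<in> sets \<mu>" by simp
    have "emeasure (density \<mu> (\<lambda>s. ennreal (?j t s * ?j u (\<phi> t s)))) A
        = (\<integral>\<^sup>+s. ennreal (?j t s) * (ennreal (?j u (\<phi> t s)) * indicator A s) \<partial>\<mu>)"
      by (subst emeasure_density) (auto simp: ennreal_mult jacobian_def mult.assoc)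
    also have "\<dots> = (\<integral>\<^sup>+s. ennreal (?j u (\<phi> t (\<phi> (- t) s))) * indicator A (\<phi> (- t) s) \<partial>\<mu>)"
      by (rule change) measurable
    also have "\<dots> = (\<integral>\<^sup>+s. ennreal (?j u s) * indicator A (\<phi> (- t) s) \<partial>\<mu>)"
      by (rule nn_integral_cong) (simp add: facts(6))
    also have "\<dots> = (\<integral>\<^sup>+s. indicator A (\<phi> (- t) (\<phi> (- u) s)) \<partial>\<mu>)"
      by (rule change) measurable
    also have "\<dots> = (\<integral>\<^sup>+s. indicator A (\<phi> (- (u + t)) s) \<partial>\<mu>)"
    proof (rule nn_integral_cong)
      fix s assume "s \<in> space \<mu>"
      then have "\<phi> (- t) (\<phi> (- u) s) = \<phi> (- t + - u) s"
        by (rule facts(4))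
      also have "- t + - u = - (u + t)"
        by simp
      finally show "(indicator A (\<phi> (- t) (\<phi> (- u) s)) :: ennreal) = indicator A (\<phi> (- (u + t)) s)"
        by simp
    qed
    also have "\<dots> = (\<integral>\<^sup>+s. indicator A s \<partial>distr \<mu> \<mu> (\<phi> (- (u + t))))"
      by (rule nn_integral_distr[symmetric]) measurable
    also have "\<dots> = emeasure (measure_comp \<mu> (\<phi> (u + t))) A"
      by (simp add: group_action_measure_comp[OF act])
    finally show "emeasure (density \<mu> (\<lambda>s. ennreal (?j t s * ?j u (\<phi> t s)))) A
        = emeasure (measure_comp \<mu> (\<phi> (u + t))) A" .
  qed
  then have "AE s in \<mu>. ennreal (?j t s * ?j u (\<phi> t s)) = RN_deriv \<mu> (measure_comp \<mu> (\<phi> (u + t))) s"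
    by (intro RN_deriv_unique) measurable
  then show ?thesis
  proof eventually_elim
    case (elim s)
    have "?j (u + t) s = enn2real (ennreal (?j t s * ?j u (\<phi> t s)))"
      unfolding elim by (rule jacobian_def)
    then show ?case by (simp add: jacobian_def)
  qed
qed

text \<open>The almost everywhere relations hold everywhere on an invariant set of full measure. Outside
  of it the weights are set to \<open>1\<close> and the functions to \<open>0\<close>.\<close>

lemma generated_representation_scaled_action:
  assumes "0 < \<alpha>" and gen: "generated_representation \<alpha> P X \<mu> Q M \<phi> c h f"
  obtains w G where "scaled_action \<mu> \<phi> w G" "AE s in \<mu>. \<forall>t. G t s = \<bar>f t s\<bar> powr \<alpha>"
proof -
  have sf: "sigma_finite_measure \<mu>" and fL: "\<And>t. f t \<in> L_space \<alpha> \<mu>"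
    and ns: "nonsingular_action \<mu> \<phi>" and coc: "cocycle \<mu> \<phi> c" and hL: "h \<in> L_space \<alpha> \<mu>"
    and f: "\<And>t. AE s in \<mu>. f t s = c t s * jacobian \<mu> \<phi> t s powr (1 / \<alpha>) * h (\<phi> t s)"
    and supp: "eq_mod \<mu> (\<Union>t. {s \<in> space \<mu>. f t s \<noteq> 0}) (space \<mu>)"
    using gen by (auto simp: generated_representation_def integral_representation_def jacobian_def)
  have act: "group_action \<mu> \<phi>" using ns by (simp add: nonsingular_action_def)
  note facts = group_action_facts[OF act]
  note facts(1)[measurable]
  have [measurable]: "h \<in> borel_measurable \<mu>" "f t \<in> borel_measurable \<mu>" for t
    using hL fL[of t] by (auto simp: L_space_def)
  let ?j = "jacobian \<mu> \<phi>"
  define good where "good s \<longleftrightarrow> (\<forall>t. 0 < ?j t s) \<and> (\<forall>u t. ?j (u + t) s = ?j t s * ?j u (\<phi> t s))" for s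
  \<comment> \<open>Asking for \<open>good\<close> along the whole orbit makes the set invariant;
    since the lattice is countable, it keeps full measure.\<close>
  define S0 where "S0 = {s \<in> space \<mu>. \<forall>v. good (\<phi> v s)}"
  have "AE s in \<mu>. good s"
    unfolding good_def AE_conj_iff AE_all_countable using jacobian_pos[OF sf ns] jacobian_add[OF sf ns]
    by blast
  then have "AE s in \<mu>. \<forall>v. good (\<phi> v s)"
    unfolding AE_all_countable using nonsingular_action_AE[OF ns] by blast
  then have AE_S0: "AE s in \<mu>. s \<in> S0"
    using AE_space by eventually_elim (simp add: S0_def)
  have S0_sets [measurable]: "S0 \<in> sets \<mu>"
    unfolding S0_def good_def by measurable
  have S0_good: "0 < ?j t s" "?j (u + t) s = ?j t s * ?j u (\<phi> t s)" if "s \<in> S0" for s t u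
  proof -
    have "good (\<phi> 0 s)" "s \<in> space \<mu>"
      using that by (auto simp: S0_def)
    then show "0 < ?j t s" "?j (u + t) s = ?j t s * ?j u (\<phi> t s)"
      by (auto simp: good_def facts(3))
  qed
  have S0_imp: "\<phi> t s \<in> S0" if "s \<in> S0" for t s
    using that by (auto simp: S0_def facts(2,4))
  have S0_iff: "\<phi> t s \<in> S0 \<longleftrightarrow> s \<in> S0" if "s \<in> space \<mu>" for t s
    using S0_imp[of s t] S0_imp[of "\<phi> t s" "- t"] facts(5)[OF that] by auto
  \<comment> \<open>Off \<open>S0\<close> the default \<open>1\<close> preserves positivity of the
    weight, and the default \<open>0\<close> of \<open>G\<close> makes the transformation law
    trivial.\<close>
  define w where "w t s = (if s \<in> S0 then ?j t s else 1)" for t s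
  define G where "G t s = (if s \<in> S0 then ?j t s * \<bar>h (\<phi> t s)\<bar> powr \<alpha> else 0)" for t s
  have G_measurable: "G t \<in> borel_measurable \<mu>" for t
    unfolding G_def by measurable
  have AE_G: "AE s in \<mu>. \<forall>t. G t s = \<bar>f t s\<bar> powr \<alpha>"
    unfolding AE_all_countable
  proof
    fix t
    show "AE s in \<mu>. G t s = \<bar>f t s\<bar> powr \<alpha>"
      using f[of t] AE_S0 AE_space
    proof eventually_elim
      case (elim s)
      have "c t s \<in> {- 1, 1}"
        using coc elim(3) by (simp add: cocycle_def)
      then have "\<bar>c t s\<bar> = 1" by auto
      then have "\<bar>f t s\<bar> = ?j t s powr (1 / \<alpha>) * \<bar>h (\<phi> t s)\<bar>"
        by (simp add: elim(1) abs_mult)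
      then show ?case
        using elim(2) S0_good(1)[OF elim(2), of t] \<open>0 < \<alpha>\<close> by (simp add: G_def powr_mult powr_powr)
    qed
  qed
  have "scaled_action \<mu> \<phi> w G"
  proof
    show "group_action \<mu> \<phi>" by fact
    show "w t \<in> borel_measurable \<mu>" for t
      unfolding w_def by measurable
    show "0 < w t s" for t s
      by (simp add: w_def S0_good(1))
    show "density \<mu> (\<lambda>s. ennreal (w t s)) = distr \<mu> \<mu> (\<phi> (- t))" for t
    proof -
      have "density \<mu> (\<lambda>s. ennreal (w t s)) = density \<mu> (\<lambda>s. ennreal (?j t s))"
      proof (rule density_cong)
        show "AE s in \<mu>. ennreal (w t s) = ennreal (?j t s)"
          using AE_S0 by eventually_elim (simp add: w_def)
      qed (auto simp: w_def[abs_def])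
      then show ?thesis by (simp add: density_jacobian[OF sf ns])
    qed
    show "G t \<in> borel_measurable \<mu>" for t by (rule G_measurable)
    show "0 \<le> G t s" for t s
      using S0_good(1)[of s t] by (simp add: G_def less_imp_le)
    show "G (u + t) s = w t s * G u (\<phi> t s)" if "s \<in> space \<mu>" for t u s
      using S0_good(2)[of s u t] that by (simp add: G_def w_def S0_iff facts(4))
    have "integrable \<mu> (\<lambda>s. \<bar>f 0 s\<bar> powr \<alpha>)"
      using fL[of 0] by (simp add: L_space_def)
    moreover have "AE s in \<mu>. G 0 s = \<bar>f 0 s\<bar> powr \<alpha>"
      using AE_G by eventually_elim simp
    ultimately show "integrable \<mu> (G 0)"
      by (subst integrable_cong_AE[of _ _ "\<lambda>s. \<bar>f 0 s\<bar> powr \<alpha>"]) (use G_measurable in auto)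
    show "AE s in \<mu>. \<exists>t. G t s \<noteq> 0"
      using AE_G supp AE_space unfolding eq_mod_def by eventually_elim auto
  qed
  then show thesis using AE_G by (rule that)
qed

text \<open>Characteristic functions at \<open>1\<close> equate the
  \<open>\<alpha>\<close>-integrals of all linear combinations. Averaging over Gaussian coefficients
  produces the two sides times a common moment, which cancels.\<close>

lemma nn_integral_lp_cong:
  assumes "0 < \<alpha>" "\<alpha> < 2" and X: "random_field P X" and T: "finite T"
    and rep1: "integral_representation \<alpha> P X \<mu>1 Q1 M1 f1"
    and rep2: "integral_representation \<alpha> P X \<mu>2 Q2 M2 f2"
  shows "(\<integral>\<^sup>+s. ennreal ((\<Sum>t\<in>T. (f1 t s)\<^sup>2) powr (\<alpha> / 2)) \<partial>\<mu>1)
       = (\<integral>\<^sup>+s. ennreal ((\<Sum>t\<in>T. (f2 t s)\<^sup>2) powr (\<alpha> / 2)) \<partial>\<mu>2)"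
proof -
  have L: "f1 t \<in> L_space \<alpha> \<mu>1" "f2 t \<in> L_space \<alpha> \<mu>2" for t
    using rep1 rep2 by (simp_all add: integral_representation_def)
  have sf: "sigma_finite_measure \<mu>1" "sigma_finite_measure \<mu>2"
    using rep1 rep2 by (simp_all add: integral_representation_def)
  have m: "f1 t \<in> borel_measurable \<mu>1" "f2 t \<in> borel_measurable \<mu>2" for t
    using L[of t] by (auto simp: L_space_def)
  have eq: "(\<integral>\<^sup>+s. ennreal (\<bar>\<Sum>t\<in>T. c t * f1 t s\<bar> powr \<alpha>) \<partial>\<mu>1)
      = (\<integral>\<^sup>+s. ennreal (\<bar>\<Sum>t\<in>T. c t * f2 t s\<bar> powr \<alpha>) \<partial>\<mu>2)" for c
  proof -
    have "(\<integral>s. \<bar>\<Sum>t\<in>T. c t * f1 t s\<bar> powr \<alpha> \<partial>\<mu>1) = (\<integral>s. \<bar>\<Sum>t\<in>T. c t * f2 t s\<bar> powr \<alpha> \<partial>\<mu>2)"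
      using char_integral_representation[OF \<open>0 < \<alpha>\<close> rep1 X T, of c 1]
        char_integral_representation[OF \<open>0 < \<alpha>\<close> rep2 X T, of c 1]
      by (simp del: of_real_exp add: of_real_eq_iff)
    moreover have "integrable \<mu>1 (\<lambda>s. \<bar>\<Sum>t\<in>T. c t * f1 t s\<bar> powr \<alpha>)"
      "integrable \<mu>2 (\<lambda>s. \<bar>\<Sum>t\<in>T. c t * f2 t s\<bar> powr \<alpha>)"
      using L_space_linear_combination[OF \<open>0 < \<alpha>\<close> T L(1), of c]
        L_space_linear_combination[OF \<open>0 < \<alpha>\<close> T L(2), of c] by (simp_all add: L_space_def)
    ultimately show ?thesis
      by (simp add: nn_integral_eq_integral)
  qed
  have "(\<integral>\<^sup>+s. ennreal ((\<Sum>t\<in>T. (f1 t s)\<^sup>2) powr (\<alpha> / 2)) \<partial>\<mu>1) * gauss_moment \<alpha>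
      = (\<integral>\<^sup>+s. ennreal ((\<Sum>t\<in>T. (f2 t s)\<^sup>2) powr (\<alpha> / 2)) \<partial>\<mu>2) * gauss_moment \<alpha>"
    unfolding gauss_average_nn_integral[OF sf(1) m(1) T \<open>0 < \<alpha>\<close>, symmetric]
      gauss_average_nn_integral[OF sf(2) m(2) T \<open>0 < \<alpha>\<close>, symmetric] eq ..
  then show ?thesis
    using gauss_moment_pos[of \<alpha>] gauss_moment_finite[OF assms(1,2)]
    by (auto simp: mult.commute[of _ "gauss_moment \<alpha>"] ennreal_mult_cancel_left less_top)
qed

lemma (in scaled_action) lp_mass_eq_nn_integral:
  assumes "0 < \<alpha>" and f: "\<And>t. f t \<in> borel_measurable \<mu>"
    and G: "AE s in \<mu>. \<forall>t. G t s = \<bar>f t s\<bar> powr \<alpha>"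
  shows "lp_mass (2 / \<alpha>) T = enn2real (\<integral>\<^sup>+s. ennreal ((\<Sum>t\<in>T. (f t s)\<^sup>2) powr (\<alpha> / 2)) \<partial>\<mu>)"
proof -
  note f [measurable]
  have "lp_mass (2 / \<alpha>) T = (\<integral>s. (\<Sum>t\<in>T. (f t s)\<^sup>2) powr (\<alpha> / 2) \<partial>\<mu>)"
    unfolding lp_mass_def
  proof (rule integral_cong_AE)
    show "AE s in \<mu>. (\<Sum>t\<in>T. G t s powr (2 / \<alpha>)) powr (1 / (2 / \<alpha>)) = (\<Sum>t\<in>T. (f t s)\<^sup>2) powr (\<alpha> / 2)"
      using G
    proof eventually_elim
      case (elim s)
      have "G t s powr (2 / \<alpha>) = (f t s)\<^sup>2" for t
        using \<open>0 < \<alpha>\<close> elim by (simp add: powr_powr)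
      then show ?case by simp
    qed
  qed measurable
  then show ?thesis
    by (simp add: integral_eq_nn_integral)
qed

section \<open>Consequences for generated representations\<close>

context
  fixes \<alpha> :: real
  assumes \<alpha>: "0 < \<alpha>" "\<alpha> < 2"
begin

lemma generated_representation_hopf:
  assumes gen: "generated_representation \<alpha> P X \<mu> Q M \<phi> c h f"
    and hopf: "hopf_decomposition \<mu> \<phi> C D"
  shows "eq_mod \<mu> C {s \<in> space \<mu>. (\<Sum>\<^sub>\<infinity>t. ennreal (\<bar>f t s\<bar> powr \<alpha>)) = \<infinity>}"
    and "eq_mod \<mu> D {s \<in> space \<mu>. (\<Sum>\<^sub>\<infinity>t. ennreal (\<bar>f t s\<bar> powr \<alpha>)) < \<infinity>}"
proof -
  obtain w G where sa: "scaled_action \<mu> \<phi> w G" and G: "AE s in \<mu>. \<forall>t. G t s = \<bar>f t s\<bar> powr \<alpha>"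
    using generated_representation_scaled_action[OF \<alpha>(1) gen] .
  interpret scaled_action \<mu> \<phi> w G by fact
  have CD: "C \<inter> D = {}" "C \<union> D = space \<mu>"
    using hopf by (simp_all add: hopf_decomposition_def)
  have *: "AE s in \<mu>. s \<in> D \<longleftrightarrow> (\<Sum>\<^sub>\<infinity>t. ennreal (\<bar>f t s\<bar> powr \<alpha>)) < \<infinity>"
    using hopf_orbit_summable[OF hopf] G AE_space
  proof eventually_elim
    case (elim s)
    then show ?case
      using summable_on_iff_infsum_ennreal[of "\<lambda>t. \<bar>f t s\<bar> powr \<alpha>"]
      by (simp add: orbit_summable_def)
  qed
  then show "eq_mod \<mu> D {s \<in> space \<mu>. (\<Sum>\<^sub>\<infinity>t. ennreal (\<bar>f t s\<bar> powr \<alpha>)) < \<infinity>}"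
    unfolding eq_mod_def using AE_space by eventually_elim simp
  show "eq_mod \<mu> C {s \<in> space \<mu>. (\<Sum>\<^sub>\<infinity>t. ennreal (\<bar>f t s\<bar> powr \<alpha>)) = \<infinity>}"
    unfolding eq_mod_def using * AE_space
    by eventually_elim (use CD in \<open>auto simp: less_top\<close>)
qed

text \<open>Both criteria involve only the integrals of \<open>G 0\<close> over the summable set and
  over the whole space, and \<open>lp_mass\<close> determines each of them.\<close>

lemma generated_representation_rigidity:
  assumes X: "random_field P X"
    and gen1: "generated_representation \<alpha> P X \<mu>1 Q1 M1 \<phi>1 c1 h1 f1"
    and gen2: "generated_representation \<alpha> P X \<mu>2 Q2 M2 \<phi>2 c2 h2 f2"
  shows "conservative_action \<mu>1 \<phi>1 \<longleftrightarrow> conservative_action \<mu>2 \<phi>2"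
    and "dissipative_action \<mu>1 \<phi>1 \<longleftrightarrow> dissipative_action \<mu>2 \<phi>2"
proof -
  obtain w1 G1 where sa1: "scaled_action \<mu>1 \<phi>1 w1 G1"
    and G1: "AE s in \<mu>1. \<forall>t. G1 t s = \<bar>f1 t s\<bar> powr \<alpha>"
    using generated_representation_scaled_action[OF \<alpha>(1) gen1] .
  obtain w2 G2 where sa2: "scaled_action \<mu>2 \<phi>2 w2 G2"
    and G2: "AE s in \<mu>2. \<forall>t. G2 t s = \<bar>f2 t s\<bar> powr \<alpha>"
    using generated_representation_scaled_action[OF \<alpha>(1) gen2] .
  interpret A: scaled_action \<mu>1 \<phi>1 w1 G1 by fact
  interpret B: scaled_action \<mu>2 \<phi>2 w2 G2 by fact
  have rep: "integral_representation \<alpha> P X \<mu>1 Q1 M1 f1" "integral_representation \<alpha> P X \<mu>2 Q2 M2 f2"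
    using gen1 gen2 by (simp_all add: generated_representation_def)
  then have m: "f1 t \<in> borel_measurable \<mu>1" "f2 t \<in> borel_measurable \<mu>2" for t
    by (simp_all add: integral_representation_def L_space_def)
  have lp: "A.lp_mass (2 / \<alpha>) T = B.lp_mass (2 / \<alpha>) T" if "finite T" for T
    unfolding A.lp_mass_eq_nn_integral[OF \<alpha>(1) m(1) G1] B.lp_mass_eq_nn_integral[OF \<alpha>(1) m(2) G2]
    using nn_integral_lp_cong[OF \<alpha> X that rep] by simp
  have "(\<integral>s. indicator A.orbit_summable s * G1 0 s \<partial>\<mu>1) = (\<integral>s. indicator B.orbit_summable s * G2 0 s \<partial>\<mu>2)"
    using \<alpha> by (intro integral_orbit_summable_cong[OF sa1 sa2 _ lp]) auto
  \<comment> \<open>The singleton \<open>{0}\<close> as index set yields the total integral.\<close>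
  moreover have "(\<integral>s. G1 0 s \<partial>\<mu>1) = (\<integral>s. G2 0 s \<partial>\<mu>2)"
    using lp[of "{0}"] \<alpha>(1) by (simp add: A.lp_mass_def B.lp_mass_def powr_powr)
  ultimately show "conservative_action \<mu>1 \<phi>1 \<longleftrightarrow> conservative_action \<mu>2 \<phi>2"
    and "dissipative_action \<mu>1 \<phi>1 \<longleftrightarrow> dissipative_action \<mu>2 \<phi>2"
    by (simp_all add: A.conservative_action_iff_integral B.conservative_action_iff_integral
        A.dissipative_action_iff_integral B.dissipative_action_iff_integral)
qed

text \<open>The two properties together make \<open>\<mu>\<close> the zero measure, so all kernels
  have integral zero and every linear combination of the field is degenerate at \<open>0\<close>,
  which counts as Gaussian.\<close>

lemma gaussian_of_conservative_dissipative:
  assumes X: "random_field P X"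
    and gen: "generated_representation \<alpha> P X \<mu> Q M \<phi> c h f"
    and "conservative_action \<mu> \<phi>" "dissipative_action \<mu> \<phi>"
  shows "gaussian_field P X"
proof -
  obtain w G where sa: "scaled_action \<mu> \<phi> w G"
    using generated_representation_scaled_action[OF \<alpha>(1) gen] .
  interpret scaled_action \<mu> \<phi> w G by fact
  have null: "AE s in \<mu>. False"
    using assms(3,4) unfolding conservative_action_iff dissipative_action_iff
    by eventually_elim simp
  have rep: "integral_representation \<alpha> P X \<mu> Q M f"
    using gen by (simp add: generated_representation_def)
  have zero: "(\<integral>s. g s \<partial>\<mu>) = 0" for g :: "_ \<Rightarrow> real"
    by (rule integral_eq_zero_AE) (use null in eventually_elim, simp)
  have "gaussian_law (distr P borel (\<lambda>\<omega>. \<Sum>t\<in>J. c t * X t \<omega>))" if "finite J" for J c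
    unfolding gaussian_law_def
    by (intro exI[of _ 0] conjI allI)
      (simp_all add: char_integral_representation[OF \<alpha>(1) rep X that] zero)
  then show ?thesis
    using X by (simp add: gaussian_field_def)
qed

end

theorem proposition3p1:
  fixes \<alpha> :: real
  assumes "0 < \<alpha>" and "\<alpha> < 2"
  shows
    "(\<forall>(P :: 'w measure) (X :: (int ^ 'd) \<Rightarrow> 'w \<Rightarrow> real)
        (\<mu> :: 's measure) (Q :: 'v measure) M \<phi> c h f C D.
        stationary_sas_field \<alpha> P X \<longrightarrow>
        generated_representation \<alpha> P X \<mu> Q M \<phi> c h f \<longrightarrow>
        hopf_decomposition \<mu> \<phi> C D \<longrightarrow>
          eq_mod \<mu> C {s \<in> space \<mu>. (\<Sum>\<^sub>\<infinity>t. ennreal (\<bar>f t s\<bar> powr \<alpha>)) = \<infinity>} \<and>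
          eq_mod \<mu> D {s \<in> space \<mu>. (\<Sum>\<^sub>\<infinity>t. ennreal (\<bar>f t s\<bar> powr \<alpha>)) < \<infinity>})
     \<and>
     (\<forall>(P :: 'w measure) (X :: (int ^ 'd) \<Rightarrow> 'w \<Rightarrow> real)
        (\<mu>' :: 's2 measure) (Q' :: 'v2 measure) M' \<phi>' c' h' f'.
        generated_representation \<alpha> P X \<mu>' Q' M' \<phi>' c' h' f' \<longrightarrow>
          ((P, X) \<in> conservative_fields TYPE('s \<times> 'v) \<alpha> \<longrightarrow> conservative_action \<mu>' \<phi>') \<and>
          ((P, X) \<in> dissipative_fields TYPE('s \<times> 'v) \<alpha> \<longrightarrow> dissipative_action \<mu>' \<phi>'))
     \<and>
     (conservative_fields TYPE('s \<times> 'v) \<alpha> ::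
        ('w measure \<times> ((int ^ 'd) \<Rightarrow> 'w \<Rightarrow> real)) set)
       \<inter> dissipative_fields TYPE('s2 \<times> 'v2) \<alpha> = {}"
proof (intro conjI)
  have cons: "conservative_action \<mu>' \<phi>'"
    if gen': "generated_representation \<alpha> P X \<mu>' Q' M' \<phi>' c' h' f'"
      and PX: "(P, X) \<in> conservative_fields TYPE('s \<times> 'v) \<alpha>"
    for P :: "'w measure" and X :: "(int ^ 'd) \<Rightarrow> 'w \<Rightarrow> real"
      and \<mu>' :: "'s2 measure" and Q' :: "'v2 measure" and M' \<phi>' c' h' f'
  proof -
    obtain \<mu> :: "'s measure" and Q :: "'v measure" and M \<phi> c h f
      where gen: "generated_representation \<alpha> P X \<mu> Q M \<phi> c h f" and "conservative_action \<mu> \<phi>"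
      using PX unfolding conservative_fields_def by blast
    moreover have "random_field P X"
      using PX by (auto simp: conservative_fields_def stationary_sas_field_def sas_field_def)
    ultimately show ?thesis
      using generated_representation_rigidity(1)[OF assms _ gen gen'] by blast
  qed
  have diss: "dissipative_action \<mu>' \<phi>'"
    if gen': "generated_representation \<alpha> P X \<mu>' Q' M' \<phi>' c' h' f'"
      and PX: "(P, X) \<in> dissipative_fields TYPE('s \<times> 'v) \<alpha>"
    for P :: "'w measure" and X :: "(int ^ 'd) \<Rightarrow> 'w \<Rightarrow> real"
      and \<mu>' :: "'s2 measure" and Q' :: "'v2 measure" and M' \<phi>' c' h' f'
  proof -
    obtain \<mu> :: "'s measure" and Q :: "'v measure" and M \<phi> c h f
      where gen: "generated_representation \<alpha> P X \<mu> Q M \<phi> c h f" and "dissipative_action \<mu> \<phi>"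
      using PX unfolding dissipative_fields_def by blast
    moreover have "random_field P X"
      using PX by (auto simp: dissipative_fields_def stationary_sas_field_def sas_field_def)
    ultimately show ?thesis
      using generated_representation_rigidity(2)[OF assms _ gen gen'] by blast
  qed
  show "\<forall>(P :: 'w measure) (X :: (int ^ 'd) \<Rightarrow> 'w \<Rightarrow> real)
        (\<mu> :: 's measure) (Q :: 'v measure) M \<phi> c h f C D.
        stationary_sas_field \<alpha> P X \<longrightarrow>
        generated_representation \<alpha> P X \<mu> Q M \<phi> c h f \<longrightarrow>
        hopf_decomposition \<mu> \<phi> C D \<longrightarrow>
          eq_mod \<mu> C {s \<in> space \<mu>. (\<Sum>\<^sub>\<infinity>t. ennreal (\<bar>f t s\<bar> powr \<alpha>)) = \<infinity>} \<and>
          eq_mod \<mu> D {s \<in> space \<mu>. (\<Sum>\<^sub>\<infinity>t. ennreal (\<bar>f t s\<bar> powr \<alpha>)) < \<infinity>}"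
    by (intro allI impI conjI generated_representation_hopf[OF assms])
  show "\<forall>(P :: 'w measure) (X :: (int ^ 'd) \<Rightarrow> 'w \<Rightarrow> real)
        (\<mu>' :: 's2 measure) (Q' :: 'v2 measure) M' \<phi>' c' h' f'.
        generated_representation \<alpha> P X \<mu>' Q' M' \<phi>' c' h' f' \<longrightarrow>
          ((P, X) \<in> conservative_fields TYPE('s \<times> 'v) \<alpha> \<longrightarrow> conservative_action \<mu>' \<phi>') \<and>
          ((P, X) \<in> dissipative_fields TYPE('s \<times> 'v) \<alpha> \<longrightarrow> dissipative_action \<mu>' \<phi>')"
    by (intro allI impI conjI) (rule cons diss, assumption+)+
  show "(conservative_fields TYPE('s \<times> 'v) \<alpha> ::
        ('w measure \<times> ((int ^ 'd) \<Rightarrow> 'w \<Rightarrow> real)) set)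
       \<inter> dissipative_fields TYPE('s2 \<times> 'v2) \<alpha> = {}"
  proof (intro equals0I)
    fix PX :: "'w measure \<times> ((int ^ 'd) \<Rightarrow> 'w \<Rightarrow> real)"
    assume PX: "PX \<in> conservative_fields TYPE('s \<times> 'v) \<alpha> \<inter> dissipative_fields TYPE('s2 \<times> 'v2) \<alpha>"
    obtain P X where [simp]: "PX = (P, X)" by (cases PX)
    have stat: "stationary_sas_field \<alpha> P X"
      using PX by (auto simp: conservative_fields_def)
    obtain \<mu>' :: "'s2 measure" and Q' :: "'v2 measure" and M' \<phi>' c' h' f'
      where gen': "generated_representation \<alpha> P X \<mu>' Q' M' \<phi>' c' h' f'" and "dissipative_action \<mu>' \<phi>'"
      using PX unfolding dissipative_fields_def by auto
    \<comment> \<open>Rigidity carries conservativity over to the representation with the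
      dissipative action, where both properties then hold at once.\<close>
    moreover have "conservative_action \<mu>' \<phi>'"
      using cons[OF gen'] PX by simp
    ultimately have "gaussian_field P X"
      using stat by (intro gaussian_of_conservative_dissipative[OF assms _ gen'])
        (auto simp: stationary_sas_field_def sas_field_def)
    then show False
      using stat by (simp add: stationary_sas_field_def)
  qed
qed

end
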